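(* Let $m\ge 0$ and $n=3m+2$. Let $t\ge 1$ and write $t=3s+\varepsilon$ with integers $s\ge 0$ and $\varepsilon\in\{1,2,3\}$. Then the connectivity of $I(G_{n,t})$ equals $2mt+2(s-1)+\varepsilon$.
   Context: For a finite simple graph $G$, $I(G)$ is its independence complex (simplicial complex on $V(G)$ whose simplices are the independent sets). The connectivity of a space $X$ is the largest $k$ such that $X$ is $k$-connected (so the connectivity of $S^k$ is $k-1$). For integers $n\ge 2$, $t\ge 0$, the graph $G_{n,t}$ (the line graph of a row of $t$ $(2n)$-gons, so $I(G_{n,t})$ is the matching complex of that tiling) has vertex set $\{a_0,\dots,a_t\}\cup\{b_{i,j},c_{i,j}: 1\le i\le t,\ 1\le j\le n-1\}$, and its edges are exactly: $b_{i,j}\sim b_{i,j+1}$ and $c_{i,j}\sim c_{i,j+1}$ for $1\le i\le t$, $1\le j\le n-2$; $b_{i,n-1}\sim b_{i+1,1}$ and $c_{i,n-1}\sim c_{i+1,1}$ for $1\le i\le t-1$; and $a_{i-1}\sim b_{i,1}$, $a_{i-1}\sim c_{i,1}$, $a_i\sim b_{i,n-1}$, $a_i\sim c_{i,n-1}$ for $1\le i\le t$. *)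

theory Defs
  imports "HOL-Analysis.Analysis"
begin

datatype vtx = A nat | B nat nat | C nat nat

definition Gverts :: "nat \<Rightarrow> nat \<Rightarrow> vtx set" where
  "Gverts n t = A ` {0..t} \<union> (\<Union>i\<in>{1..t}. \<Union>j\<in>{1..n-1}. {B i j, C i j})"

definition Gedge0 :: "nat \<Rightarrow> nat \<Rightarrow> vtx \<Rightarrow> vtx \<Rightarrow> bool" where
  "Gedge0 n t u v \<longleftrightarrow>
     (\<exists>i j. 1 \<le> i \<and> i \<le> t \<and> 1 \<le> j \<and> j \<le> n - 2 \<and>
        ((u = B i j \<and> v = B i (j+1)) \<or> (u = C i j \<and> v = C i (j+1)))) \<or>
     (\<exists>i. 1 \<le> i \<and> i \<le> t - 1 \<and>
        ((u = B i (n-1) \<and> v = B (i+1) 1) \<or> (u = C i (n-1) \<and> v = C (i+1) 1))) \<or>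
     (\<exists>i. 1 \<le> i \<and> i \<le> t \<and>
        ((u = A (i-1) \<and> v = B i 1) \<or> (u = A (i-1) \<and> v = C i 1) \<or>
         (u = A i \<and> v = B i (n-1)) \<or> (u = A i \<and> v = C i (n-1))))"

definition Gedge :: "nat \<Rightarrow> nat \<Rightarrow> vtx \<Rightarrow> vtx \<Rightarrow> bool" where
  "Gedge n t u v \<longleftrightarrow> Gedge0 n t u v \<or> Gedge0 n t v u"

definition indep_complex :: "'a set \<Rightarrow> ('a \<Rightarrow> 'a \<Rightarrow> bool) \<Rightarrow> 'a set set" where
  "indep_complex V E = {S. S \<subseteq> V \<and> finite S \<and> (\<forall>u\<in>S. \<forall>v\<in>S. \<not> E u v)}"

(* geometric realization of a (finite) simplicial complex K given by its simplices:
   barycentric-coordinate functions whose support is a nonempty simplex *)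
definition geom_real :: "'a set set \<Rightarrow> ('a \<Rightarrow> real) topology" where
  "geom_real K = subtopology (powertop_real UNIV)
     {f. (\<forall>v. 0 \<le> f v) \<and> {v. f v \<noteq> 0} \<in> K \<and> sum f {v. f v \<noteq> 0} = 1}"

(* X is k-connected (k \<ge> -1): nonempty, and every map S^i \<rightarrow> X with 0 \<le> i \<le> k is
   null-homotopic (i.e. \<pi>_i(X) trivial) *)
definition k_connected :: "int \<Rightarrow> 'a topology \<Rightarrow> bool" where
  "k_connected k X \<longleftrightarrow> (k \<ge> -1 \<longrightarrow> topspace X \<noteq> {}) \<and>
     (\<forall>i::nat. int i \<le> k \<longrightarrow> (\<forall>f. continuous_map (nsphere i) X f \<longrightarrow>
        (\<exists>c. homotopic_with (\<lambda>x. True) (nsphere i) X f (\<lambda>x. c))))"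

definition connectivity_eq :: "'a topology \<Rightarrow> int \<Rightarrow> bool" where
  "connectivity_eq X k \<longleftrightarrow> k_connected k X \<and> \<not> k_connected (k + 1) X"

end

theory Submission
  imports Defs "HOL-Homology.Homology"
begin

text \<open>
  Lower bound: if deleting a vertex from a complex leaves a \<open>k\<close>-connected complex and its link is
  \<open>(k - 1)\<close>-connected, then the complex is \<open>k\<close>-connected. Applied to independence complexes, this
  allows one to delete dominated vertices and to remove a leaf with the closed neighbourhood of its
  neighbour at the cost of one dimension. Branching on a first path vertex or on a polygon vertex
  \<open>a\<^sub>k\<close> then gives a recursion that steps by one, two or three polygons.

  Upper bound: contracting a path \<open>x - p - q - w\<close> with inner vertices of degree two desuspends the
  independence complex, by an explicit formula in barycentric coordinates. This reduces \<open>n\<close> to 2, with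
  one isolated edge for every contracted path. The result retracts onto the independence complex of a
  matching, together with an 8-cycle if \<open>t\<close> is divisible by 3. Up to homotopy, the independence complex
  of \<open>d + 1\<close> disjoint edges dominates the \<open>d\<close>-sphere, whose identity map is not null-homotopic.
\<close>

section \<open>Extension of maps over boxes\<close>

text \<open>\<open>k_connected\<close> speaks about all continuous maps from spheres, so the lower
  bound has to handle arbitrary maps: a sphere is replaced by the boundary of a cube, cut so finely
  that the weight of the chosen vertex hardly varies on a cell, and the map is rebuilt cell by cell.
  The upper bound never needs a homotopy equivalence. Connectivity passes to every space dominated
  up to homotopy, so a reduction consists of two explicit maps, one composition of which is joined
  to the identity inside simplices. The number in the theorem counts disjoint edges. For
  \<open>n = 3 * m + 2\<close> each of the \<open>2 * t\<close> paths has \<open>3 * m + 1\<close>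
  vertices; \<open>m\<close> contractions shrink it to one vertex and split off \<open>m\<close>
  edges. In the remaining ladder three polygons fold to two edges, and the last
  \<open>\<epsilon>\<close> polygons account for \<open>\<epsilon>\<close> edges; for
  \<open>\<epsilon> = 3\<close> the 8-cycle is kept, since folding everything would leave an
  isolated vertex. A matching with \<open>2 * m * t + 2 * s + \<epsilon>\<close> edges has a sphere
  of one dimension less as independence complex, and the connectivity of that sphere is smaller by
  another one.\<close>

definition sphere_set :: "nat \<Rightarrow> (nat \<Rightarrow> real) set" where
  "sphere_set n = {x. (\<Sum>i\<le>n. x i ^ 2) = 1 \<and> (\<forall>i>n. x i = 0)}"

lemma nsphere_eq: "nsphere n = top_of_set (sphere_set n)"
  by (simp add: nsphere sphere_set_def euclidean_product_topology)

lemma continuous_on_coordinate: "continuous_on S (\<lambda>x::'a \<Rightarrow> real. x i)"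
  by (rule continuous_on_subset[OF continuous_on_product_coordinates]) auto

abbreviation homotopic_in ::
  "'a::topological_space set \<Rightarrow> 'b::topological_space set \<Rightarrow> ('a \<Rightarrow> 'b) \<Rightarrow> ('a \<Rightarrow> 'b) \<Rightarrow> bool" where
  "homotopic_in X Y f g \<equiv> homotopic_with_canon (\<lambda>_. True) X Y f g"

lemma k_connected_set:
  "k_connected k (top_of_set S) \<longleftrightarrow> (k \<ge> -1 \<longrightarrow> S \<noteq> {}) \<and>
     (\<forall>i f. int i \<le> k \<longrightarrow> continuous_on (sphere_set i) f \<longrightarrow> f \<in> sphere_set i \<rightarrow> S \<longrightarrow>
        (\<exists>c. homotopic_in (sphere_set i) S f (\<lambda>_. c)))"
  unfolding k_connected_def nsphere_eq by auto

text \<open>The straight-line homotopy. Its continuity is checked in each coordinate, as functions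
  carry the product topology.\<close>

lemma homotopic_linear_fun:
  fixes f g :: "'z::topological_space \<Rightarrow> 'a \<Rightarrow> real"
  assumes "continuous_on Z f" "continuous_on Z g"
    and sub: "\<And>x s. x \<in> Z \<Longrightarrow> 0 \<le> s \<Longrightarrow> s \<le> 1 \<Longrightarrow> (\<lambda>u. (1 - s) * f x u + s * g x u) \<in> T"
  shows "homotopic_in Z T f g"
  unfolding homotopic_with_def
proof (intro exI conjI)
  let ?h = "\<lambda>z. (\<lambda>u. (1 - fst z) * f (snd z) u + fst z * g (snd z) u)"
  have "continuous_on ({0..1::real} \<times> Z) (\<lambda>z. f (snd z))" "continuous_on ({0..1::real} \<times> Z) (\<lambda>z. g (snd z))"
    by (intro continuous_on_compose2[OF assms(1)] continuous_on_compose2[OF assms(2)] continuous_on_snd continuous_on_id; auto)+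
  then have "continuous_on ({0..1} \<times> Z) ?h"
    by (intro continuous_on_coordinatewise_then_product continuous_on_add continuous_on_mult continuous_on_diff
        continuous_on_fst continuous_on_id continuous_on_const) (erule continuous_on_product_then_coordinatewise)+
  moreover have "?h \<in> {0..1} \<times> Z \<rightarrow> T"
    using sub by auto
  ultimately show "continuous_map (prod_topology (top_of_set {0..1}) (top_of_set Z)) (top_of_set T) ?h"
    by (simp add: prod_topology_subtopology_eu)
qed auto

lemma homotopic_in_compose_left:
  assumes "homotopic_in X Y f g" "continuous_on Y h" "h \<in> Y \<rightarrow> Z"
  shows "homotopic_in X Z (h \<circ> f) (h \<circ> g)"
  using assms by (intro homotopic_with_compose_continuous_map_left[where p="\<lambda>_. True"]) auto

lemma homotopic_in_compose_right:
  assumes "homotopic_in X Y f g" "continuous_on Z h" "h \<in> Z \<rightarrow> X"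
  shows "homotopic_in Z Y (f \<circ> h) (g \<circ> h)"
  using assms by (intro homotopic_with_compose_continuous_map_right[where p="\<lambda>_. True"]) auto

lemma homotopic_in_eq:
  assumes "continuous_on X f" "f \<in> X \<rightarrow> Y" "\<And>x. x \<in> X \<Longrightarrow> f x = g x"
  shows "homotopic_in X Y f g"
  by (rule homotopic_with_equal) (use assms in auto)

text \<open>Half of a homotopy equivalence: \<open>Y\<close> is a retract of \<open>X\<close> up to
  homotopy.\<close>

definition dominates :: "'a::topological_space set \<Rightarrow> 'b::topological_space set \<Rightarrow> bool" where
  "dominates X Y \<longleftrightarrow> (\<exists>f g. continuous_on X f \<and> f \<in> X \<rightarrow> Y \<and> continuous_on Y g \<and> g \<in> Y \<rightarrow> X \<and>
      homotopic_in Y Y (f \<circ> g) id)"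

text \<open>A sphere in \<open>Y\<close> is carried to \<open>X\<close>, contracted there and
  carried back; the homotopy from \<open>f \<circ> g\<close> to the identity links the result with
  the original map.\<close>

lemma k_connected_dominates:
  assumes "dominates X Y" "k_connected k (top_of_set X)"
  shows "k_connected k (top_of_set Y)"
proof -
  obtain f g where f: "continuous_on X f" "f \<in> X \<rightarrow> Y" and g: "continuous_on Y g" "g \<in> Y \<rightarrow> X"
    and fg: "homotopic_in Y Y (f \<circ> g) id"
    using assms(1) by (auto simp: dominates_def)
  show ?thesis unfolding k_connected_set
  proof (intro conjI allI impI)
    assume "k \<ge> -1" then show "Y \<noteq> {}"
      using assms(2) f by (auto simp: k_connected_set)
  next
    fix i h assume i: "int i \<le> k" and h: "continuous_on (sphere_set i) h" "h \<in> sphere_set i \<rightarrow> Y"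
    have "continuous_on (sphere_set i) (g \<circ> h)" "g \<circ> h \<in> sphere_set i \<rightarrow> X"
      unfolding o_def using continuous_on_compose2[OF g(1) h(1)] g(2) h(2) by (auto simp: image_subset_iff_funcset)
    then obtain c where "homotopic_in (sphere_set i) X (g \<circ> h) (\<lambda>_. c)"
      using assms(2) i unfolding k_connected_set by blast
    from homotopic_in_compose_left[OF this f]
    have "homotopic_in (sphere_set i) Y (f \<circ> g \<circ> h) (\<lambda>_. f c)" by (simp add: o_def)
    moreover have "homotopic_in (sphere_set i) Y (f \<circ> g \<circ> h) (id \<circ> h)"
      by (rule homotopic_in_compose_right[OF fg h])
    ultimately have "homotopic_in (sphere_set i) Y h (\<lambda>_. f c)"
      by (metis homotopic_with_symD homotopic_with_trans id_comp)
    then show "\<exists>c. homotopic_in (sphere_set i) Y h (\<lambda>_. c)" by blast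
  qed
qed

definition nbox :: "(nat \<Rightarrow> real) \<Rightarrow> (nat \<Rightarrow> real) \<Rightarrow> (nat \<Rightarrow> real) set" where
  "nbox a b = {x. \<forall>j. a j \<le> x j \<and> x j \<le> b j}"

text \<open>Coordinates with \<open>a j = b j\<close> do not count, so this is the boundary relative
  to the dimension of the box itself; a box that is a single point has empty boundary.\<close>

definition nbox_bd :: "(nat \<Rightarrow> real) \<Rightarrow> (nat \<Rightarrow> real) \<Rightarrow> (nat \<Rightarrow> real) set" where
  "nbox_bd a b = {x \<in> nbox a b. \<exists>j. a j < b j \<and> (x j = a j \<or> x j = b j)}"

lemma continuous_on_Max:
  fixes f :: "'i \<Rightarrow> 'a::topological_space \<Rightarrow> real"
  assumes "finite I" "I \<noteq> {}" "\<And>i. i \<in> I \<Longrightarrow> continuous_on S (f i)"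
  shows "continuous_on S (\<lambda>x. Max ((\<lambda>i. f i x) ` I))"
  using assms
proof (induction I rule: finite_ne_induct)
  case (insert i I)
  then have "continuous_on S (\<lambda>x. max (f i x) (Max ((\<lambda>i. f i x) ` I)))"
    by (intro continuous_on_max) auto
  then show ?case using insert by simp
qed auto

text \<open>Rescaling the \<open>d + 1\<close> nondegenerate coordinates turns the box into the unit
  ball of the maximum norm. Then \<open>r\<close> is that norm, and \<open>p\<close> and
  \<open>q\<close> are the radial projections between its unit sphere and the Euclidean one. The
  bound \<open>1/2\<close> keeps \<open>q\<close> away from the centre, where radial projection has
  no value.\<close>

lemma sphere_box:
  assumes ab: "\<And>j. a j \<le> b j" and J: "finite {j. a j < b j}" "card {j. a j < b j} = Suc d"
  obtains p q r where
    "continuous_on (sphere_set d) p" "p \<in> sphere_set d \<rightarrow> nbox_bd a b"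
    "continuous_on (nbox a b) r"
    "continuous_on {x \<in> nbox a b. r x \<ge> (1/2::real)} q" "q \<in> {x \<in> nbox a b. r x \<ge> 1/2} \<rightarrow> sphere_set d"
    "\<And>x. x \<in> nbox_bd a b \<Longrightarrow> r x = 1 \<and> p (q x) = x"
    "\<And>x. x \<in> sphere_set d \<Longrightarrow> q (p x) = x"
proof -
  let ?J = "{j. a j < b j}"
  obtain e where e: "bij_betw e {..d} ?J"
    using J by (metis card_atMost finite_atMost finite_same_card_bij)
  define e' where "e' = inv_into {..d} e"
  have e'e: "e' (e i) = i" if "i \<le> d" for i
    using that e by (simp add: e'_def bij_betw_inv_into_left)
  have ee': "e (e' j) = j" "e' j \<le> d" if "a j < b j" for j
    using that e bij_betw_inv_into_right[OF e, of j] inv_into_into[of j e "{..d}"]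
    by (auto simp: e'_def bij_betw_def)
  have eJ: "a (e i) < b (e i)" if "i \<le> d" for i
    using that e by (auto simp: bij_betw_def)
  define mx where "mx y = Max ((\<lambda>i. \<bar>y i\<bar>) ` {..d})" for y :: "nat \<Rightarrow> real"
  define nr where "nr y = sqrt (\<Sum>i\<le>d. (y i)\<^sup>2)" for y :: "nat \<Rightarrow> real"
  \<comment> \<open>Midpoint and half width of each side. \<open>Ps\<close> maps the cube of side 2
    affinely onto the box, and \<open>Ph\<close> inverts it.\<close>
  define m where "m j = (a j + b j) / 2" for j
  define h where "h j = (b j - a j) / 2" for j
  define Ps where "Ps y = (\<lambda>j. if a j < b j then m j + h j * y (e' j) else a j)" for y :: "nat \<Rightarrow> real"
  define Ph where "Ph x = (\<lambda>i. if i \<le> d then (x (e i) - m (e i)) / h (e i) else 0)" for x :: "nat \<Rightarrow> real"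
  have h0: "h j > 0" if "a j < b j" for j using that by (simp add: h_def)
  have mx_ge: "\<bar>y i\<bar> \<le> mx y" if "i \<le> d" for y i
    unfolding mx_def by (rule Max_ge) (use that in auto)
  have mx_ex: "\<exists>i\<le>d. mx y = \<bar>y i\<bar>" for y
  proof -
    have "Max ((\<lambda>i. \<bar>y i\<bar>) ` {..d}) \<in> (\<lambda>i. \<bar>y i\<bar>) ` {..d}" by (rule Max_in) auto
    then show ?thesis unfolding mx_def by (auto simp del: Max_in)
  qed
  have nr_pos: "nr y > 0 \<longleftrightarrow> mx y > 0" for y
  proof -
    have "nr y > 0 \<longleftrightarrow> (\<exists>i\<le>d. y i \<noteq> 0)"
      unfolding nr_def by (simp add: sum_nonneg less_le sum_nonneg_eq_0_iff) blast
    moreover have "mx y > 0 \<longleftrightarrow> (\<exists>i\<le>d. y i \<noteq> 0)"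
      using mx_ex[of y] mx_ge[of _ y] by (metis abs_ge_zero less_le_trans zero_less_abs_iff)
    ultimately show ?thesis by simp
  qed
  have mx_scale: "mx (\<lambda>i. y i / c) = mx y / c" if "c > 0" for y c
  proof -
    obtain i where i: "i \<le> d" "mx (\<lambda>i. y i / c) = \<bar>y i / c\<bar>" using mx_ex by blast
    obtain j where j: "j \<le> d" "mx y = \<bar>y j\<bar>" using mx_ex by blast
    have "\<bar>y i\<bar> / c \<le> mx y / c" using that mx_ge[OF i(1)] by (simp add: divide_right_mono)
    moreover have "\<bar>y j / c\<bar> \<le> mx (\<lambda>i. y i / c)" using mx_ge[OF j(1), of "\<lambda>i. y i / c"] .
    ultimately show ?thesis using i j that by (auto intro: antisym)
  qed
  have nr_scale: "nr (\<lambda>i. y i / c) = nr y / c" if "c > 0" for y c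
    using that unfolding nr_def power_divide sum_divide_distrib[symmetric] real_sqrt_divide by simp
  have sph: "x \<in> sphere_set d \<longleftrightarrow> nr x = 1 \<and> (\<forall>i>d. x i = 0)" for x
    by (auto simp: sphere_set_def nr_def)
  have PhPs: "Ph (Ps y) = y" if "\<And>i. i > d \<Longrightarrow> y i = 0" for y
  proof
    fix i show "Ph (Ps y) i = y i"
      using that[of i] eJ[of i] h0[of "e i"] by (cases "i \<le> d") (auto simp: Ph_def Ps_def e'e)
  qed
  have PsPh: "Ps (Ph x) = x" if "x \<in> nbox a b" for x
  proof
    fix j show "Ps (Ph x) j = x j"
    proof (cases "a j < b j")
      case True
      with h0[OF True] show ?thesis by (simp add: Ps_def Ph_def ee')
    next
      case False
      moreover have "a j \<le> x j" "x j \<le> b j" using that by (auto simp: nbox_def)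
      ultimately show ?thesis by (simp add: Ps_def)
    qed
  qed
  have Ps_bd: "Ps y \<in> nbox_bd a b" if "mx y = 1" for y
  proof -
    have le: "\<bar>y i\<bar> \<le> 1" if "i \<le> d" for i using mx_ge[OF that, of y] \<open>mx y = 1\<close> by simp
    have "\<bar>h j * y (e' j)\<bar> \<le> h j" if "a j < b j" for j
      using h0[OF that] le[OF ee'(2)[OF that]] by (simp add: abs_mult mult_left_le)
    then have *: "- h j \<le> h j * y (e' j) \<and> h j * y (e' j) \<le> h j" if "a j < b j" for j
      using that by (fastforce simp: abs_le_iff)
    have mh: "m j - h j = a j" "m j + h j = b j" for j
      by (simp_all add: m_def h_def field_simps)
    have "a j \<le> Ps y j \<and> Ps y j \<le> b j" for j
    proof (cases "a j < b j")
      case True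
      then have "Ps y j = m j + h j * y (e' j)" by (simp add: Ps_def)
      then show ?thesis using *[OF True] mh[of j] by linarith
    next
      case False
      then show ?thesis using ab[of j] by (simp add: Ps_def)
    qed
    then have 1: "Ps y \<in> nbox a b" by (simp add: nbox_def)
    obtain i where i: "i \<le> d" "\<bar>y i\<bar> = 1" using mx_ex[of y] \<open>mx y = 1\<close> by auto
    have "Ps y (e i) = a (e i) \<or> Ps y (e i) = b (e i)"
      using i eJ[OF i(1)] by (cases "y i \<ge> 0") (auto simp: Ps_def e'e m_def h_def field_simps)
    then show ?thesis using 1 eJ[OF i(1)] by (auto simp: nbox_bd_def)
  qed
  have mx_Ph: "mx (Ph x) = 1" if "x \<in> nbox_bd a b" for x
  proof (rule antisym)
    obtain i where i: "i \<le> d" "mx (Ph x) = \<bar>Ph x i\<bar>" using mx_ex by blast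
    have "a (e i) \<le> x (e i)" "x (e i) \<le> b (e i)" using that by (auto simp: nbox_bd_def nbox_def)
    then have "\<bar>x (e i) - m (e i)\<bar> \<le> h (e i)" by (auto simp: m_def h_def abs_le_iff field_simps)
    then show "mx (Ph x) \<le> 1" using i h0[OF eJ[OF i(1)]] by (simp add: Ph_def abs_divide)
    obtain j where j: "a j < b j" "x j = a j \<or> x j = b j" using \<open>x \<in> nbox_bd a b\<close> unfolding nbox_bd_def by blast
    have "\<bar>Ph x (e' j)\<bar> = 1" using j by (auto simp: Ph_def ee' m_def h_def field_simps)
    then show "1 \<le> mx (Ph x)" using mx_ge[OF ee'(2)[OF j(1)], of "Ph x"] by simp
  qed
  have cmx: "continuous_on S mx" for S
    unfolding mx_def
    by (intro continuous_on_Max continuous_intros continuous_on_coordinate) auto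
  have cnr: "continuous_on S nr" for S
    unfolding nr_def by (intro continuous_intros continuous_on_coordinate)
  have cPh: "continuous_on S Ph" for S
  proof (rule continuous_on_coordinatewise_then_product)
    fix i show "continuous_on S (\<lambda>x. Ph x i)"
      using eJ[of i] h0[of "e i"] unfolding Ph_def
      by (cases "i \<le> d") (auto intro!: continuous_intros continuous_on_coordinate)
  qed
  have cPs: "continuous_on S Ps" for S
  proof (rule continuous_on_coordinatewise_then_product)
    fix i show "continuous_on S (\<lambda>x. Ps x i)"
      unfolding Ps_def
      by (cases "a i < b i") (auto intro!: continuous_intros continuous_on_coordinate)
  qed
  define p where "p y = Ps (\<lambda>i. y i / mx y)" for y
  define q where "q x = (\<lambda>i. Ph x i / nr (Ph x))" for x
  define r where "r x = mx (Ph x)" for x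
  have mxpos: "mx y > 0" if "y \<in> sphere_set d" for y
    using that nr_pos[of y] by (simp add: sph)
  show thesis
  proof
    show "continuous_on (sphere_set d) p"
      unfolding p_def using mxpos
      by (intro continuous_on_compose2[OF cPs[of UNIV]] continuous_on_coordinatewise_then_product
          continuous_on_divide cmx continuous_on_coordinate) (auto simp: less_le)
    show "p \<in> sphere_set d \<rightarrow> nbox_bd a b"
      unfolding p_def using mxpos by (auto intro!: Ps_bd simp: mx_scale less_le)
    show "continuous_on (nbox a b) r"
      unfolding r_def by (intro continuous_on_compose2[OF cmx[of UNIV] cPh]) auto
    show "continuous_on {x \<in> nbox a b. r x \<ge> 1/2} q"
      unfolding q_def
    proof (intro continuous_on_coordinatewise_then_product continuous_on_divide ballI)
      fix x assume "x \<in> {x \<in> nbox a b. r x \<ge> 1/2}"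
      then have "mx (Ph x) > 0" by (auto simp: r_def)
      then show "nr (Ph x) \<noteq> 0" using nr_pos[of "Ph x"] by simp
    qed (auto intro: continuous_on_compose2[OF cnr[of UNIV] cPh] continuous_on_product_then_coordinatewise[OF cPh])
    show "q \<in> {x \<in> nbox a b. r x \<ge> 1/2} \<rightarrow> sphere_set d"
    proof
      fix x assume "x \<in> {x \<in> nbox a b. r x \<ge> 1/2}"
      then have "mx (Ph x) > 0" by (auto simp: r_def)
      then have "nr (Ph x) > 0" using nr_pos[of "Ph x"] by simp
      then show "q x \<in> sphere_set d"
        unfolding sph q_def by (simp add: nr_scale) (simp add: Ph_def)
    qed
    show "r x = 1 \<and> p (q x) = x" if x: "x \<in> nbox_bd a b" for x
    proof
      show "r x = 1" unfolding r_def by (rule mx_Ph[OF x])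
      have n: "nr (Ph x) > 0" using nr_pos[of "Ph x"] mx_Ph[OF x] by simp
      have "mx (q x) = 1 / nr (Ph x)" unfolding q_def using mx_scale[OF n] mx_Ph[OF x] by simp
      then have "(\<lambda>i. q x i / mx (q x)) = Ph x" using n by (auto simp: q_def)
      then show "p (q x) = x" using x by (simp add: p_def PsPh nbox_bd_def)
    qed
    show "q (p y) = y" if y: "y \<in> sphere_set d" for y
    proof -
      have m: "mx y > 0" by (rule mxpos[OF y])
      have "Ph (p y) = (\<lambda>i. y i / mx y)" unfolding p_def by (rule PhPs) (use y in \<open>auto simp: sph\<close>)
      then show ?thesis unfolding q_def using m y by (simp add: nr_scale sph)
    qed
  qed
qed

text \<open>A null-homotopy of the boundary map is spread over the collar
  \<open>r x \<ge> 1/2\<close>, and the rest of the box goes to its end point. In dimension 0 there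
  is no boundary, and the connectivity hypothesis just says that \<open>Y\<close> is
  nonempty.\<close>

lemma box_extension:
  fixes Y :: "'b::topological_space set"
  assumes ab: "\<And>j. a j \<le> b j" and J: "finite {j. a j < b j}"
    and Y: "k_connected (int (card {j. a j < b j}) - 1) (top_of_set Y)"
    and g: "continuous_on (nbox_bd a b) g" "g \<in> nbox_bd a b \<rightarrow> Y"
  obtains G where "continuous_on (nbox a b) G" "G \<in> nbox a b \<rightarrow> Y" "\<And>x. x \<in> nbox_bd a b \<Longrightarrow> G x = g x"
proof (cases "card {j. a j < b j}")
  case 0
  then have e: "{j. a j < b j} = {}" using J by simp
  have "Y \<noteq> {}" using Y 0 by (simp add: k_connected_set)
  then obtain y where "y \<in> Y" by blast
  have "nbox_bd a b = {}" using e by (auto simp: nbox_bd_def)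
  then show ?thesis using \<open>y \<in> Y\<close> by (intro that[of "\<lambda>_. y"]) auto
next
  case (Suc d)
  obtain p q r where p: "continuous_on (sphere_set d) p" "p \<in> sphere_set d \<rightarrow> nbox_bd a b"
    and r: "continuous_on (nbox a b) r"
    and q: "continuous_on {x \<in> nbox a b. r x \<ge> (1/2::real)} q" "q \<in> {x \<in> nbox a b. r x \<ge> 1/2} \<rightarrow> sphere_set d"
    and pq: "\<And>x. x \<in> nbox_bd a b \<Longrightarrow> r x = 1 \<and> p (q x) = x"
    by (rule sphere_box[OF ab J Suc]) blast
  have "continuous_on (sphere_set d) (g \<circ> p)" "g \<circ> p \<in> sphere_set d \<rightarrow> Y"
    unfolding o_def using continuous_on_compose2[OF g(1) p(1)] p(2) g(2) by (auto simp: image_subset_iff_funcset)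
  then obtain c where "homotopic_in (sphere_set d) Y (g \<circ> p) (\<lambda>_. c)"
    using Y Suc unfolding k_connected_set by fastforce
  then obtain H where H: "continuous_on ({0..1::real} \<times> sphere_set d) H" "H \<in> {0..1} \<times> sphere_set d \<rightarrow> Y"
     and H01: "\<forall>x. H (0, x) = g (p x)" "\<forall>x. H (1, x) = c"
    unfolding homotopic_with_def by (auto simp: prod_topology_subtopology_eu)
  then have H0: "H (0, x) = g (p x)" and H1: "H (1, x) = c" for x by auto
  have "sphere_set d \<noteq> {}" using in_topspace_nsphere[of d] by (auto simp: nsphere_eq)
  then have cY: "c \<in> Y" using H(2) H1 by (metis Pi_iff SigmaI atLeastAtMost_iff ex_in_conv order_refl zero_le_one)
  \<comment> \<open>The time \<open>2 - 2 * r x\<close> runs from 0 on the boundary to 1 at the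
    inner edge of the collar. Clamping keeps it in the unit interval without an upper bound for
    \<open>r\<close>.\<close>
  define G where "G x = (if r x \<ge> 1/2 then H (max 0 (min 1 (2 - 2 * r x)), q x) else c)" for x
  have cr: "closed {t::real. t \<ge> 1/2}" "closed {t::real. t \<le> 1/2}" by (intro closed_Collect_le continuous_intros)+
  let ?P = "{x \<in> nbox a b. r x \<ge> 1/2}" and ?Q = "{x \<in> nbox a b. r x \<le> 1/2}"
  have cl: "closedin (top_of_set (nbox a b)) ?P" "closedin (top_of_set (nbox a b)) ?Q"
    using continuous_closedin_preimage[OF r cr(1)] continuous_closedin_preimage[OF r cr(2)]
    by (auto simp: vimage_def Int_def)
  have eq: "nbox a b = ?P \<union> ?Q" by auto
  have "continuous_on (?P \<union> ?Q) G"
    unfolding G_def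
  proof (rule continuous_on_cases_local)
    show "continuous_on ?P (\<lambda>x. H (max 0 (min 1 (2 - 2 * r x)), q x))"
      using q(2) by (intro continuous_on_compose2[OF H(1)] continuous_intros q continuous_on_subset[OF r]) auto
    show "\<And>x. x \<in> ?P \<and> \<not> 1/2 \<le> r x \<or> x \<in> ?Q \<and> 1/2 \<le> r x \<Longrightarrow> H (max 0 (min 1 (2 - 2 * r x)), q x) = c"
      using H1 by (auto simp: antisym)
  qed (use cl eq in auto)
  then have "continuous_on (nbox a b) G" using eq by simp
  moreover have "G \<in> nbox a b \<rightarrow> Y"
    using H(2) q(2) cY by (auto simp: G_def Pi_iff)
  moreover have "G x = g x" if "x \<in> nbox_bd a b" for x
    using pq[OF that] by (simp add: G_def H0)
  ultimately show ?thesis by (rule that)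
qed

section \<open>Extension of maps over cubical grids\<close>

lemma k_connected_mono:
  assumes "k_connected k X" "l \<le> k"
  shows "k_connected l X"
  using assms by (auto simp: k_connected_def)

text \<open>
  Cells of the grid of mesh \<open>1 / N\<close> are coded by functions \<open>c\<close>: in coordinate \<open>j\<close>, an even value
  \<open>2 * i\<close> stands for the point \<open>i / N\<close> and an odd value \<open>2 * i + 1\<close> for the interval
  from \<open>i / N\<close> to \<open>(i + 1) / N\<close>.
\<close>

definition lower :: "nat \<Rightarrow> (nat \<Rightarrow> nat) \<Rightarrow> nat \<Rightarrow> real" where
  "lower N c j = real (c j div 2) / real N"

definition upper :: "nat \<Rightarrow> (nat \<Rightarrow> nat) \<Rightarrow> nat \<Rightarrow> real" where
  "upper N c j = real ((c j + 1) div 2) / real N"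

abbreviation cell :: "nat \<Rightarrow> (nat \<Rightarrow> nat) \<Rightarrow> (nat \<Rightarrow> real) set" where
  "cell N c \<equiv> nbox (lower N c) (upper N c)"

text \<open>An odd code may move to an even neighbour, that is, an interval to one of its end
  points. Every cell is also a face of itself.\<close>

definition face :: "(nat \<Rightarrow> nat) \<Rightarrow> (nat \<Rightarrow> nat) \<Rightarrow> bool" where
  "face c' c \<longleftrightarrow> (\<forall>j. c' j = c j \<or> odd (c j) \<and> (c' j = c j + 1 \<or> c' j + 1 = c j))"

lemma lower_le_upper: "lower N c j \<le> upper N c j"
  by (simp add: lower_def upper_def divide_right_mono)

lemma lower_less_upper: "N > 0 \<Longrightarrow> lower N c j < upper N c j \<longleftrightarrow> odd (c j)"
  by (auto simp: lower_def upper_def divide_less_cancel elim!: oddE evenE)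

lemma lower_upper:
  assumes "N > 0"
  shows "even (c j) \<Longrightarrow> lower N c j = real (c j div 2) / N \<and> upper N c j = real (c j div 2) / N"
    "odd (c j) \<Longrightarrow> lower N c j = real (c j div 2) / N \<and> upper N c j = (real (c j div 2) + 1) / N"
  by (auto simp: lower_def upper_def elim!: evenE oddE)

lemma face_cell:
  assumes "N > 0" "face c' c"
  shows "cell N c' \<subseteq> cell N c"
proof
  fix x assume x: "x \<in> cell N c'"
  have "lower N c j \<le> x j \<and> x j \<le> upper N c j" for j
  proof -
    have x': "lower N c' j \<le> x j" "x j \<le> upper N c' j" using x by (auto simp: nbox_def)
    have "c' j = c j \<or> (\<exists>a. c j = 2 * a + 1 \<and> c' j = 2 * a + 2) \<or> (\<exists>a. c j = 2 * a + 1 \<and> c' j = 2 * a)"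
      using assms(2)[unfolded face_def, rule_format, of j] by (auto elim!: oddE)
    then consider "c' j = c j" | a where "c j = 2 * a + 1" "c' j = 2 * a + 2" | a where "c j = 2 * a + 1" "c' j = 2 * a"
      by blast
    then show ?thesis
    proof cases
      case 1 then show ?thesis using x' by (simp add: lower_def upper_def)
    next
      case 2 then have "lower N c j = a / N" "upper N c j = (a + 1) / N" "lower N c' j = (a + 1) / N" "upper N c' j = (a + 1) / N"
        by (auto simp: lower_def upper_def)
      then show ?thesis using x' assms(1) by (auto intro: order_trans[of _ "(real a + 1) / N"] simp: divide_right_mono)
    next
      case 3 then have "lower N c j = a / N" "upper N c j = (a + 1) / N" "lower N c' j = a / N" "upper N c' j = a / N"
        by (auto simp: lower_def upper_def)
      then show ?thesis using x' assms(1) by (auto intro: order_trans[of _ "real a / N"] simp: divide_right_mono)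
    qed
  qed
  then show "x \<in> cell N c" by (simp add: nbox_def)
qed

lemma cell_boundary_face:
  assumes N: "N > 0" and x: "x \<in> nbox_bd (lower N c) (upper N c)"
  obtains c' where "face c' c" "c' \<noteq> c" "x \<in> cell N c'"
proof -
  obtain j where xc: "x \<in> cell N c" and j: "lower N c j < upper N c j" "x j = lower N c j \<or> x j = upper N c j"
    using x unfolding nbox_bd_def by blast
  have o: "odd (c j)" using j lower_less_upper[OF N] by simp
  define c' where "c' = c(j := if x j = lower N c j then c j - 1 else c j + 1)"
  have "face c' c" "c' \<noteq> c" using o odd_pos[OF o] by (auto simp: face_def c'_def fun_eq_iff)
  moreover have "lower N c' i \<le> x i \<and> x i \<le> upper N c' i" for i
  proof (cases "i = j")
    case True
    obtain a where a: "c j = 2 * a + 1" using o by (rule oddE)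
    show ?thesis using j(2) True a by (auto simp: lower_def upper_def c'_def)
  next
    case False
    then show ?thesis using xc by (simp add: c'_def lower_def upper_def nbox_def)
  qed
  then have "x \<in> cell N c'" by (simp add: nbox_def)
  ultimately show ?thesis by (rule that)
qed

text \<open>If \<open>x\<close> were interior to \<open>c\<close>, then \<open>d\<close> would have
  the same interval as \<open>c\<close> in every odd coordinate of \<open>c\<close>. As
  \<open>d\<close> has no larger dimension, all its other coordinates are points, and
  \<open>x\<close> forces them to agree with those of \<open>c\<close>, so
  \<open>c = d\<close>.\<close>

lemma cell_inter_boundary:
  assumes N: "N > 0" and x: "x \<in> cell N c" "x \<in> cell N d" and "c \<noteq> d"
    and fin: "finite {j. odd (c j)}" "finite {j. odd (d j)}"
    and card: "card {j. odd (d j)} \<le> card {j. odd (c j)}"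
  shows "x \<in> nbox_bd (lower N c) (upper N c)"
proof (rule ccontr)
  assume nb: "\<not> ?thesis"
  have xc: "lower N c j \<le> x j" "x j \<le> upper N c j" and xd: "lower N d j \<le> x j" "x j \<le> upper N d j" for j
    using x by (auto simp: nbox_def)
  have same: "odd (d j) \<and> d j = c j" if "odd (c j)" for j
  proof -
    have "lower N c j < upper N c j" using that N by (simp add: lower_less_upper)
    then have "x j \<noteq> lower N c j" "x j \<noteq> upper N c j" using nb x(1) unfolding nbox_bd_def by blast+
    then have s: "lower N c j < x j" "x j < upper N c j" using xc[of j] by auto
    let ?a = "c j div 2" and ?e = "d j div 2"
    have a: "real ?a < x j * N" "x j * N < real ?a + 1"
      using s lower_upper(2)[of N c j, OF N that] N by (auto simp: field_simps)
    show ?thesis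
    proof (cases "even (d j)")
      case True
      then have "x j * N = real ?e" using xd[of j] lower_upper(1)[of N d j, OF N True] N by (auto simp: field_simps)
      then have "?a < ?e" "?e < ?a + 1" using a by (simp_all only: of_nat_less_iff[symmetric, where 'a=real] of_nat_add of_nat_1)
      then show ?thesis by simp
    next
      case False
      then have "real ?e \<le> x j * N" "x j * N \<le> real ?e + 1"
        using xd[of j] lower_upper(2)[of N d j, OF N False] N by (auto simp: field_simps)
      then have "real ?a < real (?e + 1)" "real ?e < real (?a + 1)" using a by (simp_all only: of_nat_add of_nat_1)
      then have "?a = ?e" by (simp only: of_nat_less_iff)
      then show ?thesis using False that by (metis odd_two_times_div_two_succ)
    qed
  qed
  then have "{j. odd (c j)} \<subseteq> {j. odd (d j)}" by auto
  then have eq: "{j. odd (c j)} = {j. odd (d j)}" using fin card by (metis card_seteq)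
  have "c j = d j" for j
  proof (cases "odd (c j)")
    case True then show ?thesis using same by simp
  next
    case False
    then have ev: "even (c j)" "even (d j)" using eq by auto
    then have "real (c j div 2) / N = real (d j div 2) / N"
      using xc[of j] xd[of j] lower_upper(1)[of N c j, OF N] lower_upper(1)[of N d j, OF N] by simp
    then have "c j div 2 = d j div 2" using N by simp
    then show ?thesis using ev by (metis dvd_mult_div_cancel)
  qed
  then show False using \<open>c \<noteq> d\<close> by auto
qed

lemma closed_nbox: "closed (nbox a b)"
proof -
  have "nbox a b = (\<Inter>j. {x. a j \<le> x j} \<inter> {x. x j \<le> b j})" by (auto simp: nbox_def)
  moreover have "closed ({x::nat \<Rightarrow> real. a j \<le> x j} \<inter> {x. x j \<le> b j})" for j
    by (intro closed_Int closed_Collect_le continuous_on_const continuous_on_coordinate)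
  ultimately show ?thesis by auto
qed

text \<open>Induction on the number of cells, taking away one of maximal dimension. The other cells
  meet it only in its boundary, where the map is already known: a good cell keeps
  \<open>\<phi>\<close>, a bad one is filled inside \<open>W\<close> by
  \<open>box_extension\<close>. The last hypothesis makes the boundary values on good faces of bad
  cells lie in \<open>W\<close>.\<close>

lemma skeleton_extension:
  fixes W :: "'b::topological_space set" and \<phi> :: "(nat \<Rightarrow> real) \<Rightarrow> 'b"
  assumes N: "N > 0" and "finite Z" and "\<And>c c'. c \<in> Z \<Longrightarrow> face c' c \<Longrightarrow> c' \<in> Z"
    and "\<And>c. c \<in> Z \<Longrightarrow> finite {j. odd (c j)} \<and> card {j. odd (c j)} \<le> D"
    and good: "\<And>c c'. good c \<Longrightarrow> face c' c \<Longrightarrow> good c'"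
    and "continuous_on (\<Union>c\<in>Z. cell N c) \<phi>"
    and W: "k_connected (int D - 1) (top_of_set W)"
    and "\<And>c c'. c \<in> Z \<Longrightarrow> \<not> good c \<Longrightarrow> face c' c \<Longrightarrow> good c' \<Longrightarrow> \<phi> ` cell N c' \<subseteq> W"
  shows "\<exists>\<psi>. continuous_on (\<Union>c\<in>Z. cell N c) \<psi> \<and> (\<forall>c\<in>Z. good c \<longrightarrow> (\<forall>x\<in>cell N c. \<psi> x = \<phi> x)) \<and>
      (\<forall>c\<in>Z. \<not> good c \<longrightarrow> \<psi> ` cell N c \<subseteq> W)"
  using assms(2,3,4,6,8)
proof (induction "card Z" arbitrary: Z)
  case 0
  then show ?case by auto
next
  case (Suc n)
  then have "Z \<noteq> {}" by auto
  obtain c where cZ: "c \<in> Z" and max: "\<And>d. d \<in> Z \<Longrightarrow> card {j. odd (d j)} \<le> card {j. odd (c j)}"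
  proof -
    let ?S = "(\<lambda>c. card {j. odd (c j)}) ` Z"
    have "finite ?S" "?S \<noteq> {}" using Suc.prems(1) \<open>Z \<noteq> {}\<close> by auto
    then obtain c where "c \<in> Z" "card {j. odd (c j)} = Max ?S" using Max_in[of ?S] by (metis (no_types, lifting) imageE)
    then show ?thesis using Max_ge[OF \<open>finite ?S\<close>] by (intro that[of c]) auto
  qed
  let ?Z = "Z - {c}"
  have odds: "finite {j. odd (d j)}" if "d \<in> Z" for d using Suc.prems(3)[OF that] by simp
  \<comment> \<open>A cell of maximal dimension is no proper face of another one, so the remaining
    cells are still closed under faces.\<close>
  have no_face: "c' \<in> ?Z" if "d \<in> ?Z" "face c' d" for d c'
  proof -
    have "c' \<noteq> c"
    proof
      assume "c' = c"
      have sub: "{j. odd (c j)} \<subseteq> {j. odd (d j)}" using that(2) \<open>c' = c\<close> unfolding face_def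
        by (metis (mono_tags, lifting) Collect_mono)
      moreover have "card {j. odd (d j)} \<le> card {j. odd (c j)}" using max that by auto
      ultimately have "{j. odd (c j)} = {j. odd (d j)}" using odds that by (metis Diff_iff card_seteq)
      then have "odd (c j) \<longleftrightarrow> odd (d j)" for j by blast
      then have "c j = d j" for j using that(2) \<open>c' = c\<close> unfolding face_def
        by (metis even_Suc Suc_eq_plus1)
      then show False using that by auto
    qed
    then show ?thesis using that Suc.prems(2) by auto
  qed
  have "n = card ?Z" using Suc.hyps(2) cZ Suc.prems(1) by simp
  then have "\<exists>\<psi>. continuous_on (\<Union>c\<in>?Z. cell N c) \<psi> \<and> (\<forall>c\<in>?Z. good c \<longrightarrow> (\<forall>x\<in>cell N c. \<psi> x = \<phi> x)) \<and>
      (\<forall>c\<in>?Z. \<not> good c \<longrightarrow> \<psi> ` cell N c \<subseteq> W)"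
  proof (rule Suc.hyps(1))
    show "continuous_on (\<Union>c\<in>?Z. cell N c) \<phi>" by (rule continuous_on_subset[OF Suc.prems(4)]) auto
    show "finite ?Z" using Suc.prems(1) by simp
    show "c' \<in> ?Z" if "d \<in> ?Z" "face c' d" for d c' by (rule no_face[OF that])
    show "finite {j. odd (d j)} \<and> card {j. odd (d j)} \<le> D" if "d \<in> ?Z" for d
      using Suc.prems(3)[of d] that by simp
    show "\<phi> ` cell N c' \<subseteq> W" if "d \<in> ?Z" "\<not> good d" "face c' d" "good c'" for d c'
      using Suc.prems(5)[of d c'] that by simp
  qed
  then obtain \<psi> where \<psi>: "continuous_on (\<Union>c\<in>?Z. cell N c) \<psi>"
    "\<And>c x. c \<in> ?Z \<Longrightarrow> good c \<Longrightarrow> x \<in> cell N c \<Longrightarrow> \<psi> x = \<phi> x"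
    "\<And>c x. c \<in> ?Z \<Longrightarrow> \<not> good c \<Longrightarrow> x \<in> cell N c \<Longrightarrow> \<psi> x \<in> W" by blast
  let ?bd = "nbox_bd (lower N c) (upper N c)"
  have bdface: "\<exists>c'\<in>?Z. face c' c \<and> x \<in> cell N c'" if "x \<in> ?bd" for x
    using cell_boundary_face[OF N that] Suc.prems(2)[OF cZ] by (metis Diff_iff singletonD)
  have inter: "x \<in> ?bd" if "x \<in> cell N c" "d \<in> ?Z" "x \<in> cell N d" for x d
    using cell_inter_boundary[OF N that(1,3)] that(2) odds cZ max by auto
  have "\<exists>\<xi>. continuous_on (cell N c) \<xi> \<and> (\<forall>x\<in>?bd. \<xi> x = \<psi> x) \<and>
     (good c \<longrightarrow> (\<forall>x\<in>cell N c. \<xi> x = \<phi> x)) \<and> (\<not> good c \<longrightarrow> \<xi> ` cell N c \<subseteq> W)"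
  proof (cases "good c")
    case True
    have "continuous_on (cell N c) \<phi>" by (rule continuous_on_subset[OF Suc.prems(4)]) (use cZ in auto)
    moreover have "\<phi> x = \<psi> x" if "x \<in> ?bd" for x
      using bdface[OF that] \<psi>(2) good[OF True] by metis
    ultimately show ?thesis using True by blast
  next
    case False
    have "\<psi> x \<in> W" if "x \<in> ?bd" for x
    proof -
      obtain c' where c': "c' \<in> ?Z" "face c' c" "x \<in> cell N c'" using bdface[OF \<open>x \<in> ?bd\<close>] by blast
      show ?thesis
      proof (cases "good c'")
        case True
        then show ?thesis using \<psi>(2)[OF c'(1) _ c'(3)] Suc.prems(5)[OF cZ False c'(2)] c'(3) by auto
      qed (use \<psi>(3) c' in auto)
    qed
    moreover have "continuous_on ?bd \<psi>" by (rule continuous_on_subset[OF \<psi>(1)]) (use bdface in auto)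
    moreover have "{j. lower N c j < upper N c j} = {j. odd (c j)}" using lower_less_upper[OF N] by auto
    moreover have "k_connected (int (card {j. odd (c j)}) - 1) (top_of_set W)"
      by (rule k_connected_mono[OF W]) (use Suc.prems(3)[OF cZ] in auto)
    ultimately obtain G where "continuous_on (cell N c) G" "G \<in> cell N c \<rightarrow> W" "\<And>x. x \<in> ?bd \<Longrightarrow> G x = \<psi> x"
      using box_extension[of "lower N c" "upper N c" W \<psi> thesis, OF lower_le_upper] odds[OF cZ] by auto
    then show ?thesis using False by (intro exI[of _ G]) auto
  qed
  then obtain \<xi> where \<xi>: "continuous_on (cell N c) \<xi>" "\<And>x. x \<in> ?bd \<Longrightarrow> \<xi> x = \<psi> x"
    "\<And>x. good c \<Longrightarrow> x \<in> cell N c \<Longrightarrow> \<xi> x = \<phi> x" "\<And>x. \<not> good c \<Longrightarrow> x \<in> cell N c \<Longrightarrow> \<xi> x \<in> W" by blast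
  define \<eta> where "\<eta> x = (if x \<in> cell N c then \<xi> x else \<psi> x)" for x
  have un: "(\<Union>c\<in>Z. cell N c) = cell N c \<union> (\<Union>c\<in>?Z. cell N c)" using cZ by auto
  have \<eta>\<psi>: "\<eta> x = \<psi> x" if "d \<in> ?Z" "x \<in> cell N d" for x d
    using inter[OF _ that] \<xi>(2) by (auto simp: \<eta>_def)
  have "continuous_on (cell N c \<union> (\<Union>c\<in>?Z. cell N c)) \<eta>"
    unfolding \<eta>_def
  proof (rule continuous_on_cases)
    show "closed (\<Union>c\<in>?Z. cell N c)" using Suc.prems(1) by (intro closed_UN ballI closed_nbox) auto
    show "\<forall>x. x \<in> cell N c \<and> x \<notin> cell N c \<or> x \<in> (\<Union>c\<in>?Z. cell N c) \<and> x \<in> cell N c \<longrightarrow> \<xi> x = \<psi> x"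
      using inter \<xi>(2) by blast
  qed (use closed_nbox \<xi> \<psi> in auto)
  then have "continuous_on (\<Union>c\<in>Z. cell N c) \<eta>" using un by simp
  moreover have "\<eta> x = \<phi> x" if "d \<in> Z" "good d" "x \<in> cell N d" for d x
  proof (cases "d = c")
    case True
    then show ?thesis using that \<xi>(3) by (simp add: \<eta>_def)
  next
    case False
    then have "d \<in> ?Z" using that by simp
    then show ?thesis using \<eta>\<psi>[of d x] \<psi>(2)[of d x] that by simp
  qed
  moreover have "\<eta> x \<in> W" if "d \<in> Z" "\<not> good d" "x \<in> cell N d" for d x
  proof (cases "d = c")
    case True
    then show ?thesis using that \<xi>(4) by (simp add: \<eta>_def)
  next
    case False
    then have "d \<in> ?Z" using that by simp
    then show ?thesis using \<eta>\<psi>[of d x] \<psi>(3)[of d x] that by simp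
  qed
  ultimately show ?case by blast
qed

text \<open>The metric on functions sums the truncated coordinate distances with weights
  \<open>(1/2)^n\<close>, and these weights add up to 2.\<close>

lemma dist_fun_le:
  fixes x y :: "nat \<Rightarrow> real"
  assumes "\<And>j. \<bar>x j - y j\<bar> \<le> e"
  shows "dist x y \<le> 2 * e"
proof -
  have s: "summable (\<lambda>n. (1/2::real)^n * e)" by (intro summable_mult2 summable_geometric) simp
  have "dist x y = suminf (\<lambda>n. (1/2)^n * min (dist (x (from_nat n)) (y (from_nat n))) 1)"
    unfolding dist_fun_def ..
  also have "\<dots> \<le> suminf (\<lambda>n. (1/2)^n * e)"
  proof (rule suminf_le)
    show "summable (\<lambda>n. (1/2::real)^n * min (dist (x (from_nat n)) (y (from_nat n))) 1)"
      by (rule summable_comparison_test'[of "\<lambda>n. (1/2)^n"]) (auto simp: summable_geometric_iff)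
    show "(1/2::real)^n * min (dist (x (from_nat n)) (y (from_nat n))) 1 \<le> (1/2)^n * e" for n
      using assms[of "from_nat n"] by (intro mult_left_mono) (auto simp: dist_real_def)
  qed (rule s)
  also have "\<dots> = suminf (\<lambda>n. (1/2::real)^n) * e" by (rule suminf_mult2[symmetric]) (simp add: summable_geometric)
  also have "\<dots> = 2 * e" by (simp add: suminf_geometric)
  finally show ?thesis .
qed

lemma grid_modulus:
  fixes \<phi> :: "(nat \<Rightarrow> real) \<Rightarrow> real"
  assumes "compact S" "continuous_on S \<phi>" "e > 0"
  obtains N where "N > 0"
    "\<And>x y. x \<in> S \<Longrightarrow> y \<in> S \<Longrightarrow> (\<And>j. \<bar>x j - y j\<bar> \<le> 1 / real N) \<Longrightarrow> \<bar>\<phi> x - \<phi> y\<bar> < e"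
proof -
  have "uniformly_continuous_on S \<phi>" using assms compact_uniformly_continuous by blast
  then obtain \<delta> where \<delta>: "\<delta> > 0" "\<And>x y. x \<in> S \<Longrightarrow> y \<in> S \<Longrightarrow> dist y x < \<delta> \<Longrightarrow> dist (\<phi> y) (\<phi> x) < e"
    using assms(3) unfolding uniformly_continuous_on_def by metis
  obtain N where N: "inverse (real (Suc N)) < \<delta> / 2" using \<delta>(1) reals_Archimedean[of "\<delta> / 2"] by auto
  show thesis
  proof (rule that[of "Suc N"])
    fix x y assume "x \<in> S" "y \<in> S" and "\<And>j. \<bar>x j - y j\<bar> \<le> 1 / real (Suc N)"
    then have "dist x y \<le> 2 * (1 / real (Suc N))" by (intro dist_fun_le)
    also have "\<dots> < \<delta>" using N by (simp add: inverse_eq_divide)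
    finally show "\<bar>\<phi> x - \<phi> y\<bar> < e" using \<delta>(2)[of y x] \<open>x \<in> S\<close> \<open>y \<in> S\<close> by (simp add: dist_real_def)
  qed simp
qed

section \<open>Cubical subdivision of the boundary of the unit cube\<close>

lemma compact_nbox: "compact (nbox a b)"
proof -
  have "nbox a b = PiE UNIV (\<lambda>j. {a j..b j})" by (auto simp: nbox_def PiE_def Pi_def)
  moreover have "compactin (product_topology (\<lambda>_. euclidean) UNIV) (PiE UNIV (\<lambda>j. {a j..b j}))"
    by (subst compactin_PiE) (auto simp: compactin_euclidean_iff)
  ultimately show ?thesis by (simp add: euclidean_product_topology compactin_euclidean_iff)
qed

text \<open>The last clause puts the cell on a facet of the cube of dimension \<open>i + 1\<close>.
  It fixes an even entry, so at most \<open>i\<close> entries are odd.\<close>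

definition bcells :: "nat \<Rightarrow> nat \<Rightarrow> (nat \<Rightarrow> nat) set" where
  "bcells i N = {c. (\<forall>j. (j \<in> {..i} \<longrightarrow> c j \<in> {..2 * N}) \<and> (j \<notin> {..i} \<longrightarrow> c j = 0)) \<and> (\<exists>j\<le>i. c j = 0 \<or> c j = 2 * N)}"

abbreviation unit_top :: "nat \<Rightarrow> nat \<Rightarrow> real" where
  "unit_top i \<equiv> (\<lambda>j. if j \<le> i then 1 else 0)"

lemma bcells:
  shows "finite (bcells i N)"
    and "c \<in> bcells i N \<Longrightarrow> face c' c \<Longrightarrow> c' \<in> bcells i N"
    and "c \<in> bcells i N \<Longrightarrow> finite {j. odd (c j)} \<and> card {j. odd (c j)} \<le> i"
proof -
  show "finite (bcells i N)"
    by (rule finite_subset[OF _ finite_set_of_finite_funs[of "{..i}" "{..2*N}" 0]]) (auto simp: bcells_def)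
  show "c' \<in> bcells i N" if c: "c \<in> bcells i N" and f: "face c' c"
  proof -
    have "c' j \<le> 2 * N" if "j \<le> i" for j
    proof -
      have "c j \<le> 2 * N" using c that by (auto simp: bcells_def)
      moreover have "c' j = c j \<or> odd (c j) \<and> (c' j = c j + 1 \<or> c' j + 1 = c j)" using f by (simp add: face_def)
      ultimately show ?thesis by presburger
    qed
    moreover have "c' j = 0" if "\<not> j \<le> i" for j
    proof -
      have "c j = 0" using c that by (auto simp: bcells_def)
      then show ?thesis using f unfolding face_def by (metis even_zero)
    qed
    moreover have "\<exists>j\<le>i. c' j = 0 \<or> c' j = 2 * N"
    proof -
      obtain j where j: "j \<le> i" "c j = 0 \<or> c j = 2 * N" using c by (auto simp: bcells_def)
      then have "even (c j)" by auto
      then have "c' j = c j" using f unfolding face_def by metis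
      then show ?thesis using j by auto
    qed
    ultimately show ?thesis by (auto simp: bcells_def)
  qed
  show "finite {j. odd (c j)} \<and> card {j. odd (c j)} \<le> i" if c: "c \<in> bcells i N"
  proof -
    obtain j where j: "j \<le> i" "c j = 0 \<or> c j = 2 * N" using c by (auto simp: bcells_def)
    then have ev: "even (c j)" by auto
    have "{j. odd (c j)} \<subseteq> {..i} - {j}"
    proof
      fix l assume l: "l \<in> {j. odd (c j)}"
      have "l \<le> i"
      proof (rule ccontr)
        assume "\<not> l \<le> i" then have "c l = 0" using c by (auto simp: bcells_def)
        then show False using l by simp
      qed
      then show "l \<in> {..i} - {j}" using l ev by auto
    qed
    then show ?thesis using j(1) card_mono[of "{..i} - {j}" "{j. odd (c j)}"] by (auto intro: finite_subset)
  qed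
qed

lemma bcells_cover:
  assumes N: "N > 0"
  shows "(\<Union>c\<in>bcells i N. cell N c) = nbox_bd (\<lambda>_. 0) (unit_top i)"
proof (intro equalityI subsetI)
  fix x assume "x \<in> (\<Union>c\<in>bcells i N. cell N c)"
  then obtain c where c: "c \<in> bcells i N" and x: "\<And>j. lower N c j \<le> x j \<and> x j \<le> upper N c j" by (auto simp: nbox_def)
  have "0 \<le> x j \<and> x j \<le> unit_top i j" for j
  proof (cases "j \<le> i")
    case True
    then have "(c j + 1) div 2 \<le> N" using c by (auto simp: bcells_def)
    then have "upper N c j \<le> 1" using N by (simp add: upper_def)
    moreover have "0 \<le> lower N c j" by (simp add: lower_def)
    ultimately show ?thesis using x[of j] True by auto
  next
    case False
    then have "c j = 0" using c by (auto simp: bcells_def)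
    then show ?thesis using x[of j] False by (simp add: lower_def upper_def)
  qed
  moreover obtain j where j: "j \<le> i" "c j = 0 \<or> c j = 2 * N" using c by (auto simp: bcells_def)
  then have "x j = 0 \<or> x j = 1" using x[of j] N by (auto simp: lower_def upper_def)
  ultimately show "x \<in> nbox_bd (\<lambda>_. 0) (unit_top i)"
    using j(1) by (auto simp: nbox_bd_def nbox_def intro!: exI[of _ j])
next
  fix x assume "x \<in> nbox_bd (\<lambda>_. 0) (unit_top i)"
  then obtain j where x: "\<And>j. 0 \<le> x j \<and> x j \<le> unit_top i j" and "0 < unit_top i j" "x j = 0 \<or> x j = unit_top i j"
    unfolding nbox_bd_def nbox_def by blast
  then have j: "j \<le> i" "x j = 0 \<or> x j = 1" by (auto split: if_splits)
  \<comment> \<open>An inner value gets the interval found by rounding down. The values 0 and 1 get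
    even codes, so the coordinate that puts \<open>x\<close> on the boundary also puts the cell
    there.\<close>
  define c where "c j = (if x j = 0 then 0 else if x j = 1 then 2 * N else 2 * nat \<lfloor>x j * N\<rfloor> + 1)" for j
  have "lower N c j \<le> x j \<and> x j \<le> upper N c j \<and> c j \<le> 2 * N" for j
  proof (cases "x j = 0 \<or> x j = 1")
    case True then show ?thesis using N by (auto simp: c_def lower_def upper_def)
  next
    case False
    then have s: "0 < x j" "x j < 1" using x[of j] by (auto split: if_splits simp: less_le)
    have "0 \<le> \<lfloor>x j * N\<rfloor>" using s by simp
    then have fl: "real (nat \<lfloor>x j * N\<rfloor>) \<le> x j * N" "x j * N \<le> real (nat \<lfloor>x j * N\<rfloor>) + 1" by linarith+
    have "x j * N < N" using s N by simp
    then have "nat \<lfloor>x j * N\<rfloor> < N" using s by (simp add: floor_less_iff nat_less_iff)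
    then show ?thesis using False fl N by (auto simp: c_def lower_def upper_def field_simps)
  qed
  moreover have "c j = 0" if "\<not> j \<le> i" for j using x[of j] that by (auto simp: c_def)
  moreover have "c j = 0 \<or> c j = 2 * N" using j by (auto simp: c_def)
  ultimately have "c \<in> bcells i N" "x \<in> cell N c" using j(1) by (auto simp: bcells_def nbox_def)
  then show "x \<in> (\<Union>c\<in>bcells i N. cell N c)" by blast
qed

section \<open>Connectivity of a complex from deletion and link\<close>

definition supp :: "('a \<Rightarrow> real) \<Rightarrow> 'a set" where
  "supp f = {v. f v \<noteq> 0}"

definition greal :: "'a set set \<Rightarrow> ('a \<Rightarrow> real) set" where
  "greal K = {f. (\<forall>v. 0 \<le> f v) \<and> supp f \<in> K \<and> sum f (supp f) = 1}"

lemma geom_real_eq: "geom_real K = top_of_set (greal K)"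
  by (simp add: geom_real_def greal_def supp_def euclidean_product_topology)

text \<open>Unnormalised barycentric coordinates: the open cone over the realisation, without its apex.\<close>

definition wcone :: "'a set set \<Rightarrow> ('a \<Rightarrow> real) set" where
  "wcone K = {f. (\<forall>v. 0 \<le> f v) \<and> supp f \<in> K \<and> supp f \<noteq> {}}"

text \<open>The divisor sums over a fixed set and not over the support of \<open>f\<close>, which
  makes it a continuous function of \<open>f\<close>.\<close>

definition normalize_on :: "'a set \<Rightarrow> ('a \<Rightarrow> real) \<Rightarrow> 'a \<Rightarrow> real" where
  "normalize_on V f = (\<lambda>u. f u / sum f V)"

locale finite_complex =
  fixes V :: "'a set" and K :: "'a set set"
  assumes finV: "finite V" and subV: "\<And>S. S \<in> K \<Longrightarrow> S \<subseteq> V"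
    and down: "\<And>S T. S \<in> K \<Longrightarrow> T \<subseteq> S \<Longrightarrow> T \<in> K"
begin

lemma sum_supp: "supp f \<in> K \<Longrightarrow> sum f V = sum f (supp f)"
  by (rule sum.mono_neutral_right) (use finV subV in \<open>auto simp: supp_def\<close>)

lemma cone_sum_pos:
  assumes "f \<in> wcone K" shows "sum f V > 0"
proof -
  obtain v where v: "v \<in> supp f" using assms by (auto simp: wcone_def)
  then have "v \<in> V" using assms subV by (auto simp: wcone_def)
  moreover have "f v > 0" using v assms by (auto simp: wcone_def supp_def less_le)
  ultimately show ?thesis using assms finV by (intro sum_pos2[of V v]) (auto simp: wcone_def)
qed

lemma greal_cone: "f \<in> greal K \<longleftrightarrow> f \<in> wcone K \<and> sum f V = 1"
  by (auto simp: greal_def wcone_def sum_supp)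

lemma normalize_on_greal:
  assumes "f \<in> wcone K" shows "normalize_on V f \<in> greal K"
proof -
  have "supp (normalize_on V f) = supp f" using cone_sum_pos[OF assms] by (auto simp: supp_def normalize_on_def)
  moreover have "sum (normalize_on V f) V = 1"
    using cone_sum_pos[OF assms] by (simp add: normalize_on_def sum_divide_distrib[symmetric])
  moreover have "normalize_on V f v \<ge> 0" for v
    using assms cone_sum_pos[OF assms] by (auto simp: normalize_on_def wcone_def)
  ultimately show ?thesis using assms by (auto simp: greal_cone wcone_def)
qed

lemma continuous_on_normalize:
  assumes "continuous_on Z w" "\<And>z. z \<in> Z \<Longrightarrow> w z \<in> wcone K"
  shows "continuous_on Z (\<lambda>z. normalize_on V (w z))"
proof (rule continuous_on_coordinatewise_then_product)
  fix u
  have c: "continuous_on Z (\<lambda>z. w z u)" for u by (rule continuous_on_product_then_coordinatewise[OF assms(1)])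
  show "continuous_on Z (\<lambda>z. normalize_on V (w z) u)"
    unfolding normalize_on_def
    by (intro continuous_on_divide continuous_on_sum c) (use cone_sum_pos assms(2) in \<open>fastforce\<close>)
qed

text \<open>The source of the straight-line homotopies below: maps whose supports always lie in a
  common simplex are homotopic.\<close>

lemma segment_cone:
  assumes "f \<in> wcone K" "g \<in> wcone K" "supp f \<union> supp g \<in> K" "0 \<le> s" "s \<le> 1"
  shows "(\<lambda>u. (1 - s) * f u + s * g u) \<in> wcone K"
proof -
  let ?h = "\<lambda>u. (1 - s) * f u + s * g u"
  have nn: "f u \<ge> 0" "g u \<ge> 0" for u using assms by (auto simp: wcone_def)
  have "supp ?h \<subseteq> supp f \<union> supp g" by (auto simp: supp_def)
  then have 1: "supp ?h \<in> K" using down assms(3) by blast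
  have 2: "supp f \<noteq> {}" "supp g \<noteq> {}" using assms by (auto simp: wcone_def)
  have "supp ?h \<noteq> {}"
  proof (cases "s = 1")
    case True then show ?thesis using 2 by (simp add: supp_def)
  next
    case False
    obtain u where "f u > 0" using 2 nn by (auto simp: supp_def less_le)
    then have "(1 - s) * f u > 0" using False assms(5) by simp
    then have "?h u > 0" using nn assms(4) by (simp add: add_pos_nonneg)
    then have "u \<in> supp ?h" by (simp add: supp_def)
    then show ?thesis by blast
  qed
  then show ?thesis using 1 nn assms(4,5) by (auto simp: wcone_def)
qed

lemma segment_greal:
  assumes "f \<in> greal K" "g \<in> greal K" "supp f \<union> supp g \<in> K" "0 \<le> s" "s \<le> 1"
  shows "(\<lambda>u. (1 - s) * f u + s * g u) \<in> greal K"
  using assms segment_cone[of f g s]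
  by (auto simp: greal_cone sum.distrib sum_distrib_left[symmetric])

text \<open>Normalising keeps supports and is therefore homotopic to the identity. This permits maps
  between complexes to be written with unnormalised weights.\<close>

lemma dominates_cone_greal: "dominates (wcone K) (greal K)" "dominates (greal K) (wcone K)"
proof -
  have n: "continuous_on (wcone K) (normalize_on V)" "normalize_on V \<in> wcone K \<rightarrow> greal K"
    using continuous_on_normalize[OF continuous_on_id, of "wcone K"] normalize_on_greal by auto
  have i: "continuous_on (greal K) id" "id \<in> greal K \<rightarrow> wcone K" by (auto simp: greal_cone)
  have "homotopic_in (greal K) (greal K) (normalize_on V \<circ> id) id"
    by (rule homotopic_with_symD, rule homotopic_in_eq) (auto simp: greal_cone normalize_on_def)
  then show "dominates (wcone K) (greal K)" unfolding dominates_def using n i by blast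
  have "supp (normalize_on V f) = supp f" if "f \<in> wcone K" for f
    using cone_sum_pos[OF that] by (auto simp: supp_def normalize_on_def)
  then have "homotopic_in (wcone K) (wcone K) (id \<circ> normalize_on V) id"
    using n i normalize_on_greal
    by (intro homotopic_linear_fun segment_cone) (auto simp: greal_cone, auto simp: wcone_def)
  then show "dominates (greal K) (wcone K)" unfolding dominates_def using n i by blast
qed

end

text \<open>Reduces domination to a condition on supports, the analogue of contiguity of simplicial
  maps.\<close>

lemma dominates_contiguous:
  assumes K: "finite_complex V K" and L: "finite_complex W L"
    and f: "continuous_on (wcone K) f" "f \<in> wcone K \<rightarrow> wcone L"
    and g: "continuous_on (wcone L) g" "g \<in> wcone L \<rightarrow> wcone K"
    and fg: "\<And>x. x \<in> wcone L \<Longrightarrow> supp (f (g x)) \<union> supp x \<in> L"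
  shows "dominates (wcone K) (wcone L)"
proof -
  have "homotopic_in (wcone L) (wcone L) (f \<circ> g) id"
    using f g fg continuous_on_compose2[OF f(1) g(1)]
    by (intro homotopic_linear_fun finite_complex.segment_cone[OF L]) (auto simp: o_def image_subset_iff_funcset)
  then show ?thesis unfolding dominates_def using f g by blast
qed

context finite_complex begin

text \<open>Radial projection away from \<open>v\<close>, defined wherever \<open>v\<close> does not
  carry the whole weight.\<close>

lemma drop_vertex:
  assumes x: "x \<in> greal K" and v: "x v < 1"
  defines "y \<equiv> (\<lambda>u. if u = v then 0 else x u / (1 - x v))"
  shows "y \<in> greal {S \<in> K. v \<notin> S}" "supp y = supp x - {v}"
proof -
  show s: "supp y = supp x - {v}" using v by (auto simp: supp_def y_def)
  have xc: "\<And>u. x u \<ge> 0" "supp x \<in> K" "sum x (supp x) = 1" using x by (auto simp: greal_def)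
  have "finite (supp x)" using xc(2) subV finV finite_subset by blast
  have "sum y (supp y) = (\<Sum>u\<in>supp x - {v}. x u / (1 - x v))"
    unfolding s by (rule sum.cong) (auto simp: y_def)
  also have "\<dots> = (sum x (supp x - {v})) / (1 - x v)" by (simp add: sum_divide_distrib)
  also have "sum x (supp x - {v}) = 1 - x v"
    using \<open>finite (supp x)\<close> xc(3) by (cases "v \<in> supp x") (auto simp: sum_diff1 supp_def)
  finally have "sum y (supp y) = 1" using v by simp
  moreover have "supp y \<in> K" using xc(2) down s by (metis Diff_subset)
  ultimately show "y \<in> greal {S \<in> K. v \<notin> S}" using s xc(1) v by (auto simp: greal_def y_def)
qed

lemma continuous_on_drop_vertex:
  assumes "\<And>x. x \<in> S \<Longrightarrow> x v < 1"
  shows "continuous_on S (\<lambda>x u. if u = v then 0 else x u / (1 - x v :: real))"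
proof (rule continuous_on_coordinatewise_then_product)
  fix u
  show "continuous_on S (\<lambda>x. if u = v then 0 else x u / (1 - x v :: real))"
    using assms by (cases "u = v") (auto intro!: continuous_on_divide continuous_on_diff continuous_on_const continuous_on_coordinate, fastforce)
qed

text \<open>
  Given a map \<open>\<phi>\<close> from a cube boundary, keep it on the cells where the \<open>v\<close>-coordinate stays below
  \<open>1/2\<close> and replace it on the other cells by a map into \<open>W\<close>, which is homotopy equivalent to the link.
  The new map \<open>\<psi>\<close> avoids \<open>v\<close>, and \<open>H\<close>, which pushes everything with \<open>v\<close>-coordinate at least \<open>1/3\<close>
  into \<open>v\<close>, makes the two maps equal.
\<close>

lemma k_connected_vertex:
  assumes del: "k_connected k (top_of_set (greal {S \<in> K. v \<notin> S}))"
    and lk: "k_connected (k - 1) (top_of_set (greal {S. v \<notin> S \<and> insert v S \<in> K}))"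
  shows "k_connected k (top_of_set (greal K))"
proof -
  define D where "D = {S \<in> K. v \<notin> S}"
  define L where "L = {S. v \<notin> S \<and> insert v S \<in> K}"
  \<comment> \<open>Positive weight at \<open>v\<close> puts the projection away from
    \<open>v\<close> into the link, and weight below 1 makes that projection defined.\<close>
  define W where "W = {x \<in> greal K. 1/3 < x v \<and> x v < 1}"
  define U where "U = {x \<in> greal K. x v < 1}"
  define R where "R x = (\<lambda>u. if u = v then 0 else x u / (1 - x v :: real))" for x
  have LD: "L \<subseteq> D" using down by (auto simp: L_def D_def)
  have gD: "greal D \<subseteq> greal K" by (auto simp: greal_def D_def)
  have DU: "greal D \<subseteq> U"
  proof
    fix x assume "x \<in> greal D"
    then have "x \<in> greal K" "x v = 0" using gD by (auto simp: greal_def D_def supp_def)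
    then show "x \<in> U" by (simp add: U_def)
  qed
  have v0: "x v = 0" if "x \<in> greal L" for x using that by (auto simp: greal_def L_def supp_def)
  have Rc: "continuous_on S R" if "S \<subseteq> U" for S
    unfolding R_def using that by (intro continuous_on_drop_vertex) (auto simp: U_def)
  have RU: "R \<in> U \<rightarrow> greal D" using drop_vertex(1) unfolding R_def D_def U_def by blast
  have Rs: "supp (R x) = supp x - {v}" if "x \<in> U" for x
    using drop_vertex(2)[of x v] that unfolding R_def U_def by blast
  have WU: "W \<subseteq> U" by (auto simp: W_def U_def)
  have RW: "R \<in> W \<rightarrow> greal L"
  proof
    fix x assume x: "x \<in> W"
    then have "v \<in> supp x" "supp x \<in> K" by (auto simp: W_def greal_def supp_def)
    then have "insert v (supp (R x)) \<in> K" "v \<notin> supp (R x)"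
      using Rs[of x] x WU by (auto simp: insert_absorb)
    moreover have "R x \<in> greal D" using RU x WU by auto
    ultimately show "R x \<in> greal L" by (auto simp: greal_def L_def)
  qed
  \<comment> \<open>The midpoint between a point of the link and \<open>v\<close>; its
    \<open>v\<close>-coordinate \<open>1/2\<close> satisfies both bounds of
    \<open>W\<close>.\<close>
  define F where "F l = (\<lambda>u. if u = v then 1/2 else l u / 2 :: real)" for l
  have Fs: "supp (F l) = insert v (supp l)" for l by (auto simp: supp_def F_def)
  have FW: "F \<in> greal L \<rightarrow> W"
  proof
    fix l assume l: "l \<in> greal L"
    have K: "insert v (supp l) \<in> K" "v \<notin> supp l" "finite (supp l)"
      using l subV finV finite_subset[of "insert v (supp l)" V] by (auto simp: greal_def L_def)
    have "sum (F l) (supp l) = (\<Sum>u\<in>supp l. l u / 2)"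
      by (rule sum.cong) (use K in \<open>auto simp: F_def\<close>)
    also have "\<dots> = 1 / 2" using l by (simp add: sum_divide_distrib[symmetric] greal_def)
    finally have "sum (F l) (supp (F l)) = 1" unfolding Fs using K by (simp add: F_def)
    then have "F l \<in> greal K" using K l by (auto simp: greal_def Fs) (auto simp: F_def)
    then show "F l \<in> W" by (simp add: W_def F_def)
  qed
  have Fc: "continuous_on S F" for S
  proof (rule continuous_on_coordinatewise_then_product)
    fix u show "continuous_on S (\<lambda>x. F x u)" unfolding F_def
      by (cases "u = v") (auto intro!: continuous_on_divide continuous_on_const continuous_on_coordinate)
  qed
  have "homotopic_in W W (F \<circ> R) id"
  proof (rule homotopic_linear_fun)
    show "continuous_on W (F \<circ> R)" unfolding o_def
      by (rule continuous_on_compose2[OF Fc[of UNIV] Rc[OF WU]]) auto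
    fix x and s :: real assume x: "x \<in> W" and s: "0 \<le> s" "s \<le> 1"
    have FRx: "F (R x) \<in> W" using FW RW x by blast
    have vs: "v \<in> supp x" using x by (auto simp: W_def supp_def)
    have "supp (F (R x)) \<union> supp x = supp x" using Rs[of x] x WU vs by (auto simp: Fs)
    then have "(\<lambda>u. (1 - s) * F (R x) u + s * x u) \<in> greal K"
      using x FRx s by (intro segment_greal) (auto simp: W_def greal_def)
    moreover have "1/3 < (1 - s) * F (R x) v + s * x v" "(1 - s) * F (R x) v + s * x v < 1"
      using convex_bound_lt[of "F (R x) v" 1 "x v" "1 - s" s]
        convex_bound_lt[of "- F (R x) v" "- 1/3" "- x v" "1 - s" s] FRx x s
      by (auto simp: W_def)
    ultimately show "(\<lambda>u. (1 - s) * (F \<circ> R) x u + s * id x u) \<in> W" by (simp add: W_def)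
  qed auto
  then have "dominates (greal L) W"
    unfolding dominates_def using Fc FW Rc[OF WU] RW by blast
  then have kW: "k_connected (k - 1) (top_of_set W)"
    using k_connected_dominates lk unfolding L_def by blast
  have hR: "homotopic_in U (greal K) R id"
  proof (rule homotopic_linear_fun)
    fix x and s :: real assume x: "x \<in> U" and s: "0 \<le> s" "s \<le> 1"
    have "R x \<in> greal K" using RU x gD by blast
    moreover have "supp (R x) \<union> supp x = supp x" using Rs[OF x] by auto
    ultimately show "(\<lambda>u. (1 - s) * R x u + s * id x u) \<in> greal K"
      using x s by (auto intro!: segment_greal simp: U_def) (auto simp: greal_def)
  qed (use Rc in auto)
  \<comment> \<open>The factor falls from 1 at \<open>x v = 0\<close> to 0 at
    \<open>x v = 1/3\<close>, so after normalising only \<open>v\<close> is left from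
    \<open>1/3\<close> on.\<close>
  define wt where "wt x = (\<lambda>u. if u = v then x v else max 0 (1 - 3 * x v) * x u :: real)" for x
  define H where "H x = normalize_on V (wt x)" for x
  have wt: "wt x \<in> wcone K \<and> supp (wt x) \<subseteq> supp x" if x: "x \<in> greal K" for x
  proof -
    have xx: "\<And>u. x u \<ge> 0" "supp x \<in> K" "supp x \<noteq> {}" using x by (auto simp: greal_cone wcone_def)
    have 1: "supp (wt x) \<subseteq> supp x" by (auto simp: supp_def wt_def)
    moreover have "supp (wt x) \<noteq> {}"
    proof (cases "x v = 0")
      case True
      then have "wt x = x" by (auto simp: wt_def)
      then show ?thesis using xx by simp
    qed (auto simp: supp_def wt_def)
    ultimately show ?thesis using xx down by (auto simp: wcone_def wt_def)
  qed
  have wtc: "continuous_on S wt" for S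
  proof (rule continuous_on_coordinatewise_then_product)
    fix u show "continuous_on S (\<lambda>x. wt x u)" unfolding wt_def
      by (cases "u = v") (auto intro!: continuous_intros continuous_on_coordinate)
  qed
  have Hc: "continuous_on (greal K) H" unfolding H_def
    by (rule continuous_on_normalize[OF wtc]) (use wt in auto)
  have HK: "H \<in> greal K \<rightarrow> greal K" unfolding H_def using wt normalize_on_greal by auto
  have hH: "homotopic_in (greal K) (greal K) H id"
  proof (rule homotopic_linear_fun)
    fix x and s :: real assume x: "x \<in> greal K" and s: "0 \<le> s" "s \<le> 1"
    have "supp (H x) \<subseteq> supp x" using wt[OF x] by (auto simp: H_def normalize_on_def supp_def)
    then have "supp (H x) \<union> supp x \<in> K" using x by (auto simp: greal_def Un_absorb1)
    then show "(\<lambda>u. (1 - s) * H x u + s * id x u) \<in> greal K"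
      using x s HK by (auto intro!: segment_greal)
  qed (use Hc in auto)
  have H_v: "H x = (\<lambda>u. if u = v then 1 else 0)" if x: "x \<in> greal K" "x v \<ge> 1/3" for x
  proof -
    have w: "wt x = (\<lambda>u. if u = v then x v else 0)" using x(2) by (auto simp: wt_def)
    have "v \<in> supp x" "supp x \<in> K" using x by (auto simp: greal_def supp_def)
    then have "v \<in> V" using subV by blast
    then have "sum (wt x) V = x v" unfolding w using finV by simp
    then show ?thesis using x(2) by (auto simp: H_def normalize_on_def w)
  qed
  show ?thesis unfolding k_connected_set
  proof (intro conjI allI impI)
    assume "-1 \<le> k"
    then have "greal D \<noteq> {}" using del unfolding k_connected_set D_def by simp
    then show "greal K \<noteq> {}" using gD by auto
  next
    fix i f assume i: "int i \<le> k" and f: "continuous_on (sphere_set i) f" "f \<in> sphere_set i \<rightarrow> greal K"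
    let ?a = "\<lambda>_::nat. 0::real" and ?b = "unit_top i"
    have J: "{j. ?a j < ?b j} = {..i}" by auto
    obtain p q r where p: "continuous_on (sphere_set i) p" "p \<in> sphere_set i \<rightarrow> nbox_bd ?a ?b"
      and r: "\<And>x. x \<in> nbox_bd ?a ?b \<Longrightarrow> r x = 1"
      and q: "continuous_on {x \<in> nbox ?a ?b. r x \<ge> (1/2::real)} q" "q \<in> {x \<in> nbox ?a ?b. r x \<ge> 1/2} \<rightarrow> sphere_set i"
      and qp: "\<And>x. x \<in> sphere_set i \<Longrightarrow> q (p x) = x"
      by (rule sphere_box[of ?a ?b i, unfolded J]) (simp, simp, simp, blast)
    let ?B = "nbox_bd ?a ?b"
    have Bb: "?B \<subseteq> nbox ?a ?b" by (auto simp: nbox_bd_def)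
    have Br: "?B \<subseteq> {x \<in> nbox ?a ?b. r x \<ge> 1/2}" using r Bb by auto
    have qc: "continuous_on ?B q" "q \<in> ?B \<rightarrow> sphere_set i"
      using continuous_on_subset[OF q(1) Br] q(2) Br by auto
    define \<phi> where "\<phi> = f \<circ> q"
    have \<phi>K: "\<phi> x \<in> greal K" if "x \<in> ?B" for x
      using qc(2) f(2) that by (auto simp: \<phi>_def)
    have \<phi>c: "continuous_on ?B \<phi>"
      using continuous_on_compose2[OF f(1) qc(1)] qc(2) by (auto simp: \<phi>_def o_def image_subset_iff_funcset)
    \<comment> \<open>With mesh 1 the boundary is already a finite union of closed cells.\<close>
    have "closed ?B"
      unfolding bcells_cover[of 1 i, simplified, symmetric]
      using bcells(1)[of i 1] by (intro closed_UN ballI closed_nbox) auto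
    then have "compact ?B"
      using compact_nbox[of ?a ?b] compact_Int_closed[of "nbox ?a ?b" ?B] Bb by (simp add: Int_absorb1)
    \<comment> \<open>The tolerance is \<open>1/2 - 1/3\<close>: a cell with some point of
      \<open>v\<close>-weight at least \<open>1/2\<close> has \<open>v\<close>-weight above
      \<open>1/3\<close> everywhere.\<close>
    obtain N where N: "N > 0" and mod:
      "\<And>x y. x \<in> ?B \<Longrightarrow> y \<in> ?B \<Longrightarrow> (\<And>j. \<bar>x j - y j\<bar> \<le> 1 / real N) \<Longrightarrow> \<bar>\<phi> x v - \<phi> y v\<bar> < 1/6"
      using grid_modulus[OF \<open>compact ?B\<close>, of "\<lambda>x. \<phi> x v" "1/6"]
        continuous_on_product_then_coordinatewise[OF \<phi>c, of v] by (metis zero_less_divide_1_iff zero_less_numeral)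
    note cover = bcells_cover[OF N, of i]
    have osc: "\<bar>\<phi> x v - \<phi> y v\<bar> < 1/6" if "c \<in> bcells i N" "x \<in> cell N c" "y \<in> cell N c" for c x y
    proof (rule mod)
      show "x \<in> ?B" "y \<in> ?B" using that cover by blast+
      fix j
      have "upper N c j - lower N c j \<le> 1 / real N" by (cases "even (c j)") (auto simp: lower_upper[OF N] add_divide_distrib)
      moreover have "lower N c j \<le> x j" "x j \<le> upper N c j" "lower N c j \<le> y j" "y j \<le> upper N c j"
        using that by (auto simp: nbox_def)
      ultimately show "\<bar>x j - y j\<bar> \<le> 1 / real N" by linarith
    qed
    define good where "good c \<longleftrightarrow> (\<forall>x\<in>cell N c. \<phi> x v < 1/2)" for c
    have bad: "1/3 < \<phi> x v" if "c \<in> bcells i N" "\<not> good c" "x \<in> cell N c" for c x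
    proof -
      obtain y where "y \<in> cell N c" "\<phi> y v \<ge> 1/2" using \<open>\<not> good c\<close> by (auto simp: good_def not_less)
      then show ?thesis using osc[OF that(1) that(3), of y] by linarith
    qed
    obtain \<psi> where \<psi>: "continuous_on ?B \<psi>" "\<forall>c\<in>bcells i N. good c \<longrightarrow> (\<forall>x\<in>cell N c. \<psi> x = \<phi> x)"
      "\<forall>c\<in>bcells i N. \<not> good c \<longrightarrow> \<psi> ` cell N c \<subseteq> W"
    proof -
      have "\<exists>\<psi>. continuous_on (\<Union>c\<in>bcells i N. cell N c) \<psi> \<and> (\<forall>c\<in>bcells i N. good c \<longrightarrow> (\<forall>x\<in>cell N c. \<psi> x = \<phi> x)) \<and>
      (\<forall>c\<in>bcells i N. \<not> good c \<longrightarrow> \<psi> ` cell N c \<subseteq> W)"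
      proof (rule skeleton_extension[OF N])
        show "good c'" if "good c" "face c' c" for c c' using that face_cell[OF N that(2)] by (auto simp: good_def)
        show "continuous_on (\<Union>c\<in>bcells i N. cell N c) \<phi>" using \<phi>c cover by simp
        show "k_connected (int i - 1) (top_of_set W)" by (rule k_connected_mono[OF kW]) (use i in simp)
        show "\<phi> ` cell N c' \<subseteq> W" if c: "c \<in> bcells i N" "\<not> good c" "face c' c" "good c'" for c c'
        proof clarify
          fix x assume x: "x \<in> cell N c'"
          then have "x \<in> cell N c" using face_cell[OF N c(3)] by blast
          then have "x \<in> ?B" "1/3 < \<phi> x v" using cover c(1) bad[OF c(1,2)] by blast+
          moreover have "\<phi> x v < 1/2" using c(4) x by (simp add: good_def)
          ultimately show "\<phi> x \<in> W" using \<phi>K by (simp add: W_def)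
        qed
      qed (use bcells in auto)
      then show ?thesis using that cover by auto
    qed
    have \<psi>U: "\<psi> x \<in> U" and H\<psi>: "H (\<psi> x) = H (\<phi> x)" if x: "x \<in> ?B" for x
    proof -
      obtain c where c: "c \<in> bcells i N" "x \<in> cell N c" using x cover by blast
      have *: "\<psi> x \<in> U \<and> H (\<psi> x) = H (\<phi> x)"
      proof (cases "good c")
        case True
        then have "\<psi> x = \<phi> x" "\<phi> x v < 1/2" using \<psi>(2) c by (auto simp: good_def)
        then show ?thesis using \<phi>K[OF x] by (simp add: U_def)
      next
        case False
        then have w: "\<psi> x \<in> W" using \<psi>(3) c by blast
        have "H (\<phi> x) = (\<lambda>u. if u = v then 1 else 0)" using H_v[OF \<phi>K[OF x]] bad[OF c(1) False c(2)] by simp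
        moreover have "H (\<psi> x) = (\<lambda>u. if u = v then 1 else 0)" using w by (intro H_v) (auto simp: W_def)
        ultimately show ?thesis using w WU by auto
      qed
      then show "\<psi> x \<in> U" "H (\<psi> x) = H (\<phi> x)" by auto
    qed
    define f' where "f' = \<psi> \<circ> p"
    let ?S = "sphere_set i"
    have f': "continuous_on ?S f'" "f' \<in> ?S \<rightarrow> U"
      using continuous_on_compose2[OF \<psi>(1) p(1)] p(2) \<psi>U by (auto simp: f'_def o_def image_subset_iff_funcset)
    have UK: "U \<subseteq> greal K" by (auto simp: U_def)
    have Hf: "H (f' x) = H (f x)" if "x \<in> ?S" for x
      using H\<psi>[of "p x"] p(2) that qp[OF that] by (auto simp: f'_def \<phi>_def)
    have 1: "homotopic_in ?S (greal K) (H \<circ> f) f" using homotopic_in_compose_right[OF hH f] by simp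
    have 2: "homotopic_in ?S (greal K) (H \<circ> f') f'"
      using homotopic_in_compose_right[OF hH f'(1)] f'(2) UK by auto
    have 3: "homotopic_in ?S (greal K) (H \<circ> f) (H \<circ> f')"
      using homotopic_with_imp_continuous_maps[OF 1] Hf by (intro homotopic_in_eq) auto
    have 4: "homotopic_in ?S (greal K) (R \<circ> f') f'" using homotopic_in_compose_right[OF hR f'] by simp
    have "continuous_on ?S (R \<circ> f')" "R \<circ> f' \<in> ?S \<rightarrow> greal D"
      using continuous_on_compose2[OF Rc[OF order_refl] f'(1)] f'(2) RU by (auto simp: o_def image_subset_iff_funcset)
    then obtain c where "homotopic_in ?S (greal D) (R \<circ> f') (\<lambda>_. c)"
      using del i unfolding k_connected_set D_def by blast
    then have 5: "homotopic_in ?S (greal K) (R \<circ> f') (\<lambda>_. c)" using gD by (rule homotopic_with_subset_right)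
    \<comment> \<open>The chain is \<open>f\<close>, \<open>H \<circ> f\<close>,
      \<open>H \<circ> f'\<close>, \<open>f'\<close>, \<open>R \<circ> f'\<close>, constant; only
      the last link uses the connectivity of the deletion.\<close>
    have "homotopic_in ?S (greal K) f (\<lambda>_. c)"
      by (rule homotopic_with_trans[OF homotopic_with_symD[OF 1] homotopic_with_trans[OF 3 homotopic_with_trans[OF 2
            homotopic_with_trans[OF homotopic_with_symD[OF 4] 5]]]])
    then show "\<exists>c. homotopic_in ?S (greal K) f (\<lambda>_. c)" by blast
  qed
qed

end

section \<open>Lower bound for the ladder of polygons\<close>

lemma finite_complex_indep: "finite V \<Longrightarrow> finite_complex V (indep_complex V E)"
  by unfold_locales (auto simp: indep_complex_def finite_subset)

definition conn :: "('a \<Rightarrow> 'a \<Rightarrow> bool) \<Rightarrow> int \<Rightarrow> 'a set \<Rightarrow> bool" where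
  "conn E k V \<longleftrightarrow> k_connected k (geom_real (indep_complex V E))"

lemma conn_mono: "conn E k V \<Longrightarrow> l \<le> k \<Longrightarrow> conn E l V"
  unfolding conn_def by (rule k_connected_mono)

lemma conn_trivial: "k \<le> -2 \<Longrightarrow> conn E k V"
  by (simp add: conn_def k_connected_def)

text \<open>Every simplex extends by \<open>v\<close>, so the complex is a cone with apex
  \<open>v\<close>, and all maps slide to the apex.\<close>

lemma conn_isolated:
  assumes fin: "finite V" and v: "v \<in> V" "\<And>u. u \<in> V \<Longrightarrow> \<not> E u v \<and> \<not> E v u"
  shows "conn E k V"
proof -
  let ?K = "indep_complex V E"
  interpret finite_complex V ?K by (rule finite_complex_indep[OF fin])
  define e where "e = (\<lambda>u. if u = v then 1 else 0 :: real)"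
  have "supp e = {v}" by (auto simp: e_def supp_def)
  then have e: "e \<in> greal ?K" using v by (auto simp: greal_def indep_complex_def e_def)
  show ?thesis unfolding conn_def geom_real_eq k_connected_set
  proof (intro conjI allI impI)
    show "greal ?K \<noteq> {}" using e by auto
    fix i f assume f: "continuous_on (sphere_set i) f" "f \<in> sphere_set i \<rightarrow> greal ?K"
    have "homotopic_in (sphere_set i) (greal ?K) f (\<lambda>_. e)"
    proof (rule homotopic_linear_fun)
      fix x and s :: real assume "x \<in> sphere_set i" and s: "0 \<le> s" "s \<le> 1"
      then have fx: "f x \<in> greal ?K" using f by auto
      then have "supp (f x) \<in> ?K" by (simp add: greal_def)
      then have "insert v (supp (f x)) \<in> ?K" using v by (auto simp: indep_complex_def)
      then show "(\<lambda>u. (1 - s) * f x u + s * e u) \<in> greal ?K"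
        using fx e s \<open>supp e = {v}\<close> by (intro segment_greal) auto
    qed (use f in auto)
    then show "\<exists>c. homotopic_in (sphere_set i) (greal ?K) f (\<lambda>_. c)" by blast
  qed
qed

abbreviation icone :: "'a set \<Rightarrow> ('a \<Rightarrow> 'a \<Rightarrow> bool) \<Rightarrow> ('a \<Rightarrow> real) set" where
  "icone V E \<equiv> wcone (indep_complex V E)"

lemma conn_cone_iff:
  assumes "finite V"
  shows "conn E k V \<longleftrightarrow> k_connected k (top_of_set (icone V E))"
  using finite_complex.dominates_cone_greal[OF finite_complex_indep[OF assms, of E]] k_connected_dominates
  unfolding conn_def geom_real_eq by blast

lemma conn_iso:
  assumes fin: "finite V'" and f: "bij_betw f V V'" and E: "\<And>u v. u \<in> V \<Longrightarrow> v \<in> V \<Longrightarrow> E' (f u) (f v) \<longleftrightarrow> E u v"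
    and "conn E k V"
  shows "conn E' k V'"
proof -
  have finV: "finite V" using fin f bij_betw_finite by blast
  define g where "g = inv_into V f"
  have gf: "g (f u) = u" "f u \<in> V'" if "u \<in> V" for u
    using that f by (auto simp: g_def bij_betw_inv_into_left bij_betwE)
  have fg: "f (g u) = u" "g u \<in> V" if "u \<in> V'" for u
    using that f bij_betw_inv_into_right[OF f] by (auto simp: g_def bij_betw_def inv_into_into)
  define F where "F x = (\<lambda>u. if u \<in> V' then x (g u) else 0 :: real)" for x
  define G where "G x = (\<lambda>u. if u \<in> V then x (f u) else 0 :: real)" for x
  let ?K = "icone V E" and ?K' = "icone V' E'"
  have "continuous_on S (\<lambda>x. F x u)" "continuous_on S' (\<lambda>x. G x v)" for S S' u v
    by (cases "u \<in> V'"; cases "v \<in> V"; simp add: F_def G_def continuous_on_coordinate)+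
  then have c: "continuous_on S F" "continuous_on S' G" for S S'
    by (auto intro!: continuous_on_coordinatewise_then_product)
  have FK: "F \<in> ?K \<rightarrow> ?K'"
  proof
    fix x assume x: "x \<in> ?K"
    then have xs: "supp x \<subseteq> V" "\<And>u v. u \<in> supp x \<Longrightarrow> v \<in> supp x \<Longrightarrow> \<not> E u v" "supp x \<noteq> {}" "\<And>u. x u \<ge> 0"
      by (auto simp: wcone_def indep_complex_def)
    have s: "supp (F x) = f ` supp x"
    proof (rule Set.set_eqI)
      fix u
      show "u \<in> supp (F x) \<longleftrightarrow> u \<in> f ` supp x"
      proof
        assume "u \<in> supp (F x)"
        then have "u \<in> V'" "g u \<in> supp x" by (auto simp: F_def supp_def split: if_splits)
        then show "u \<in> f ` supp x" using fg(1)[of u] by (metis imageI)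
      next
        assume "u \<in> f ` supp x"
        then obtain w where "w \<in> supp x" "u = f w" by blast
        then show "u \<in> supp (F x)" using gf[of w] xs(1) by (auto simp: F_def supp_def)
      qed
    qed
    then have "supp (F x) \<in> indep_complex V' E'"
      using xs gf E finV finite_subset[OF xs(1)] by (auto simp: indep_complex_def subset_iff)
    then show "F x \<in> ?K'" using xs s by (auto simp: wcone_def F_def)
  qed
  have GK: "G \<in> ?K' \<rightarrow> ?K"
  proof
    fix x assume x: "x \<in> ?K'"
    then have xs: "supp x \<subseteq> V'" "\<And>u v. u \<in> supp x \<Longrightarrow> v \<in> supp x \<Longrightarrow> \<not> E' u v" "supp x \<noteq> {}" "\<And>u. x u \<ge> 0"
      by (auto simp: wcone_def indep_complex_def)
    have s: "supp (G x) = g ` supp x"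
    proof (rule Set.set_eqI)
      fix u
      show "u \<in> supp (G x) \<longleftrightarrow> u \<in> g ` supp x"
      proof
        assume "u \<in> supp (G x)"
        then have "u \<in> V" "f u \<in> supp x" by (auto simp: G_def supp_def split: if_splits)
        then show "u \<in> g ` supp x" using gf(1)[of u] by (metis imageI)
      next
        assume "u \<in> g ` supp x"
        then obtain w where "w \<in> supp x" "u = g w" by blast
        then show "u \<in> supp (G x)" using fg[of w] xs(1) by (auto simp: G_def supp_def)
      qed
    qed
    have "\<not> E (g u) (g v)" if "u \<in> supp x" "v \<in> supp x" for u v
      using E[of "g u" "g v"] xs(1,2) that fg by (metis subsetD)
    then have "supp (G x) \<in> indep_complex V E"
      using s xs(1) fg finite_subset[OF xs(1) fin] by (auto simp: indep_complex_def subset_iff)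
    then show "G x \<in> ?K" using xs s by (auto simp: wcone_def G_def)
  qed
  have "homotopic_in ?K' ?K' (F \<circ> G) id"
  proof (rule homotopic_in_eq)
    show "continuous_on ?K' (F \<circ> G)" unfolding o_def by (rule continuous_on_compose2[OF c(1)[of UNIV] c(2)]) auto
    show "F \<circ> G \<in> ?K' \<rightarrow> ?K'" using FK GK by auto
    fix x assume "x \<in> ?K'"
    then have "supp x \<subseteq> V'" by (auto simp: wcone_def indep_complex_def)
    then show "(F \<circ> G) x = id x" using fg by (auto simp: F_def G_def supp_def fun_eq_iff)
  qed
  then have "dominates ?K ?K'" unfolding dominates_def using c FK GK by blast
  then show ?thesis using assms(4) k_connected_dominates[of ?K ?K' k]
    by (simp add: conn_cone_iff fin finV)
qed

locale simple_graph =
  fixes E :: "'a \<Rightarrow> 'a \<Rightarrow> bool"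
  assumes sym: "E u v \<Longrightarrow> E v u" and irrefl: "\<not> E v v"
begin

lemma conn_nonempty:
  assumes "v \<in> V" shows "conn E (-1) V"
proof -
  define e where "e = (\<lambda>u. if u = v then 1 else 0 :: real)"
  have "supp e = {v}" by (auto simp: e_def supp_def)
  then have "e \<in> greal (indep_complex V E)" using assms irrefl by (auto simp: greal_def indep_complex_def e_def)
  then show ?thesis unfolding conn_def geom_real_eq k_connected_set by auto
qed

text \<open>Deletion and link of \<open>v\<close> are again independence complexes: of the graph
  without \<open>v\<close> and of the graph on the non-neighbours of \<open>v\<close>.\<close>

lemma conn_vertex:
  assumes fin: "finite V" and v: "v \<in> V" and "conn E k (V - {v})" "conn E (k - 1) {u \<in> V. u \<noteq> v \<and> \<not> E v u}"
  shows "conn E k V"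
proof -
  interpret finite_complex V "indep_complex V E" by (rule finite_complex_indep[OF fin])
  have "{S \<in> indep_complex V E. v \<notin> S} = indep_complex (V - {v}) E"
    by (auto simp: indep_complex_def)
  moreover have "{S. v \<notin> S \<and> insert v S \<in> indep_complex V E} = indep_complex {u \<in> V. u \<noteq> v \<and> \<not> E v u} E"
    using v sym irrefl by (auto simp: indep_complex_def)
  ultimately show ?thesis
    using k_connected_vertex[of k v] assms(3,4) by (simp add: conn_def geom_real_eq)
qed

text \<open>All neighbours of \<open>u\<close> are neighbours of \<open>v\<close>, so
  \<open>u\<close> is isolated among the non-neighbours of \<open>v\<close>. The link of
  \<open>v\<close> is then a cone and puts no bound on \<open>k\<close>.\<close>

lemma conn_fold:
  assumes "finite V" "u \<in> V" "v \<in> V" "u \<noteq> v" "\<not> E u v" "\<And>x. x \<in> V \<Longrightarrow> E x u \<Longrightarrow> E x v" "conn E k (V - {v})"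
  shows "conn E k V"
proof (rule conn_vertex[OF assms(1,3,7)])
  show "conn E (k - 1) {u \<in> V. u \<noteq> v \<and> \<not> E v u}"
    by (rule conn_isolated[of _ u]) (use assms sym in auto)
qed

text \<open>The other neighbours of \<open>w\<close> are folded away against the leaf
  \<open>u\<close>, whose only neighbour \<open>w\<close> is also theirs. Afterwards deleting
  \<open>w\<close> isolates \<open>u\<close>, so only the link of \<open>w\<close> matters, and it
  costs one dimension.\<close>

lemma conn_leaf:
  assumes fin: "finite V" and u: "u \<in> V" and w: "w \<in> V" "E u w" and leaf: "\<And>x. x \<in> V \<Longrightarrow> E x u \<Longrightarrow> x = w"
    and k: "conn E (k - 1) {x \<in> V. x \<noteq> w \<and> \<not> E w x}"
  shows "conn E k V"
proof -
  define M where "M = {x \<in> V. E w x \<and> x \<noteq> u}"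
  have wM: "w \<notin> M" using irrefl by (auto simp: M_def)
  have uM: "u \<notin> M" by (auto simp: M_def)
  have "conn E k (V - F) \<longrightarrow> conn E k V" if "finite F" "F \<subseteq> M" for F
    using that
  proof (induction F)
    case (insert x F)
    have "conn E k (V - F)" if *: "conn E k (V - insert x F)"
    proof (rule conn_fold[of "V - F" u x])
      show "u \<noteq> x" "x \<in> V - F" using insert.prems insert.hyps uM by (auto simp: M_def)
      show "\<not> E u x"
      proof
        assume "E u x"
        then have "x = w" using leaf[OF _ sym] insert.prems by (simp add: M_def)
        then show False using insert.prems wM by simp
      qed
      show "E y x" if "y \<in> V - F" "E y u" for y
      proof -
        have "y = w" using leaf[of y] that by simp
        then show ?thesis using insert.prems by (simp add: M_def)
      qed
      show "conn E k (V - F - {x})" unfolding Diff_insert[symmetric] by (rule *)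
      show "finite (V - F)" "u \<in> V - F" using fin u insert.prems uM by auto
    qed
    then show ?case using insert.IH insert.prems by blast
  qed auto
  moreover have "conn E k (V - M)"
  proof (rule conn_vertex[of _ w])
    show "conn E k (V - M - {w})"
    proof (rule conn_isolated[of _ u])
      show "\<not> E y u \<and> \<not> E u y" if "y \<in> V - M - {w}" for y
        using leaf[of y] sym[of u y] that by blast
      show "u \<in> V - M - {w}" using u uM w(2) irrefl by auto
    qed (use fin in simp)
    have "{x \<in> V - M. x \<noteq> w \<and> \<not> E w x} = {x \<in> V. x \<noteq> w \<and> \<not> E w x}" by (auto simp: M_def)
    then show "conn E (k - 1) {x \<in> V - M. x \<noteq> w \<and> \<not> E w x}" using k by simp
  qed (use fin w wM in auto)
  moreover have "finite M" using fin by (simp add: M_def)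
  ultimately show ?thesis by blast
qed

end

text \<open>
  The paths of all polygons are concatenated: \<open>Pv h x\<close> is the vertex at position \<open>x\<close>, counted from 0,
  of the upper or lower boundary path, and each polygon contributes \<open>L\<close> positions to each of them.
\<close>

datatype pvtx = Av nat | Pv bool nat

text \<open>Positions are unbounded here; the vertex sets restrict them. Consecutive numbering makes
  the edges between polygons ordinary path edges, and \<open>Av i\<close> sees the last position of
  one polygon and the first of the next. For \<open>L = 1\<close> position \<open>i * L\<close> is
  adjacent to both \<open>Av i\<close> and \<open>Av (i + 1)\<close>.\<close>

fun padj :: "nat \<Rightarrow> pvtx \<Rightarrow> pvtx \<Rightarrow> bool" where
  "padj L (Av i) (Av j) = False"
| "padj L (Av i) (Pv h x) = (x = i * L \<or> x + 1 = i * L)"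
| "padj L (Pv h x) (Av i) = (x = i * L \<or> x + 1 = i * L)"
| "padj L (Pv h x) (Pv h' y) = (h = h' \<and> (y = x + 1 \<or> x = y + 1))"

interpretation padj: simple_graph "padj L" for L
proof
  show "padj L v u" if "padj L u v" for u v
    using that by (cases u; cases v) auto
  show "\<not> padj L v v" for v by (cases v) auto
qed

locale ladder =
  fixes m t :: nat
begin

definition "L = 3 * m + 1"

fun inQ :: "nat \<Rightarrow> (bool \<Rightarrow> nat) \<Rightarrow> pvtx \<Rightarrow> bool" where
  "inQ i P (Av j) = (i \<le> j \<and> j \<le> t)"
| "inQ i P (Pv h x) = (P h \<le> x \<and> x < t * L)"

text \<open>All graphs of the recursion have this shape, because the reductions consume the ladder
  from its left end: \<open>i\<close> is the first polygon vertex left and \<open>P h\<close> the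
  first position left on each path.\<close>

definition Q :: "nat \<Rightarrow> (bool \<Rightarrow> nat) \<Rightarrow> pvtx set" where
  "Q i P = {u. inQ i P u}"

definition starts :: "nat \<Rightarrow> nat \<Rightarrow> bool \<Rightarrow> nat" where
  "starts p q h = (if h then p else q)"

lemma starts_simps [simp]: "starts p q True = p" "starts p q False = q"
  "(starts p q)(True := p') = starts p' q" "(starts p q)(False := q') = starts p q'"
  by (auto simp: starts_def fun_eq_iff)

abbreviation qconn where "qconn \<equiv> conn (padj L)"

lemma finite_Q: "finite (Q i P)"
proof (rule finite_subset)
  show "Q i P \<subseteq> Av ` {..t} \<union> (\<lambda>(h, x). Pv h x) ` (UNIV \<times> {..<t * L})"
  proof
    fix u assume "u \<in> Q i P"
    then show "u \<in> Av ` {..t} \<union> (\<lambda>(h, x). Pv h x) ` (UNIV \<times> {..<t * L})"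
      by (cases u) (auto simp: Q_def)
  qed
qed auto

lemma L_pos: "0 < L"
  by (simp add: L_def)

lemma L_less: "i < j \<Longrightarrow> i * L + L \<le> j * L"
  by (metis Suc_leI add.commute mult_Suc mult_le_mono1)

text \<open>The bound \<open>P h + 3 \<le> i * L\<close> keeps the remaining polygon vertices away
  from the first two positions. So the first position is a leaf, and the closed neighbourhood of its
  neighbour is the first triple of the path.\<close>

lemma path3:
  assumes "P h + 3 \<le> i * L" "P h + 1 < t * L" "qconn (k - 1) (Q i (P(h := P h + 3)))"
  shows "qconn k (Q i P)"
proof (rule padj.conn_leaf[of _ "Pv h (P h)" "Pv h (P h + 1)"])
  have far: "P h + 3 \<le> j * L" if "i \<le> j" for j
    using assms(1) that by (meson le_trans mult_le_mono1)
  show "y = Pv h (P h + 1)" if "y \<in> Q i P" "padj L y (Pv h (P h))" for y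
  proof (cases y)
    case (Av j) then show ?thesis using that far[of j] by (auto simp: Q_def)
  qed (use that in \<open>auto simp: Q_def\<close>)
  have "{x \<in> Q i P. x \<noteq> Pv h (P h + 1) \<and> \<not> padj L (Pv h (P h + 1)) x} = Q i (P(h := P h + 3))"
  proof (rule Set.set_eqI)
    fix y show "y \<in> {x \<in> Q i P. x \<noteq> Pv h (P h + 1) \<and> \<not> padj L (Pv h (P h + 1)) x} \<longleftrightarrow> y \<in> Q i (P(h := P h + 3))"
    proof (cases y)
      case (Av j) then show ?thesis using far[of j] by (auto simp: Q_def)
    qed (auto simp: Q_def)
  qed
  then show "qconn (k - 1) {x \<in> Q i P. x \<noteq> Pv h (P h + 1) \<and> \<not> padj L (Pv h (P h + 1)) x}"
    using assms(3) by simp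
qed (use assms(2) finite_Q in \<open>auto simp: Q_def\<close>)

text \<open>The bound \<open>t * L + 1\<close> lets the middle vertex of the last triple exist,
  while its third vertex may lie beyond the end of the path.\<close>

lemma path3s:
  assumes "P h + 3 * a \<le> i * L" "P h + 3 * a \<le> t * L + 1" "qconn (k - int a) (Q i (P(h := P h + 3 * a)))"
  shows "qconn k (Q i P)"
  using assms
proof (induction a arbitrary: k)
  case (Suc a)
  have "qconn (k - int a) (Q i (P(h := P h + 3 * a)))"
  proof (rule path3[of _ h])
    have "(P(h := P h + 3 * a))(h := (P(h := P h + 3 * a)) h + 3) = P(h := P h + 3 * Suc a)"
      by (simp add: fun_eq_iff)
    moreover have "k - int a - 1 = k - int (Suc a)" by simp
    ultimately show "qconn (k - int a - 1) (Q i ((P(h := P h + 3 * a))(h := (P(h := P h + 3 * a)) h + 3)))"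
      using Suc.prems(3) by (simp only:)
  qed (use Suc.prems in auto)
  moreover have "P h + 3 * a \<le> i * L" "P h + 3 * a \<le> t * L + 1" using Suc.prems by auto
  ultimately show ?case using Suc.IH by blast
qed auto

text \<open>Here the neighbour of the leaf is the last position before \<open>i * L\<close>. Its
  closed neighbourhood also contains \<open>Av i\<close>, hence the step to
  \<open>i + 1\<close>.\<close>

lemma path2:
  assumes "P h + 2 = i * L" "i \<le> t" "qconn (k - 1) (Q (i + 1) (P(h := P h + 3)))"
  shows "qconn k (Q i P)"
proof (rule padj.conn_leaf[of _ "Pv h (P h)" "Pv h (P h + 1)"])
  have far: "P h + 3 \<le> j * L" if "i < j" for j
    using assms(1) L_less[OF that] by (simp add: L_def)
  have tL: "i * L \<le> t * L" using assms(2) by simp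
  show "y = Pv h (P h + 1)" if "y \<in> Q i P" "padj L y (Pv h (P h))" for y
  proof (cases y)
    case (Av j) then show ?thesis using that far[of j] assms(1) by (cases "i = j") (auto simp: Q_def)
  qed (use that in \<open>auto simp: Q_def\<close>)
  have "{x \<in> Q i P. x \<noteq> Pv h (P h + 1) \<and> \<not> padj L (Pv h (P h + 1)) x} = Q (i + 1) (P(h := P h + 3))"
  proof (rule Set.set_eqI)
    fix y show "y \<in> {x \<in> Q i P. x \<noteq> Pv h (P h + 1) \<and> \<not> padj L (Pv h (P h + 1)) x} \<longleftrightarrow> y \<in> Q (i + 1) (P(h := P h + 3))"
    proof (cases y)
      case (Av j)
      consider "j < i" | "j = i" | "i < j" by linarith
      then show ?thesis using far[of j] assms(1) Av L_pos by cases (auto simp: Q_def)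
    qed (auto simp: Q_def)
  qed
  then show "qconn (k - 1) {x \<in> Q i P. x \<noteq> Pv h (P h + 1) \<and> \<not> padj L (Pv h (P h + 1)) x}"
    using assms(3) by simp
  have "P h + 1 < t * L" using tL assms(1) by linarith
  then show "Pv h (P h) \<in> Q i P" "Pv h (P h + 1) \<in> Q i P" by (auto simp: Q_def)
qed (use finite_Q in auto)

text \<open>This and the next three rules state every number as a separate equation, so that
  backward use leaves only linear arithmetic.\<close>

lemma path3_T:
  assumes "qconn k' (Q i (starts p' q))" "p' = p + 3 * a" "p' \<le> i * L" "p' \<le> t * L + 1" "k' = k - int a"
  shows "qconn k (Q i (starts p q))"
  using path3s[of "starts p q" True a i k] assms by simp

lemma path3_F:
  assumes "qconn k' (Q i (starts p q'))" "q' = q + 3 * a" "q' \<le> i * L" "q' \<le> t * L + 1" "k' = k - int a"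
  shows "qconn k (Q i (starts p q))"
  using path3s[of "starts p q" False a i k] assms by simp

lemma path2_T:
  assumes "qconn k' (Q i' (starts p' q))" "p + 2 = i * L" "i \<le> t" "p' = p + 3" "i' = i + 1" "k' = k - 1"
  shows "qconn k (Q i (starts p q))"
  using path2[of "starts p q" True i k] assms by simp

lemma path2_F:
  assumes "qconn k' (Q i' (starts p q'))" "q + 2 = i * L" "i \<le> t" "q' = q + 3" "i' = i + 1" "k' = k - 1"
  shows "qconn k (Q i (starts p q))"
  using path2[of "starts p q" False i k] assms by simp

lemma mult_L: "(k + 1) * L = k * L + L" "(k + 2) * L = k * L + 2 * L" "(k + 3) * L = k * L + 3 * L"
  by (simp_all add: add_mult_distrib)

text \<open>
  The states of the recursion: \<open>Gs k\<close> is the ladder of the last \<open>t - k\<close> polygons, \<open>Hs k\<close> (for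
  \<open>k \<ge> 1\<close>) has one more vertex at the start of the upper path, and \<open>Ss k\<close> is what both branchings
  produce when two consecutive polygon vertices are lost.
\<close>

definition "Gs k = Q k (starts (k * L) (k * L))"
definition "Hs k = Q k (starts (k * L - 1) (k * L))"
definition "Ss k = Q (k + 2) (starts (k * L + L + 1) (k * L))"

text \<open>The lower path loses \<open>2 * m\<close> triples, then a triple together with
  \<open>Av (k + 2)\<close>, then \<open>m\<close> triples; the upper path loses
  \<open>2 * m\<close> triples. These \<open>5 * m + 1\<close> reductions are composed from the
  small graph back to \<open>Ss k\<close>.\<close>

lemma Ss_step:
  assumes "k + 3 \<le> t" "qconn (j - (5 * int m + 1)) (Hs (k + 3))"
  shows "qconn j (Ss k)"
proof -
  have "(k + 3) * L \<le> t * L" using assms(1) mult_le_mono1 by blast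
  note F = this[unfolded mult_L] L_def
  have e: "(k + 3) * L - 1 = k * L + 9 * m + 2" "(k + 3) * L = k * L + 9 * m + 3"
    unfolding mult_L using F by linarith+
  have 1: "qconn (j - (5 * int m + 1)) (Q (k + 3) (starts (k * L + 9 * m + 2) (k * L + 9 * m + 3)))"
    using assms(2) unfolding Hs_def e(1) unfolding e(2) .
  have 2: "qconn (j - (4 * int m + 1)) (Q (k + 3) (starts (k * L + 9 * m + 2) (k * L + 6 * m + 3)))"
    by (rule path3_F[OF 1, of _ m]) (unfold mult_L | use F in \<open>linarith | simp\<close>)+
  have 3: "qconn (j - (2 * int m + 1)) (Q (k + 3) (starts (k * L + L + 1) (k * L + 6 * m + 3)))"
    by (rule path3_T[OF 2, of _ "2 * m"]) (unfold mult_L | use F in \<open>linarith | simp\<close>)+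
  have 4: "qconn (j - 2 * int m) (Q (k + 2) (starts (k * L + L + 1) (k * L + 6 * m)))"
    by (rule path2_F[OF 3]) (unfold mult_L | use F assms(1) in \<open>linarith | simp\<close>)+
  show ?thesis unfolding Ss_def
    by (rule path3_F[OF 4, of _ "2 * m"]) (unfold mult_L | use F in \<open>linarith | simp\<close>)+
qed

text \<open>The \<open>2 * m + 1\<close> reductions on the lower path and \<open>m\<close> on the
  upper one bring the required connectivity down to -2, which is no condition.\<close>

lemma Ss_2:
  assumes "k + 2 = t" "j \<le> 3 * int m - 1"
  shows "qconn j (Ss k)"
proof -
  have "(k + 2) * L = t * L" using assms(1) by simp
  note F = this[unfolded mult_L] L_def
  have 2: "qconn (j - (3 * int m + 1)) (Q (k + 3) (starts (k * L + L + 1 + 3 * m) (k * L + 6 * m + 3)))"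
    using assms(2) by (intro conn_trivial) simp
  have 3: "qconn (j - (2 * int m + 1)) (Q (k + 3) (starts (k * L + L + 1) (k * L + 6 * m + 3)))"
    by (rule path3_T[OF 2, of _ m]) (unfold mult_L | use F in \<open>linarith | simp\<close>)+
  have 4: "qconn (j - 2 * int m) (Q (k + 2) (starts (k * L + L + 1) (k * L + 6 * m)))"
    by (rule path2_F[OF 3]) (unfold mult_L | use F assms(1) in \<open>linarith | simp\<close>)+
  show ?thesis unfolding Ss_def
    by (rule path3_F[OF 4, of _ "2 * m"]) (unfold mult_L | use F in \<open>linarith | simp\<close>)+
qed

text \<open>The upper path is used up. The lower one has \<open>3 * m + 1\<close> vertices, so
  \<open>m\<close> triples leave a vertex, which gives connectivity -1.\<close>

lemma Ss_1:
  assumes "k + 1 = t" "j \<le> int m - 1"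
  shows "qconn j (Ss k)"
proof -
  have "(k + 1) * L = t * L" using assms(1) by simp
  note F = this[unfolded mult_L] L_def
  have "k * L + 3 * m < t * L" using F by linarith
  then have "Pv False (k * L + 3 * m) \<in> Q (k + 2) (starts (k * L + L + 1) (k * L + 3 * m))"
    by (simp add: Q_def)
  then have 1: "qconn (j - int m) (Q (k + 2) (starts (k * L + L + 1) (k * L + 3 * m)))"
    using assms(2) by (intro conn_mono[OF padj.conn_nonempty]) auto
  show ?thesis unfolding Ss_def
    by (rule path3_F[OF 1, of _ m]) (unfold mult_L | use F in \<open>linarith | simp\<close>)+
qed

text \<open>Without polygons only the vertex \<open>Av t\<close> remains, so the complex is a
  point.\<close>

lemma Gs_end: "qconn j (Gs t)"
proof (rule conn_isolated[of _ "Av t"])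
  show "\<not> padj L u (Av t) \<and> \<not> padj L (Av t) u" if "u \<in> Gs t" for u
    using that by (cases u) (auto simp: Gs_def Q_def starts_def split: if_splits)
qed (auto simp: Gs_def finite_Q, auto simp: Q_def)

text \<open>Branches at \<open>Av k\<close>. After its deletion the extra vertex lets the upper path
  run by triples into a \<open>path2\<close> step that takes \<open>Av (k + 1)\<close>, which gives
  \<open>Ss k\<close>. In the link both paths have lost their vertices next to \<open>Av k\<close>,
  and \<open>m\<close> triples on each lead to \<open>Gs (k + 1)\<close>.\<close>

lemma Hs_step:
  assumes k: "1 \<le> k" "k < t" and S: "qconn (j - (int m + 1)) (Ss k)" and G: "qconn (j - (2 * int m + 1)) (Gs (k + 1))"
  shows "qconn j (Hs k)"
proof (rule padj.conn_vertex[of _ "Av k"])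
  have kL: "1 \<le> k * L" using k L_pos by (simp add: Suc_le_eq)
  have "(k + 1) * L \<le> t * L" using k(2) mult_le_mono1[of "k + 1" t L] by simp
  note F = this[unfolded mult_L] L_def kL
  have "Hs k - {Av k} = Q (k + 1) (starts (k * L - 1) (k * L))"
  proof (rule Set.set_eqI)
    fix y show "y \<in> Hs k - {Av k} \<longleftrightarrow> y \<in> Q (k + 1) (starts (k * L - 1) (k * L))"
      by (cases y) (auto simp: Hs_def Q_def)
  qed
  moreover have "qconn j (Q (k + 1) (starts (k * L - 1) (k * L)))"
  proof -
    have 1: "qconn (j - int m) (Q (k + 1) (starts (k * L - 1 + 3 * m) (k * L)))"
      by (rule path2_T[OF S[unfolded Ss_def]]) (unfold mult_L | use F k in \<open>linarith | simp\<close>)+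
    show ?thesis by (rule path3_T[OF 1, of _ m]) (unfold mult_L | use F in \<open>linarith | simp\<close>)+
  qed
  ultimately show "qconn j (Hs k - {Av k})" by simp
  have "{u \<in> Hs k. u \<noteq> Av k \<and> \<not> padj L (Av k) u} = Q (k + 1) (starts (k * L + 1) (k * L + 1))"
  proof (rule Set.set_eqI)
    fix y show "y \<in> {u \<in> Hs k. u \<noteq> Av k \<and> \<not> padj L (Av k) u} \<longleftrightarrow> y \<in> Q (k + 1) (starts (k * L + 1) (k * L + 1))"
      using kL by (cases y) (auto simp: Hs_def Q_def starts_def split: if_splits)
  qed
  moreover have "qconn (j - 1) (Q (k + 1) (starts (k * L + 1) (k * L + 1)))"
  proof -
    have 1: "qconn (j - (int m + 1)) (Q (k + 1) (starts ((k + 1) * L) (k * L + 1)))"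
      by (rule path3_F[OF G[unfolded Gs_def], of _ m]) (unfold mult_L | use F in \<open>linarith | simp\<close>)+
    show ?thesis by (rule path3_T[OF 1, of _ m]) (unfold mult_L | use F in \<open>linarith | simp\<close>)+
  qed
  ultimately show "qconn (j - 1) {u \<in> Hs k. u \<noteq> Av k \<and> \<not> padj L (Av k) u}" by simp
qed (use k in \<open>auto simp: Hs_def finite_Q\<close>, auto simp: Q_def)

lemma Hs_end: "qconn (-1) (Hs t)"
  by (rule padj.conn_nonempty[of "Av t"]) (auto simp: Hs_def Q_def)

text \<open>Branches at the first vertex of the upper path. After its deletion \<open>Av k\<close>
  is a leaf on the lower path, which is shortened as a result; in the link the upper path is
  shortened. In both cases the shortened path then swallows \<open>Av (k + 1)\<close>, hence the
  index \<open>k + 2\<close>.\<close>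

lemma Gs_step:
  assumes k: "k < t" and S: "qconn (j - (int m + 1)) (Ss k)"
    and H: "qconn (j - (int m + 1)) (Q (k + 2) (starts (k * L + 1) (k * L + 3 * m + 2)))"
  shows "qconn j (Gs k)"
proof (rule padj.conn_vertex[of _ "Pv True (k * L)"])
  have "(k + 1) * L \<le> t * L" using k mult_le_mono1[of "k + 1" t L] by simp
  note F = this[unfolded mult_L] L_def
  have tL: "k * L + L \<le> t * L" using L_less[OF k] .
  have av: "padj L (Av i) (Pv h (k * L)) \<longleftrightarrow> i = k \<or> m = 0 \<and> i = k + 1" if "k \<le> i" for i h
  proof -
    consider "i = k" | "i = k + 1" | "k + 1 < i" using \<open>k \<le> i\<close> by linarith
    then show ?thesis
    proof cases
      case 3
      then have "(k + 1) * L + L \<le> i * L" by (rule L_less)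
      then have "k * L + 1 < i * L" using F L_pos unfolding mult_L by linarith
      then show ?thesis using 3 L_pos by simp
    next
      case 2
      then show ?thesis by (simp add: mult_L L_def)
    qed simp
  qed
  \<comment> \<open>For \<open>m = 0\<close> a polygon has one vertex on each path, which is
    adjacent to \<open>Av (k + 1)\<close> as well, so this vertex disappears at once.\<close>
  let ?i = "if m = 0 then k + 2 else k + 1"
  have 1: "Gs k - {Pv True (k * L)} = Q k (starts (k * L + 1) (k * L))"
  proof (rule Set.set_eqI)
    fix y show "y \<in> Gs k - {Pv True (k * L)} \<longleftrightarrow> y \<in> Q k (starts (k * L + 1) (k * L))"
      by (cases y) (auto simp: Gs_def Q_def starts_def)
  qed
  show "qconn j (Gs k - {Pv True (k * L)})"
    unfolding 1
  proof (rule padj.conn_leaf[of _ "Av k" "Pv False (k * L)"])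
    show "x = Pv False (k * L)" if "x \<in> Q k (starts (k * L + 1) (k * L))" "padj L x (Av k)" for x
      using that by (cases x) (auto simp: Q_def starts_def split: if_splits)
    have "{x \<in> Q k (starts (k * L + 1) (k * L)). x \<noteq> Pv False (k * L) \<and> \<not> padj L (Pv False (k * L)) x} =
      Q ?i (starts (k * L + 1) (k * L + 2))" (is "?A = ?B")
    proof (rule Set.set_eqI)
      fix y show "y \<in> ?A \<longleftrightarrow> y \<in> ?B"
      proof (cases y)
        case (Av i)
        then show ?thesis using av[of i False] by (auto simp: Q_def)
      qed (auto simp: Q_def starts_def)
    qed
    moreover have "qconn (j - 1) (Q ?i (starts (k * L + 1) (k * L + 2)))"
    proof (cases "m = 0")
      case True then show ?thesis using H by simp
    next
      case False
      then have m: "m \<ge> 1" "int (m - 1) = int m - 1" by auto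
      have 1: "qconn (j - int m) (Q (k + 1) (starts (k * L + 1) (k * L + 3 * m - 1)))"
        by (rule path2_F[OF H]) (unfold mult_L | use F k m(1) in \<open>linarith | simp\<close>)+
      have "qconn (j - 1) (Q (k + 1) (starts (k * L + 1) (k * L + 2)))"
        by (rule path3_F[OF 1, of _ "m - 1"]) (unfold mult_L | use F m in \<open>linarith | simp\<close>)+
      then show ?thesis using False by simp
    qed
    ultimately show "qconn (j - 1) ?A" by simp
  qed (use k tL finite_Q in \<open>auto simp: Q_def L_def\<close>)
  have "{u \<in> Gs k. u \<noteq> Pv True (k * L) \<and> \<not> padj L (Pv True (k * L)) u} = Q ?i (starts (k * L + 2) (k * L))" (is "?A = ?B")
  proof (rule Set.set_eqI)
    fix y show "y \<in> ?A \<longleftrightarrow> y \<in> ?B"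
    proof (cases y)
      case (Av i)
      then show ?thesis using av[of i True] by (auto simp: Q_def Gs_def)
    qed (auto simp: Gs_def Q_def starts_def)
  qed
  moreover have "qconn (j - 1) (Q ?i (starts (k * L + 2) (k * L)))"
  proof (cases "m = 0")
    case True
    have "L = 1" unfolding L_def using True by simp
    then have e: "k * L + L + 1 = k * L + 2" "j - (int m + 1) = j - 1" using True by auto
    show ?thesis using S True unfolding Ss_def e by simp
  next
    case False
    then have m: "m \<ge> 1" "int (m - 1) = int m - 1" by auto
    have 1: "qconn (j - int m) (Q (k + 1) (starts (k * L + 3 * m - 1) (k * L)))"
      by (rule path2_T[OF S[unfolded Ss_def]]) (unfold mult_L | use F k m(1) in \<open>linarith | simp\<close>)+
    have "qconn (j - 1) (Q (k + 1) (starts (k * L + 2) (k * L)))"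
      by (rule path3_T[OF 1, of _ "m - 1"]) (unfold mult_L | use F m in \<open>linarith | simp\<close>)+
    then show ?thesis using False by simp
  qed
  ultimately show "qconn (j - 1) ?A" by simp
  show "Pv True (k * L) \<in> Gs k" using tL by (auto simp: Gs_def Q_def L_def)
qed (auto simp: Gs_def finite_Q)

text \<open>With \<open>2 * m\<close> triples on the upper path and \<open>m\<close> on the lower
  one the starts reach \<open>(k + 2) * L - 1\<close> and \<open>(k + 2) * L\<close>, exactly those
  of \<open>Hs (k + 2)\<close>.\<close>

lemma Gs_2:
  assumes "k + 2 \<le> t" "qconn (j - (4 * int m + 1)) (Hs (k + 2))"
  shows "qconn (j - (int m + 1)) (Q (k + 2) (starts (k * L + 1) (k * L + 3 * m + 2)))"
proof -
  have "(k + 2) * L \<le> t * L" using assms(1) mult_le_mono1 by blast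
  note F = this[unfolded mult_L] L_def
  have e: "(k + 2) * L - 1 = k * L + 6 * m + 1" "(k + 2) * L = k * L + 6 * m + 2"
    unfolding mult_L using F by linarith+
  have 1: "qconn (j - (4 * int m + 1)) (Q (k + 2) (starts (k * L + 6 * m + 1) (k * L + 6 * m + 2)))"
    using assms(2) unfolding Hs_def e(1) unfolding e(2) .
  have 2: "qconn (j - (3 * int m + 1)) (Q (k + 2) (starts (k * L + 6 * m + 1) (k * L + 3 * m + 2)))"
    by (rule path3_F[OF 1, of _ m]) (unfold mult_L | use F in \<open>linarith | simp\<close>)+
  show ?thesis
    by (rule path3_T[OF 2, of _ "2 * m"]) (unfold mult_L | use F in \<open>linarith | simp\<close>)+
qed

text \<open>In the last polygon the lower path is used up, and \<open>m\<close> triples on the upper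
  one lower the demand to -2.\<close>

lemma Gs_1:
  assumes "k + 1 = t" "j \<le> 2 * int m - 1"
  shows "qconn (j - (int m + 1)) (Q (k + 2) (starts (k * L + 1) (k * L + 3 * m + 2)))"
proof -
  have "(k + 1) * L = t * L" using assms(1) by simp
  note F = this[unfolded mult_L] L_def
  have 1: "qconn (j - (2 * int m + 1)) (Q (k + 2) (starts (k * L + 1 + 3 * m) (k * L + 3 * m + 2)))"
    using assms(2) by (intro conn_trivial) simp
  show ?thesis
    by (rule path3_T[OF 1, of _ m]) (unfold mult_L | use F in \<open>linarith | simp\<close>)+
qed

text \<open>\<open>r\<close> is the number of polygons left. Each of them is worth
  \<open>2 * m + 1\<close>, and the rounded quotients subtract one dimension per three polygons. The
  two bounds need each other: \<open>Gs\<close> leads to \<open>Hs\<close> two polygons later,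
  \<open>Hs\<close> to \<open>Gs\<close> one later, and both to \<open>Ss\<close>, which returns to
  \<open>Hs\<close> three later.\<close>

lemma Gs_Hs_conn:
  assumes "k + r = t"
  shows "(r \<ge> 1 \<longrightarrow> qconn (2 * int m * int r + int r - 2 - int ((r - 1) div 3)) (Gs k)) \<and>
         (k \<ge> 1 \<longrightarrow> qconn (2 * int m * int r + int r - 1 - int ((r + 1) div 3)) (Hs k))"
  using assms
proof (induction r arbitrary: k rule: less_induct)
  case (less r)
  have IHG: "qconn l (Gs (k + d))" if "d \<ge> 1" "d < r"
    "l \<le> 2 * int m * int (r - d) + int (r - d) - 2 - int ((r - d - 1) div 3)" for d l
    using less.IH[of "r - d" "k + d"] less.prems that conn_mono by fastforce
  have IHH: "qconn l (Hs (k + d))" if "d \<ge> 1" "d \<le> r"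
    "l \<le> 2 * int m * int (r - d) + int (r - d) - 1 - int ((r - d + 1) div 3)" for d l
    using less.IH[of "r - d" "k + d"] less.prems that conn_mono by fastforce
  have SS: "qconn l (Ss k)" if "r \<ge> 1" "l \<le> 2 * int m * int r - int m + int r - 2 - int ((r + 1) div 3)" for l
  proof -
    consider "r = 1" | "r = 2" | "r \<ge> 3" using \<open>r \<ge> 1\<close> by linarith
    then show ?thesis
    proof cases
      case 1 then show ?thesis using that less.prems by (intro Ss_1) (auto simp: algebra_simps)
    next
      case 2 then show ?thesis using that less.prems by (intro Ss_2) (auto simp: algebra_simps)
    next
      case 3
      define r' where "r' = r - 3"
      then have r': "r = r' + 3" using 3 by simp
      then have "qconn (l - (5 * int m + 1)) (Hs (k + 3))"
        using that by (intro IHH) (auto simp: algebra_simps)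
      then show ?thesis using 3 less.prems by (intro Ss_step) auto
    qed
  qed
  have "qconn (2 * int m * int r + int r - 2 - int ((r - 1) div 3)) (Gs k)" if "r \<ge> 1"
  proof (rule Gs_step)
    have "(r + 1) div 3 \<le> (r - 1) div 3 + 1" by linarith
    then show "qconn (2 * int m * int r + int r - 2 - int ((r - 1) div 3) - (int m + 1)) (Ss k)"
      using that by (intro SS) auto
    show "qconn (2 * int m * int r + int r - 2 - int ((r - 1) div 3) - (int m + 1)) (Q (k + 2) (starts (k * L + 1) (k * L + 3 * m + 2)))"
    proof (cases "r = 1")
      case True then show ?thesis using less.prems by (intro Gs_1) auto
    next
      case False
      define r' where "r' = r - 2"
      then have r': "r = r' + 2" using False that by simp
      then show ?thesis using less.prems by (intro Gs_2 IHH) (auto simp: algebra_simps)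
    qed
  qed (use that less.prems in auto)
  moreover have "qconn (2 * int m * int r + int r - 1 - int ((r + 1) div 3)) (Hs k)" if "k \<ge> 1"
  proof (cases "r = 0")
    case True then show ?thesis using Hs_end less.prems by simp
  next
    case False
    then obtain r' where r': "r = r' + 1" by (metis Suc_eq_plus1 not0_implies_Suc)
    show ?thesis
    proof (rule Hs_step[OF that])
      show "qconn (2 * int m * int r + int r - 1 - int ((r + 1) div 3) - (int m + 1)) (Ss k)"
        using False by (intro SS) auto
      show "qconn (2 * int m * int r + int r - 1 - int ((r + 1) div 3) - (2 * int m + 1)) (Gs (k + 1))"
      proof (cases "r = 1")
        case True then show ?thesis using Gs_end less.prems by simp
      next
        case False
        have "(r + 1) div 3 = (r - 1 - 1) div 3 + 1" using False r' by linarith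
        then show ?thesis using False r' by (intro IHG) (auto simp: algebra_simps)
      qed
    qed (use False less.prems in auto)
  qed
  ultimately show ?case by blast
qed

end

section \<open>Identification of the recursive model with the given graph\<close>

context ladder begin

definition "n = 3 * m + 2"

lemma n_L: "n - 1 = L" "n - Suc 0 = L" "n - 2 = L - 1"
  by (simp_all add: n_def L_def)

definition path_vtx :: "bool \<Rightarrow> nat \<Rightarrow> nat \<Rightarrow> vtx" where
  "path_vtx h a b = (if h then B (a + 1) (b + 1) else C (a + 1) (b + 1))"

lemma Gedge_AA: "\<not> Gedge n t (A i) (A j)"
  by (auto simp: Gedge_def Gedge0_def)

lemma Gedge_AB:
  assumes "a < t" "b < L"
  shows "Gedge n t (A i) (path_vtx h a b) \<longleftrightarrow> i = a \<and> b = 0 \<or> i = a + 1 \<and> b + 1 = L"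
proof -
  have "Gedge n t (A i) (path_vtx h a b) \<longleftrightarrow>
      (\<exists>i'. 1 \<le> i' \<and> i' \<le> t \<and> (i = i' - 1 \<and> a + 1 = i' \<and> b + 1 = 1 \<or> i = i' \<and> a + 1 = i' \<and> b + 1 = L))"
    unfolding Gedge_def Gedge0_def n_L by (cases h) (simp_all add: path_vtx_def)
  then show ?thesis using assms by presburger
qed

lemma Gedge0_BB:
  assumes "a < t" "b < L" "a' < t" "b' < L"
  shows "Gedge0 n t (path_vtx h a b) (path_vtx h' a' b') \<longleftrightarrow> h = h' \<and>
    (a' = a \<and> b' = b + 1 \<or> a' = a + 1 \<and> b + 1 = L \<and> b' = 0)"
proof -
  have "Gedge0 n t (path_vtx h a b) (path_vtx h' a' b') \<longleftrightarrow> h = h' \<and>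
      ((\<exists>i j. 1 \<le> i \<and> i \<le> t \<and> 1 \<le> j \<and> j \<le> L - 1 \<and> a + 1 = i \<and> b + 1 = j \<and> a' + 1 = i \<and> b' + 1 = j + 1) \<or>
       (\<exists>i. 1 \<le> i \<and> i \<le> t - 1 \<and> a + 1 = i \<and> b + 1 = L \<and> a' + 1 = i + 1 \<and> b' + 1 = 1))"
    (is "_ \<longleftrightarrow> h = h' \<and> ?R")
    unfolding Gedge0_def n_L by (cases h; cases h') (simp_all add: path_vtx_def)
  moreover have "?R \<longleftrightarrow> a' = a \<and> b' = b + 1 \<or> a' = a + 1 \<and> b + 1 = L \<and> b' = 0"
    using assms by presburger
  ultimately show ?thesis by simp
qed

lemma Gedge_BB:
  assumes "a < t" "b < L" "a' < t" "b' < L"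
  shows "Gedge n t (path_vtx h a b) (path_vtx h' a' b') \<longleftrightarrow> h = h' \<and>
    (a' = a \<and> (b' = b + 1 \<or> b = b' + 1) \<or> a' = a + 1 \<and> b + 1 = L \<and> b' = 0 \<or> a = a' + 1 \<and> b' + 1 = L \<and> b = 0)"
  unfolding Gedge_def Gedge0_BB[OF assms] Gedge0_BB[OF assms(3,4,1,2)] by argo

lemma Gedge_sym: "Gedge n t u v \<longleftrightarrow> Gedge n t v u"
  by (auto simp: Gedge_def)

fun pvtx_to_vtx :: "pvtx \<Rightarrow> vtx" where
  "pvtx_to_vtx (Av j) = A j"
| "pvtx_to_vtx (Pv h x) = path_vtx h (x div L) (x mod L)"

text \<open>The two cases are the two kinds of path edges: inside a polygon, and from the last
  vertex of one polygon to the first of the next.\<close>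

lemma Suc_div_mod:
  "y = x + 1 \<longleftrightarrow> y div L = x div L \<and> y mod L = x mod L + 1 \<or> y div L = x div L + 1 \<and> x mod L + 1 = L \<and> y mod L = 0"
  (is "?l \<longleftrightarrow> ?r")
proof
  show ?r if ?l using that L_pos by (auto simp: div_Suc mod_Suc)
  show ?l if ?r
  proof -
    have xy: "x = x div L * L + x mod L" "y = y div L * L + y mod L" by simp_all
    from that show ?l
    proof
      assume "y div L = x div L \<and> y mod L = x mod L + 1"
      then show ?l using xy by simp
    next
      assume *: "y div L = x div L + 1 \<and> x mod L + 1 = L \<and> y mod L = 0"
      then have "y = (x div L + 1) * L" using xy(2) by simp
      also have "\<dots> = x div L * L + (x mod L + 1)" using * by (simp add: add_mult_distrib)
      finally show ?l using xy(1) by linarith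
    qed
  qed
qed

lemma mult_L_iff: "x = i * L \<longleftrightarrow> x div L = i \<and> x mod L = 0" "x + 1 = i * L \<longleftrightarrow> x div L + 1 = i \<and> x mod L + 1 = L"
proof -
  show 1: "x = i * L \<longleftrightarrow> x div L = i \<and> x mod L = 0" for x using L_pos by auto
  show "x + 1 = i * L \<longleftrightarrow> x div L + 1 = i \<and> x mod L + 1 = L"
    using 1[of "x + 1"] L_pos by (auto simp: div_Suc mod_Suc)
qed

lemma Gs_0_iff: "u \<in> Gs 0 \<longleftrightarrow> (case u of Av j \<Rightarrow> j \<le> t | Pv h x \<Rightarrow> x < t * L)"
  by (cases u) (auto simp: Gs_def Q_def starts_def)

lemma pvtx_to_vtx_bij: "bij_betw pvtx_to_vtx (Gs 0) (Gverts n t)"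
proof (rule bij_betw_imageI)
  have eq: "x = y" if "x div L = y div L" "x mod L = y mod L" for x y :: nat
    using that by (metis div_mult_mod_eq)
  show "inj_on pvtx_to_vtx (Gs 0)"
  proof (rule inj_onI)
    fix u v assume "pvtx_to_vtx u = pvtx_to_vtx v"
    then show "u = v" by (cases u; cases v) (auto simp: path_vtx_def split: if_splits intro: eq)
  qed
  show "pvtx_to_vtx ` Gs 0 = Gverts n t"
  proof (intro equalityI subsetI)
    fix y assume "y \<in> pvtx_to_vtx ` Gs 0"
    then obtain u where u: "u \<in> Gs 0" "y = pvtx_to_vtx u" by blast
    show "y \<in> Gverts n t"
    proof (cases u)
      case (Av j) then show ?thesis using u by (auto simp: Gs_0_iff Gverts_def)
    next
      case (Pv h x)
      then have "x div L < t" "x mod L < L" using u L_pos by (auto simp: Gs_0_iff less_mult_imp_div_less)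
      then show ?thesis using u Pv by (cases h) (auto simp: Gverts_def path_vtx_def n_L Suc_le_eq)
    qed
  next
    fix y assume y: "y \<in> Gverts n t"
    have "pvtx_to_vtx (Pv h (a * L + b)) = path_vtx h a b \<and> Pv h (a * L + b) \<in> Gs 0" if "a < t" "b < L" for h a b
    proof -
      have "a * L + L \<le> t * L" using that(1) by (rule L_less)
      then show ?thesis using that by (simp add: Gs_0_iff)
    qed
    then have *: "path_vtx h a b \<in> pvtx_to_vtx ` Gs 0" if "a < t" "b < L" for h a b using that by (metis imageI)
    show "y \<in> pvtx_to_vtx ` Gs 0"
    proof (cases y)
      case (A j)
      then have "y = pvtx_to_vtx (Av j)" "Av j \<in> Gs 0" using y by (auto simp: Gverts_def Gs_0_iff)
      then show ?thesis by blast
    next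
      case (B i j)
      then have "1 \<le> i" "i \<le> t" "1 \<le> j" "j \<le> L" using y by (auto simp: Gverts_def n_L)
      then show ?thesis using *[of "i - 1" "j - 1" True] B by (simp add: path_vtx_def)
    next
      case (C i j)
      then have "1 \<le> i" "i \<le> t" "1 \<le> j" "j \<le> L" using y by (auto simp: Gverts_def n_L)
      then show ?thesis using *[of "i - 1" "j - 1" False] C by (simp add: path_vtx_def)
    qed
  qed
qed

lemma pvtx_to_vtx_adj:
  assumes "u \<in> Gs 0" "v \<in> Gs 0"
  shows "Gedge n t (pvtx_to_vtx u) (pvtx_to_vtx v) \<longleftrightarrow> padj L u v"
proof -
  have P: "x div L < t" "x mod L < L" if "Pv h x \<in> Gs 0" for h x
    using that L_pos by (auto simp: Gs_0_iff less_mult_imp_div_less)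
  show ?thesis
  proof (cases u)
    case (Av i)
    show ?thesis
    proof (cases v)
      case (Av j) then show ?thesis using \<open>u = Av i\<close> by (simp add: Gedge_AA)
    next
      case (Pv h x)
      then show ?thesis using \<open>u = Av i\<close> Gedge_AB[of "x div L" "x mod L" i h] P[of h x] assms mult_L_iff[of x i]
        by auto
    qed
  next
    case (Pv h x)
    show ?thesis
    proof (cases v)
      case (Av i)
      then show ?thesis using \<open>u = Pv h x\<close> Gedge_AB[of "x div L" "x mod L" i h] P[of h x] assms mult_L_iff[of x i]
        by (subst Gedge_sym) auto
    next
      case (Pv h' y)
      then have "padj L u v \<longleftrightarrow> h = h' \<and> (y = x + 1 \<or> x = y + 1)" using \<open>u = Pv h x\<close> by simp
      moreover have "Gedge n t (pvtx_to_vtx u) (pvtx_to_vtx v) \<longleftrightarrow> h = h' \<and>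
          (y div L = x div L \<and> (y mod L = x mod L + 1 \<or> x mod L = y mod L + 1) \<or>
           y div L = x div L + 1 \<and> x mod L + 1 = L \<and> y mod L = 0 \<or>
           x div L = y div L + 1 \<and> y mod L + 1 = L \<and> x mod L = 0)"
        using Gedge_BB[of "x div L" "x mod L" "y div L" "y mod L" h h'] P[of h x] P[of h' y] assms \<open>u = Pv h x\<close> Pv
        by simp
      ultimately show ?thesis unfolding Suc_div_mod[of y x] Suc_div_mod[of x y] eq_commute[of "x div L" "y div L"]
        by argo
    qed
  qed
qed

lemma finite_Gverts: "finite (Gverts n t)"
  by (auto simp: Gverts_def)

lemma Gverts_conn:
  assumes "t \<ge> 1"
  shows "conn (Gedge n t) (2 * int m * int t + int t - 2 - int ((t - 1) div 3)) (Gverts n t)"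
proof (rule conn_iso[where f = pvtx_to_vtx and V = "Gs 0" and E = "padj L", OF finite_Gverts pvtx_to_vtx_bij pvtx_to_vtx_adj])
  show "qconn (2 * int m * int t + int t - 2 - int ((t - 1) div 3)) (Gs 0)"
    using Gs_Hs_conn[of 0 t] assms by simp
qed

end

section \<open>Domination of independence complexes\<close>

text \<open>The round trip may lose support but never gain it, so every point and its image lie in a
  common simplex.\<close>

lemma conn_dominated:
  assumes "finite V" "finite V'"
    and f: "continuous_on (icone V E) f" "f \<in> icone V E \<rightarrow> icone V' E'"
    and g: "continuous_on (icone V' E') g" "g \<in> icone V' E' \<rightarrow> icone V E"
    and fg: "\<And>x. x \<in> icone V' E' \<Longrightarrow> supp (f (g x)) \<subseteq> supp x"
    and "conn E k V"
  shows "conn E' k V'"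
proof -
  have dom: "dominates (icone V E) (icone V' E')"
  proof (rule dominates_contiguous[OF finite_complex_indep finite_complex_indep f g])
    fix x assume x: "x \<in> icone V' E'"
    then show "supp (f (g x)) \<union> supp x \<in> indep_complex V' E'"
      using fg[OF x] by (simp add: wcone_def Un_absorb1)
  qed fact+
  show ?thesis
    using assms(8) unfolding conn_cone_iff[OF assms(1)] conn_cone_iff[OF assms(2)] by (rule k_connected_dominates[OF dom])
qed

lemma in_cone_indep:
  assumes "finite V"
  shows "f \<in> icone V E \<longleftrightarrow> (\<forall>u. 0 \<le> f u) \<and> (\<forall>u. f u \<noteq> 0 \<longrightarrow> u \<in> V) \<and>
    (\<forall>u v. f u \<noteq> 0 \<longrightarrow> f v \<noteq> 0 \<longrightarrow> \<not> E u v) \<and> (\<exists>u. f u \<noteq> 0)"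
  using assms finite_subset[of "{u. f u \<noteq> 0}" V] by (auto simp: wcone_def indep_complex_def supp_def)

text \<open>As \<open>h\<close> reflects edges, it sends independent sets to independent sets.
  Pushing weights forward along \<open>h\<close> thus retracts the complex of \<open>V\<close> onto
  that of \<open>T\<close>.\<close>

lemma conn_retract:
  assumes fin: "finite V" and T: "T \<subseteq> V" and h: "\<And>u. u \<in> V \<Longrightarrow> h u \<in> T" "\<And>u. u \<in> T \<Longrightarrow> h u = u"
    and E: "\<And>u v. u \<in> V \<Longrightarrow> v \<in> V \<Longrightarrow> E (h u) (h v) \<Longrightarrow> E u v" and "conn E k V"
  shows "conn E k T"
proof -
  have finT: "finite T" using fin T finite_subset by blast
  define F where "F f = (\<lambda>u. \<Sum>v\<in>{v \<in> V. h v = u}. f v :: real)" for f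
  have F0: "F f u \<noteq> 0 \<Longrightarrow> \<exists>v\<in>V. h v = u \<and> f v \<noteq> 0" for f u
    unfolding F_def by (metis (mono_tags, lifting) mem_Collect_eq sum.neutral)
  show ?thesis
  proof (rule conn_dominated[OF fin finT _ _ _ _ _ assms(6)])
    show "continuous_on (icone V E) F"
      unfolding F_def by (intro continuous_on_coordinatewise_then_product continuous_on_sum continuous_on_coordinate)
    show "F \<in> icone V E \<rightarrow> icone T E"
    proof
      fix f assume "f \<in> icone V E"
      then have f: "\<And>u. 0 \<le> f u" "\<And>u. f u \<noteq> 0 \<Longrightarrow> u \<in> V" "\<And>u v. f u \<noteq> 0 \<Longrightarrow> f v \<noteq> 0 \<Longrightarrow> \<not> E u v" "\<exists>u. f u \<noteq> 0"
        by (auto simp: in_cone_indep[OF fin])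
      have "\<not> E u v" if "F f u \<noteq> 0" "F f v \<noteq> 0" for u v
        using F0[OF that(1)] F0[OF that(2)] f(3) E by blast
      moreover have "u \<in> T" if "F f u \<noteq> 0" for u using F0[OF that] h by blast
      moreover obtain u where u: "f u \<noteq> 0" using f(4) by blast
      then have "F f (h u) > 0" unfolding F_def using f(1,2) fin
        by (intro sum_pos2[of _ u]) (auto simp: less_le)
      then have "F f (h u) \<noteq> 0" by simp
      ultimately show "F f \<in> icone T E"
        unfolding in_cone_indep[OF finT] using f(1) by (auto simp: F_def intro: sum_nonneg)
    qed
    show "id \<in> icone T E \<rightarrow> icone V E"
    proof
      fix x assume "x \<in> icone T E"
      then show "id x \<in> icone V E"
        using T unfolding in_cone_indep[OF fin] in_cone_indep[OF finT] id_apply by blast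
    qed
    show "supp (F (id x)) \<subseteq> supp x" if "x \<in> icone T E" for x
    proof
      fix u assume "u \<in> supp (F (id x))"
      then obtain v where "v \<in> V" "h v = u" "x v \<noteq> 0" using F0[of x u] by (auto simp: supp_def)
      moreover have "v \<in> T" using that \<open>x v \<noteq> 0\<close> unfolding in_cone_indep[OF finT] by blast
      ultimately show "u \<in> supp x" using h(2) by (auto simp: supp_def)
    qed
  qed auto
qed

text \<open>
  The four weights on a path \<open>x - p - q - w\<close> correspond to the weight \<open>min x w\<close> of the contracted vertex
  and to the suspension coordinate \<open>p - q + w - x\<close>, whose positive and negative parts become the weights
  of \<open>p\<close> and \<open>q\<close>.
\<close>

lemma conn_split:
  fixes p q w rt :: "'a \<Rightarrow> 'a"
  assumes fin: "finite V" and R: "R \<subseteq> V" "p ` R \<subseteq> V" "q ` R \<subseteq> V" "w ` R \<subseteq> V"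
    and rt: "\<And>x. x \<in> R \<Longrightarrow> rt (p x) = x \<and> rt (q x) = x \<and> rt (w x) = x"
    and disj: "R \<inter> p ` R = {}" "R \<inter> q ` R = {}" "R \<inter> w ` R = {}" "p ` R \<inter> q ` R = {}" "p ` R \<inter> w ` R = {}" "q ` R \<inter> w ` R = {}"
    and path: "\<And>x. x \<in> R \<Longrightarrow> E x (p x) \<and> E (p x) (q x) \<and> E (q x) (w x)"
    and pq: "\<And>x. x \<in> R \<Longrightarrow> E' (p x) (q x)"
    and expand: "\<And>a a'. a \<in> V \<Longrightarrow> a' \<in> V \<Longrightarrow> E a a' \<Longrightarrow>
      (\<exists>x\<in>R. {a, a'} \<in> {{x, p x}, {p x, q x}, {q x, w x}}) \<or>
      a \<notin> p ` R \<union> q ` R \<and> a' \<notin> p ` R \<union> q ` R \<and> E' (if a \<in> w ` R then rt a else a) (if a' \<in> w ` R then rt a' else a')"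
    and contract: "\<And>u u'. u \<in> V - w ` R \<Longrightarrow> u' \<in> V - w ` R \<Longrightarrow> E' u u' \<Longrightarrow>
      (\<exists>x\<in>R. {u, u'} = {p x, q x}) \<or>
      u \<notin> p ` R \<union> q ` R \<and> u' \<notin> p ` R \<union> q ` R \<and>
      (\<exists>a a'. (a = u \<or> u \<in> R \<and> a = w u) \<and> (a' = u' \<or> u' \<in> R \<and> a' = w u') \<and> E a a')"
    and "conn E k V"
  shows "conn E' k (V - w ` R)"
proof -
  let ?V = "V - w ` R"
  have fin': "finite ?V" using fin by simp
  define T where "T f x = f (p x) - f (q x) + f (w x) - (f x :: real)" for f x
  define F where "F f u = (if u \<in> R then min (f u) (f (w u)) else if u \<in> p ` R then max 0 (T f (rt u))
      else if u \<in> q ` R then max 0 (- T f (rt u)) else if u \<in> w ` R then 0 else f u)" for f u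
  \<comment> \<open>With \<open>s = g (p x) - g (q x)\<close>, the weight \<open>g x\<close> is
    copied to both ends of the path and \<open>|s|\<close> is taken off one of them; any excess of
    \<open>|s|\<close> over \<open>g x\<close> goes to \<open>p x\<close> or \<open>q x\<close>,
    according to the sign of \<open>s\<close>.\<close>
  define G where "G g u = (if u \<in> R then max 0 (g u - max 0 (g (p u) - g (q u)))
      else if u \<in> p ` R then max 0 (g (p (rt u)) - g (q (rt u)) - g (rt u))
      else if u \<in> q ` R then max 0 (g (q (rt u)) - g (p (rt u)) - g (rt u))
      else if u \<in> w ` R then max 0 (g (rt u) - max 0 (g (q (rt u)) - g (p (rt u)))) else (g u :: real))" for g u
  have im: "p x \<in> p ` R" "q x \<in> q ` R" "w x \<in> w ` R" if "x \<in> R" for x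
    using that by (rule imageI)+
  have nm: "p x \<in> p ` R" "q x \<in> q ` R" "w x \<in> w ` R" "p x \<notin> R" "q x \<notin> R" "w x \<notin> R"
    "q x \<notin> p ` R" "w x \<notin> p ` R" "w x \<notin> q ` R" if "x \<in> R" for x
    using im[OF that] disj[unfolded disjoint_iff] that by metis+
  have Fx: "F f x = min (f x) (f (w x))" "F f (p x) = max 0 (T f x)" "F f (q x) = max 0 (- T f x)" "F f (w x) = 0"
    if "x \<in> R" for f x
    using that rt[OF that] nm[OF that] by (simp_all add: F_def)
  have Gx: "G g x = max 0 (g x - max 0 (g (p x) - g (q x)))" "G g (p x) = max 0 (g (p x) - g (q x) - g x)"
    "G g (q x) = max 0 (g (q x) - g (p x) - g x)" "G g (w x) = max 0 (g x - max 0 (g (q x) - g (p x)))"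
    if "x \<in> R" for g x
    using that rt[OF that] nm[OF that] by (simp_all add: G_def)
  have other: "F f u = f u" "G f u = f u" if "u \<notin> R" "u \<notin> p ` R" "u \<notin> q ` R" "u \<notin> w ` R" for f u
    using that by (simp_all add: F_def G_def)
  show ?thesis
  proof (rule conn_dominated[OF fin fin' _ _ _ _ _ assms(17)])
    show "continuous_on (icone V E) F"
    proof (rule continuous_on_coordinatewise_then_product)
      fix u show "continuous_on (icone V E) (\<lambda>f. F f u)"
        unfolding F_def T_def
        by (cases "u \<in> R"; cases "u \<in> p ` R"; cases "u \<in> q ` R"; cases "u \<in> w ` R")
          (simp only: if_True if_False; intro continuous_intros continuous_on_coordinate)+
    qed
    show "continuous_on (icone ?V E') G"
    proof (rule continuous_on_coordinatewise_then_product)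
      fix u show "continuous_on (icone ?V E') (\<lambda>f. G f u)"
        unfolding G_def
        by (cases "u \<in> R"; cases "u \<in> p ` R"; cases "u \<in> q ` R"; cases "u \<in> w ` R")
          (simp only: if_True if_False; intro continuous_intros continuous_on_coordinate)+
    qed
    show "F \<in> icone V E \<rightarrow> icone ?V E'"
    proof
      fix f assume "f \<in> icone V E"
      then have f: "\<And>u. 0 \<le> f u" "\<And>u. f u \<noteq> 0 \<Longrightarrow> u \<in> V" "\<And>u v. f u \<noteq> 0 \<Longrightarrow> f v \<noteq> 0 \<Longrightarrow> \<not> E u v" "\<exists>u. f u \<noteq> 0"
        by (auto simp: in_cone_indep[OF fin])
      have FV: "u \<in> ?V" if "F f u \<noteq> 0" for u
        using that R disj f(2)[of u] by (auto simp: F_def split: if_splits)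
      have copies: "f u \<noteq> 0 \<and> (u \<in> R \<longrightarrow> f (w u) \<noteq> 0)" if "F f u \<noteq> 0" "u \<notin> p ` R \<union> q ` R" for u
        using that f(1)[of u] f(1)[of "w u"] by (auto simp: F_def min_def split: if_splits)
      have "\<not> E' u u'" if u: "F f u \<noteq> 0" "F f u' \<noteq> 0" for u u'
      proof
        assume "E' u u'"
        from contract[OF FV[OF u(1)] FV[OF u(2)] this] show False
        proof
          assume "\<exists>x\<in>R. {u, u'} = {p x, q x}"
          then obtain x where "x \<in> R" "{u, u'} = {p x, q x}" by blast
          then have "F f (p x) \<noteq> 0 \<and> F f (q x) \<noteq> 0" using u by (auto simp: doubleton_eq_iff)
          then show False using Fx[OF \<open>x \<in> R\<close>, of f] by (simp add: max_def split: if_splits)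
        next
          assume *: "u \<notin> p ` R \<union> q ` R \<and> u' \<notin> p ` R \<union> q ` R \<and>
            (\<exists>a a'. (a = u \<or> u \<in> R \<and> a = w u) \<and> (a' = u' \<or> u' \<in> R \<and> a' = w u') \<and> E a a')"
          then obtain a a' where "E a a'" "a = u \<or> u \<in> R \<and> a = w u" "a' = u' \<or> u' \<in> R \<and> a' = w u'"
            by blast
          with * show False using copies[OF u(1)] copies[OF u(2)] f(3) by metis
        qed
      qed
      moreover have "\<exists>u. F f u \<noteq> 0"
      proof (rule ccontr)
        assume "\<not> ?thesis"
        then have F0: "F f u = 0" for u by simp
        \<comment> \<open>Vanishing of \<open>T\<close> gives
          \<open>f (p x) + f (w x) = f (q x) + f x\<close>. One end weight is 0, and adjacent
          weights are never both positive, so all four vanish.\<close>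
        have zero: "f x = 0 \<and> f (p x) = 0 \<and> f (q x) = 0 \<and> f (w x) = 0" if x: "x \<in> R" for x
        proof -
          have 1: "min (f x) (f (w x)) = 0" "max 0 (T f x) = 0" "max 0 (- T f x) = 0"
            using Fx[OF x, of f] F0 by metis+
          then have 2: "f (p x) + f (w x) = f (q x) + f x" by (simp add: T_def max_def split: if_splits)
          have "f x = 0 \<or> f (p x) = 0" "f (p x) = 0 \<or> f (q x) = 0" "f (q x) = 0 \<or> f (w x) = 0"
            using f(3) path[OF x] by blast+
          then show ?thesis using 1(1) 2 f(1)[of x] f(1)[of "p x"] f(1)[of "q x"] f(1)[of "w x"]
            by (auto simp: min_def split: if_splits)
        qed
        have "f u = 0" for u
        proof (cases "u \<in> R \<or> u \<in> p ` R \<or> u \<in> q ` R \<or> u \<in> w ` R")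
          case True then show ?thesis using zero by auto
        next
          case False then show ?thesis using other(1)[of u f] F0[of u] by simp
        qed
        then show False using f(4) by blast
      qed
      moreover have "F f u \<ge> 0" for u using f(1) by (auto simp: F_def)
      ultimately show "F f \<in> icone ?V E'"
        unfolding in_cone_indep[OF fin'] using FV by blast
    qed
    fix g assume "g \<in> icone ?V E'"
    then have g: "\<And>u. 0 \<le> g u" "\<And>u. g u \<noteq> 0 \<Longrightarrow> u \<in> ?V" "\<And>u v. g u \<noteq> 0 \<Longrightarrow> g v \<noteq> 0 \<Longrightarrow> \<not> E' u v" "\<exists>u. g u \<noteq> 0"
      by (auto simp: in_cone_indep[OF fin'])
    show "supp (F (G g)) \<subseteq> supp g"
    proof
      fix u assume u: "u \<in> supp (F (G g))"
      \<comment> \<open>The suspension coordinate is recovered exactly. The weight of the contracted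
        vertex only shrinks, to the positive part of \<open>g x - |g (p x) - g (q x)|\<close>, so
        supports do not grow.\<close>
      have TG: "T (G g) x = g (p x) - g (q x)" if "x \<in> R" for x
        using g(1)[of x] unfolding T_def Gx[OF that] by (auto simp: max_def)
      consider "u \<in> R" | x where "x \<in> R" "u = p x" | x where "x \<in> R" "u = q x" | x where "x \<in> R" "u = w x"
        | "u \<notin> R" "u \<notin> p ` R" "u \<notin> q ` R" "u \<notin> w ` R" by blast
      then show "u \<in> supp g"
      proof cases
        case 1 then show ?thesis using u g(1)[of u] by (auto simp: Fx Gx supp_def min_def max_def split: if_splits)
      next
        case (2 x) then show ?thesis using u g(1)[of "q x"] TG by (auto simp: Fx supp_def max_def split: if_splits)
      next
        case (3 x) then show ?thesis using u g(1)[of "p x"] TG by (auto simp: Fx supp_def max_def split: if_splits)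
      next
        case (4 x) then show ?thesis using u by (auto simp: Fx supp_def)
      next
        case 5 then show ?thesis using u by (simp add: other supp_def)
      qed
    qed
  next
    show "G \<in> icone ?V E' \<rightarrow> icone V E"
    proof
      fix g assume "g \<in> icone ?V E'"
      then have g: "\<And>u. 0 \<le> g u" "\<And>u. g u \<noteq> 0 \<Longrightarrow> u \<in> ?V" "\<And>u v. g u \<noteq> 0 \<Longrightarrow> g v \<noteq> 0 \<Longrightarrow> \<not> E' u v" "\<exists>u. g u \<noteq> 0"
        by (auto simp: in_cone_indep[OF fin'])
      have GV: "u \<in> V" if "G g u \<noteq> 0" for u
        using that R g(2)[of u] by (auto simp: G_def split: if_splits)
      have root: "g (if a \<in> w ` R then rt a else a) \<noteq> 0" if "G g a \<noteq> 0" "a \<notin> p ` R \<union> q ` R" for a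
      proof (cases "a \<in> w ` R")
        case True
        then obtain x where "x \<in> R" "a = w x" by blast
        then show ?thesis using that(1) True rt[of x] by (auto simp: Gx max_def split: if_splits)
      next
        case False
        then show ?thesis using that g(1)[of a] by (auto simp: G_def max_def split: if_splits)
      qed
      have "\<not> E a a'" if a: "G g a \<noteq> 0" "G g a' \<noteq> 0" for a a'
      proof
        assume "E a a'"
        from expand[OF GV[OF a(1)] GV[OF a(2)] this] show False
        proof
          assume "\<exists>x\<in>R. {a, a'} \<in> {{x, p x}, {p x, q x}, {q x, w x}}"
          then obtain x where "x \<in> R" "{a, a'} \<in> {{x, p x}, {p x, q x}, {q x, w x}}" by blast
          then show False using a g(1)[of x] Gx[OF \<open>x \<in> R\<close>, of g]
            by (auto simp: doubleton_eq_iff max_def split: if_splits)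
        next
          assume "a \<notin> p ` R \<union> q ` R \<and> a' \<notin> p ` R \<union> q ` R \<and>
            E' (if a \<in> w ` R then rt a else a) (if a' \<in> w ` R then rt a' else a')"
          then show False using root[OF a(1)] root[OF a(2)] g(3) by metis
        qed
      qed
      moreover have "\<exists>u. G g u \<noteq> 0"
      proof (rule ccontr)
        assume "\<not> ?thesis"
        then have G0: "G g u = 0" for u by simp
        have zero: "g x = 0 \<and> g (p x) = 0 \<and> g (q x) = 0" if x: "x \<in> R" for x
        proof -
          have "g (p x) = 0 \<or> g (q x) = 0" using g(3) pq[OF x] by blast
          then show ?thesis
            using G0[of x] G0[of "p x"] G0[of "q x"] G0[of "w x"] g(1)[of x] g(1)[of "p x"] g(1)[of "q x"]
            by (auto simp: Gx[OF x] max_def split: if_splits)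
        qed
        have "g u = 0" for u
        proof (cases "u \<in> R \<or> u \<in> p ` R \<or> u \<in> q ` R \<or> u \<in> w ` R")
          case True then show ?thesis using zero g(2)[of u] by auto
        next
          case False then show ?thesis using other(2)[of u g] G0[of u] by simp
        qed
        then show False using g(4) by blast
      qed
      moreover have "G g u \<ge> 0" for u using g(1) by (auto simp: G_def)
      ultimately show "G g \<in> icone V E"
        unfolding in_cone_indep[OF fin] using GV by blast
    qed
  qed
qed

lemma not_k_connected_sphere: "\<not> k_connected (int d) (top_of_set (sphere_set d))"
proof
  assume k: "k_connected (int d) (top_of_set (sphere_set d))"
  have "\<exists>c. homotopic_in (sphere_set d) (sphere_set d) id (\<lambda>_. c)"
    using k unfolding k_connected_set by auto
  then have "contractible_space (nsphere d)"
    by (simp add: contractible_space_def nsphere_eq)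
  then show False using non_contractible_space_nsphere by blast
qed

text \<open>The complex is the boundary of a cross-polytope with one axis per edge. The coordinate
  on an axis is the difference of the two end weights; in the other direction a coordinate is split
  into its positive and negative part.\<close>

lemma matching_not_conn:
  assumes fin: "finite V" and V: "V = P \<union> \<pi> ` P" and disj: "P \<inter> \<pi> ` P = {}" and inj: "inj_on \<pi> P"
    and card: "card P = Suc d"
    and E: "\<And>u v. u \<in> V \<Longrightarrow> v \<in> V \<Longrightarrow> E u v \<longleftrightarrow> u \<in> P \<and> v = \<pi> u \<or> v \<in> P \<and> u = \<pi> v"
  shows "\<not> conn E (int d) V"
proof
  assume "conn E (int d) V"
  let ?K = "icone V E"
  have "finite P" using card by (metis card.infinite nat.distinct(1))
  then obtain e where e: "bij_betw e {..d} P" using card by (metis card_atMost finite_atMost finite_same_card_bij)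
  have eP: "e i \<in> P" if "i \<le> d" for i using that e by (auto simp: bij_betw_def)
  define e' where "e' = inv_into {..d} e"
  define \<pi>' where "\<pi>' = inv_into P \<pi>"
  have e'e: "e' (e i) = i" if "i \<le> d" for i using that e by (simp add: e'_def bij_betw_inv_into_left)
  have ee': "e (e' u) = u" "e' u \<le> d" if "u \<in> P" for u
    using that bij_betw_inv_into_right[OF e that] inv_into_into[of u e "{..d}"] e by (auto simp: e'_def bij_betw_def)
  have \<pi>'\<pi>: "\<pi>' (\<pi> u) = u" if "u \<in> P" for u using that inj by (simp add: \<pi>'_def)
  define D where "D f i = (if i \<le> d then f (e i) - f (\<pi> (e i)) else (0::real))" for f i
  define nr where "nr x = sqrt (\<Sum>i\<le>d. (x i)\<^sup>2)" for x :: "nat \<Rightarrow> real"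
  define F where "F f = (\<lambda>i. D f i / nr (D f))" for f
  define G where "G x u = (if u \<in> P then max 0 (x (e' u)) else if u \<in> \<pi> ` P then max 0 (- x (e' (\<pi>' u))) else 0)"
    for x :: "nat \<Rightarrow> real" and u
  have Dnz: "nr (D f) > 0" if "f \<in> ?K" for f
  proof -
    have f: "\<And>u. 0 \<le> f u" "\<And>u. f u \<noteq> 0 \<Longrightarrow> u \<in> V" "\<And>u v. f u \<noteq> 0 \<Longrightarrow> f v \<noteq> 0 \<Longrightarrow> \<not> E u v" "\<exists>u. f u \<noteq> 0"
      using that by (auto simp: in_cone_indep[OF fin])
    obtain u where u: "f u \<noteq> 0" using f(4) by blast
    then obtain v where v: "v \<in> P" "u = v \<or> u = \<pi> v" using f(2) V by blast
    have "E v (\<pi> v)" using E[of v "\<pi> v"] v(1) V by auto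
    then have "f v = 0 \<or> f (\<pi> v) = 0" using f(3) by blast
    \<comment> \<open>An independent set meets an edge in at most one end, so the difference cannot
      cancel; this keeps the norm nonzero.\<close>
    then have "f v - f (\<pi> v) \<noteq> 0" using u v by auto
    then have "D f (e' v) \<noteq> 0" using ee' v(1) by (simp add: D_def)
    then have "(\<Sum>i\<le>d. (D f i)\<^sup>2) > 0" using ee' v(1) by (intro sum_pos2[of _ "e' v"]) auto
    then show ?thesis by (simp add: nr_def)
  qed
  have cD: "continuous_on S (\<lambda>f. D f i)" for S i
    unfolding D_def by (cases "i \<le> d") (auto intro!: continuous_intros continuous_on_coordinate)
  have cF: "continuous_on ?K F"
    unfolding F_def nr_def
  proof (intro continuous_on_coordinatewise_then_product continuous_on_divide continuous_on_real_sqrt continuous_on_sum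
        continuous_on_power cD ballI)
    show "sqrt (\<Sum>i\<le>d. (D f i)\<^sup>2) \<noteq> 0" if "f \<in> ?K" for f using Dnz[OF that] by (simp add: nr_def)
  qed
  have FK: "F \<in> ?K \<rightarrow> sphere_set d"
  proof
    fix f assume "f \<in> ?K"
    then have "nr (D f) > 0" by (rule Dnz)
    then have "(\<Sum>i\<le>d. (F f i)\<^sup>2) = 1"
      by (simp add: F_def power_divide sum_divide_distrib[symmetric]) (simp add: nr_def sum_nonneg)
    then show "F f \<in> sphere_set d" by (simp add: sphere_set_def) (simp add: F_def D_def)
  qed
  have cG: "continuous_on S G" for S
  proof (rule continuous_on_coordinatewise_then_product)
    fix u show "continuous_on S (\<lambda>x. G x u)" unfolding G_def
      by (cases "u \<in> P"; cases "u \<in> \<pi> ` P") (auto intro!: continuous_intros continuous_on_coordinate)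
  qed
  have Ge: "G x (e i) = max 0 (x i)" "G x (\<pi> (e i)) = max 0 (- x i)" if "i \<le> d" for x i
    using eP[OF that] e'e[OF that] \<pi>'\<pi> disj by (auto simp: G_def)
  have GK: "G \<in> sphere_set d \<rightarrow> ?K"
  proof
    fix x assume x: "x \<in> sphere_set d"
    have "\<exists>u. G x u \<noteq> 0"
    proof -
      have "\<exists>i\<le>d. x i \<noteq> 0"
      proof (rule ccontr)
        assume "\<not> ?thesis"
        then have "(\<Sum>i\<le>d. (x i)\<^sup>2) = 0" by simp
        then show False using x by (simp add: sphere_set_def)
      qed
      then obtain i where i: "i \<le> d" "x i \<noteq> 0" by blast
      then have "G x (e i) \<noteq> 0 \<or> G x (\<pi> (e i)) \<noteq> 0" using Ge[OF i(1), of x] by auto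
      then show ?thesis by blast
    qed
    moreover have "\<not> E u v" if uv: "G x u \<noteq> 0" "G x v \<noteq> 0" for u v
    proof
      assume "E u v"
      have "u \<in> V" "v \<in> V" using uv V by (auto simp: G_def split: if_splits)
      then obtain z where z: "z \<in> P" "{u, v} = {z, \<pi> z}" using E \<open>E u v\<close> by blast
      then obtain i where "i \<le> d" "z = e i" using ee' by metis
      then have "G x z = 0 \<or> G x (\<pi> z) = 0" using Ge[of i x] by auto
      then show False using uv z by (auto simp: doubleton_eq_iff)
    qed
    moreover have "u \<in> V" if "G x u \<noteq> 0" for u using that V by (auto simp: G_def split: if_splits)
    moreover have "G x u \<ge> 0" for u by (auto simp: G_def)
    ultimately show "G x \<in> ?K" unfolding in_cone_indep[OF fin] by blast
  qed
  have "homotopic_in (sphere_set d) (sphere_set d) (F \<circ> G) id"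
  proof (rule homotopic_in_eq)
    show "continuous_on (sphere_set d) (F \<circ> G)" unfolding o_def by (rule continuous_on_compose2[OF cF cG]) (use GK in auto)
    show "F \<circ> G \<in> sphere_set d \<rightarrow> sphere_set d" using FK GK by auto
    fix x assume x: "x \<in> sphere_set d"
    have "D (G x) = x"
    proof
      fix i show "D (G x) i = x i"
        using x Ge[of i x] by (cases "i \<le> d") (auto simp: D_def sphere_set_def max_def)
    qed
    moreover have "nr x = 1" using x by (simp add: nr_def sphere_set_def)
    ultimately show "(F \<circ> G) x = id x" by (simp add: F_def)
  qed
  then have "dominates ?K (sphere_set d)" unfolding dominates_def using cF FK cG GK by blast
  moreover have "k_connected (int d) (top_of_set ?K)" using \<open>conn E (int d) V\<close> conn_cone_iff[OF fin] by simp
  ultimately show False using k_connected_dominates not_k_connected_sphere by blast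
qed

section \<open>Upper bound for the ladder of polygons\<close>

text \<open>
  At level \<open>k\<close> every path of a polygon has been contracted to the positions \<open>0, \<dots>, 3 * k\<close>; the remaining
  positions \<open>b\<close> with \<open>b mod 3 \<noteq> 0\<close> form the isolated edges produced by the contractions.
\<close>

datatype uvtx = UA nat | UX bool nat nat

text \<open>The position \<open>3 * k\<close> acts as the last one of its path and carries the edges
  leaving it. The condition \<open>b mod 3 = 1\<close> selects the split-off edges from
  \<open>3 * i + 1\<close> to \<open>3 * i + 2\<close>.\<close>

fun ladj :: "nat \<Rightarrow> uvtx \<Rightarrow> uvtx \<Rightarrow> bool" where
  "ladj k (UA i) (UA j) = False"
| "ladj k (UA i) (UX h a b) = (i = a \<and> b = 0 \<or> i = a + 1 \<and> b = 3 * k)"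
| "ladj k (UX h a b) (UA i) = (i = a \<and> b = 0 \<or> i = a + 1 \<and> b = 3 * k)"
| "ladj k (UX h a b) (UX h' a' b') = (h = h' \<and>
     (a = a' \<and> (b' = b + 1 \<and> (b < 3 * k \<or> b mod 3 = 1) \<or> b = b' + 1 \<and> (b' < 3 * k \<or> b' mod 3 = 1)) \<or>
      a' = a + 1 \<and> b = 3 * k \<and> b' = 0 \<or> a = a' + 1 \<and> b' = 3 * k \<and> b = 0))"

context ladder begin

fun in_level :: "nat \<Rightarrow> uvtx \<Rightarrow> bool" where
  "in_level k (UA i) = (i \<le> t)"
| "in_level k (UX h a b) = (a < t \<and> b \<le> 3 * m \<and> (b \<le> 3 * k \<or> b mod 3 \<noteq> 0))"

definition "level k = {u. in_level k u}"

lemma finite_level: "finite (level k)"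
proof (rule finite_subset)
  show "level k \<subseteq> UA ` {..t} \<union> (\<lambda>(h, a, b). UX h a b) ` (UNIV \<times> {..<t} \<times> {..3 * m})"
  proof
    fix u assume "u \<in> level k"
    then show "u \<in> UA ` {..t} \<union> (\<lambda>(h, a, b). UX h a b) ` (UNIV \<times> {..<t} \<times> {..3 * m})"
      by (cases u) (auto simp: level_def image_iff)
  qed
qed auto

fun to_uvtx :: "vtx \<Rightarrow> uvtx" where
  "to_uvtx (A i) = UA i"
| "to_uvtx (B i j) = UX True (i - 1) (j - 1)"
| "to_uvtx (C i j) = UX False (i - 1) (j - 1)"

fun of_uvtx :: "uvtx \<Rightarrow> vtx" where
  "of_uvtx (UA i) = A i"
| "of_uvtx (UX h a b) = path_vtx h a b"

lemma to_uvtx_bij: "bij_betw to_uvtx (Gverts n t) (level m)"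
proof (rule bij_betw_byWitness[of _ of_uvtx])
  show "\<forall>u\<in>Gverts n t. of_uvtx (to_uvtx u) = u" by (auto simp: Gverts_def path_vtx_def)
  show "\<forall>u\<in>level m. to_uvtx (of_uvtx u) = u"
  proof
    fix u assume "u \<in> level m" show "to_uvtx (of_uvtx u) = u" by (cases u) (auto simp: path_vtx_def)
  qed
  show "to_uvtx ` Gverts n t \<subseteq> level m" by (auto simp: Gverts_def level_def n_L L_def)
  show "of_uvtx ` level m \<subseteq> Gverts n t"
  proof
    fix v assume "v \<in> of_uvtx ` level m"
    then obtain u where "in_level m u" "v = of_uvtx u" by (auto simp: level_def)
    then show "v \<in> Gverts n t" by (cases u) (auto simp: Gverts_def path_vtx_def n_L L_def)
  qed
qed

lemma of_uvtx_adj: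
  assumes "u \<in> level m" "v \<in> level m"
  shows "Gedge n t (of_uvtx u) (of_uvtx v) \<longleftrightarrow> ladj m u v"
proof (cases u; cases v)
  fix i j assume "u = UA i" "v = UA j"
  then show ?thesis by (simp add: Gedge_AA)
next
  fix i h a b assume "u = UA i" "v = UX h a b"
  then show ?thesis using assms Gedge_AB[of a b i h] by (simp add: level_def L_def)
next
  fix i h a b assume "u = UX h a b" "v = UA i"
  then show ?thesis using assms Gedge_AB[of a b i h] Gedge_sym[of "path_vtx h a b" "A i"] by (simp add: level_def L_def)
next
  fix h a b h' a' b' assume uv: "u = UX h a b" "v = UX h' a' b'"
  then have "a < t" "b < L" "a' < t" "b' < L" using assms by (auto simp: level_def L_def)
  note * = Gedge_BB[OF this, of h h']
  have "b' = b + 1 \<Longrightarrow> b < 3 * m" "b = b' + 1 \<Longrightarrow> b' < 3 * m" "b + 1 = L \<longleftrightarrow> b = 3 * m" "b' + 1 = L \<longleftrightarrow> b' = 3 * m"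
    using \<open>b < L\<close> \<open>b' < L\<close> by (auto simp: L_def)
  then show ?thesis unfolding uv of_uvtx.simps * ladj.simps by blast
qed

lemma level_top:
  assumes "conn (Gedge n t) j (Gverts n t)"
  shows "conn (ladj m) j (level m)"
proof (rule conn_iso[OF finite_level to_uvtx_bij _ assms])
  fix u v assume uv: "u \<in> Gverts n t" "v \<in> Gverts n t"
  have "of_uvtx (to_uvtx x) = x" if "x \<in> Gverts n t" for x using that by (auto simp: Gverts_def path_vtx_def)
  moreover have "to_uvtx u \<in> level m" "to_uvtx v \<in> level m" using uv to_uvtx_bij by (auto simp: bij_betw_def)
  ultimately show "ladj m (to_uvtx u) (to_uvtx v) \<longleftrightarrow> Gedge n t u v" using of_uvtx_adj uv by metis
qed

text \<open>In every polygon path the piece from \<open>3 * k\<close> to \<open>3 * k + 3\<close> is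
  contracted at the same time. Its end hands the edges to the following polygon vertex and path over
  to \<open>3 * k\<close>.\<close>

lemma level_step:
  assumes "k < m" "conn (ladj (Suc k)) j (level (Suc k))"
  shows "conn (ladj k) j (level k)"
proof -
  define R where "R = {UX h a (3 * k) | h a. a < t}"
  define sh where "sh d u = (case u of UA i \<Rightarrow> UA i | UX h a b \<Rightarrow> UX h a (b + d))" for d u
  define rt where "rt u = (case u of UA i \<Rightarrow> UA i | UX h a b \<Rightarrow> UX h a (3 * k))" for u
  let ?p = "sh 1" and ?q = "sh 2" and ?w = "sh 3"
  have mem: "UX h a b \<in> R \<longleftrightarrow> a < t \<and> b = 3 * k" "UA i \<notin> R" for h a b i by (auto simp: R_def)
  have shR: "UX h a b \<in> sh d ` R \<longleftrightarrow> a < t \<and> b = 3 * k + d" "UA i \<notin> sh d ` R" for d h a b i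
    by (auto simp: R_def sh_def intro!: image_eqI[of _ _ "UX h a (3 * k)"])
  have shX: "sh d (UX h a b) = UX h a (b + d)" for d h a b by (simp add: sh_def)
  have level_eq: "level (Suc k) - ?w ` R = level k"
  proof (rule Set.set_eqI)
    fix u show "u \<in> level (Suc k) - ?w ` R \<longleftrightarrow> u \<in> level k"
    proof (cases u)
      case (UX h a b)
      have "(b \<le> 3 * Suc k \<or> b mod 3 \<noteq> 0) \<and> b \<noteq> 3 * k + 3 \<longleftrightarrow> b \<le> 3 * k \<or> b mod 3 \<noteq> 0" by presburger
      then show ?thesis using UX by (auto simp: level_def shR)
    qed (auto simp: level_def shR)
  qed
  \<comment> \<open>\<open>XP\<close> and, further down, \<open>CO\<close> are the edge conditions
    \<open>expand\<close> and \<open>contract\<close> of \<open>conn_split\<close>, named so that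
    each kind of edge is handled in both directions at once.\<close>
  define XP where "XP a a' \<longleftrightarrow> (\<exists>x\<in>R. {a, a'} \<in> {{x, ?p x}, {?p x, ?q x}, {?q x, ?w x}}) \<or>
      a \<notin> ?p ` R \<union> ?q ` R \<and> a' \<notin> ?p ` R \<union> ?q ` R \<and> ladj k (if a \<in> ?w ` R then rt a else a) (if a' \<in> ?w ` R then rt a' else a')"
    for a a'
  have XP: "XP a a'" if aU: "a \<in> level (Suc k)" "a' \<in> level (Suc k)" "ladj (Suc k) a a'" for a a'
  proof -
    have step: "XP (UX h c b) (UX h c (b + 1)) \<and> XP (UX h c (b + 1)) (UX h c b)"
      if cb: "c < t" "b < 3 * Suc k \<or> b mod 3 = 1" for h c b
    proof -
      let ?x = "UX h c (3 * k)"
      have x: "?x \<in> R" using cb by (simp add: mem)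
      have sx: "?p ?x = UX h c (3 * k + 1)" "?q ?x = UX h c (3 * k + 2)" "?w ?x = UX h c (3 * k + 3)"
        by (simp_all add: sh_def)
      have "b = 3 * k \<or> b = 3 * k + 1 \<or> b = 3 * k + 2 \<or> (b < 3 * k \<or> b > 3 * k + 3) \<and> (b < 3 * k \<or> b mod 3 = 1)"
        using cb(2) by presburger
      then consider (1) "b = 3 * k" | (2) "b = 3 * k + 1" | (3) "b = 3 * k + 2"
        | (4) "b < 3 * k \<or> b > 3 * k + 3" "b < 3 * k \<or> b mod 3 = 1" by blast
      then show ?thesis
      proof cases
        case 1
        then have "{UX h c b, UX h c (b + 1)} = {?x, ?p ?x}" unfolding sx by simp
        then show ?thesis unfolding XP_def insert_commute[of "UX h c (b + 1)" "UX h c b"] using x by blast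
      next
        case 2
        then have "{UX h c b, UX h c (b + 1)} = {?p ?x, ?q ?x}" unfolding sx by simp
        then show ?thesis unfolding XP_def insert_commute[of "UX h c (b + 1)" "UX h c b"] using x by blast
      next
        case 3
        then have b: "b + 1 = 3 * k + 3" by simp
        have "{UX h c b, UX h c (b + 1)} = {?q ?x, ?w ?x}" unfolding sx b using 3 by simp
        then show ?thesis unfolding XP_def insert_commute[of "UX h c (b + 1)" "UX h c b"] using x by blast
      next
        case 4
        then have "ladj k (UX h c b) (UX h c (b + 1)) \<and> ladj k (UX h c (b + 1)) (UX h c b)" by simp
        moreover have "UX h c b \<notin> sh d ` R \<and> UX h c (b + 1) \<notin> sh d ` R" if "d \<in> {1, 2, 3}" for d
          using 4(1) that by (auto simp: shR)
        ultimately show ?thesis unfolding XP_def by simp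
      qed
    qed
    have inter: "XP (UX h c (3 * k + 3)) (UX h (c + 1) 0) \<and> XP (UX h (c + 1) 0) (UX h c (3 * k + 3))" if "c < t" for h c
      using that unfolding XP_def by (intro conjI disjI2) (auto simp: shR rt_def)
    have left: "XP (UA c) (UX h c 0) \<and> XP (UX h c 0) (UA c)" for h c
      unfolding XP_def by (intro conjI disjI2) (auto simp: shR rt_def)
    have right: "XP (UA (c + 1)) (UX h c (3 * k + 3)) \<and> XP (UX h c (3 * k + 3)) (UA (c + 1))" if "c < t" for h c
      using that unfolding XP_def by (intro conjI disjI2) (auto simp: shR rt_def)
    show ?thesis
    proof (cases a; cases a')
      fix h c b h' c' b' assume e: "a = UX h c b" "a' = UX h' c' b'"
      then have lt: "c < t" "c' < t" using aU by (auto simp: level_def)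
      have "h = h'" using aU e by simp
      moreover have "c = c' \<and> b' = b + 1 \<and> (b < 3 * Suc k \<or> b mod 3 = 1) \<or> c = c' \<and> b = b' + 1 \<and> (b' < 3 * Suc k \<or> b' mod 3 = 1)
        \<or> c' = c + 1 \<and> b = 3 * k + 3 \<and> b' = 0 \<or> c = c' + 1 \<and> b' = 3 * k + 3 \<and> b = 0"
        using aU(3) e by auto
      ultimately show ?thesis
        unfolding e using step[of c b h] step[of c b' h] inter[of c h] inter[of c' h] lt by (elim disjE conjE) simp_all
    next
      fix i h c b assume e: "a = UA i" "a' = UX h c b"
      then have "c < t" using aU by (auto simp: level_def)
      moreover have "i = c \<and> b = 0 \<or> i = c + 1 \<and> b = 3 * k + 3" using aU(3) e by auto
      ultimately show ?thesis unfolding e using left[of c h] right[of c h] by (elim disjE conjE) simp_all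
    next
      fix i h c b assume e: "a' = UA i" "a = UX h c b"
      then have "c < t" using aU by (auto simp: level_def)
      moreover have "i = c \<and> b = 0 \<or> i = c + 1 \<and> b = 3 * k + 3" using aU(3) e by auto
      ultimately show ?thesis unfolding e using left[of c h] right[of c h] by (elim disjE conjE) simp_all
    qed (use aU in auto)
  qed
  define CO where "CO u u' \<longleftrightarrow> (\<exists>x\<in>R. {u, u'} = {?p x, ?q x}) \<or>
      u \<notin> ?p ` R \<union> ?q ` R \<and> u' \<notin> ?p ` R \<union> ?q ` R \<and>
      (\<exists>a a'. (a = u \<or> u \<in> R \<and> a = ?w u) \<and> (a' = u' \<or> u' \<in> R \<and> a' = ?w u') \<and> ladj (Suc k) a a')" for u u'
  have COI: "CO u u'" if "u \<notin> ?p ` R \<union> ?q ` R" "u' \<notin> ?p ` R \<union> ?q ` R"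
      "a = u \<or> u \<in> R \<and> a = ?w u" "a' = u' \<or> u' \<in> R \<and> a' = ?w u'" "ladj (Suc k) a a'" for u u' a a'
    using that unfolding CO_def by blast
  have CO: "CO u u'" if uU: "u \<in> level (Suc k) - ?w ` R" "u' \<in> level (Suc k) - ?w ` R" "ladj k u u'" for u u'
  proof -
    have step: "CO (UX h c b) (UX h c (b + 1)) \<and> CO (UX h c (b + 1)) (UX h c b)"
      if cb: "c < t" "b < 3 * k \<or> b mod 3 = 1" for h c b
    proof -
      let ?x = "UX h c (3 * k)"
      have x: "?x \<in> R" using cb by (simp add: mem)
      have sx: "?p ?x = UX h c (3 * k + 1)" "?q ?x = UX h c (3 * k + 2)"
        by (simp_all add: sh_def)
      have "b = 3 * k + 1 \<or> b < 3 * k \<or> b > 3 * k + 3" using cb(2) by presburger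
      then consider (1) "b = 3 * k + 1" | (2) "b < 3 * k \<or> b > 3 * k + 3" by blast
      then show ?thesis
      proof cases
        case 1
        then have "{UX h c b, UX h c (b + 1)} = {?p ?x, ?q ?x}" unfolding sx by simp
        then show ?thesis unfolding CO_def insert_commute[of "UX h c (b + 1)" "UX h c b"] using x by blast
      next
        case 2
        have "ladj (Suc k) (UX h c b) (UX h c (b + 1)) \<and> ladj (Suc k) (UX h c (b + 1)) (UX h c b)" using cb(2) by auto
        moreover have "UX h c b \<notin> sh d ` R \<and> UX h c (b + 1) \<notin> sh d ` R" if "d \<in> {1, 2}" for d
          using 2 that by (auto simp: shR)
        then have "UX h c b \<notin> ?p ` R \<union> ?q ` R" "UX h c (b + 1) \<notin> ?p ` R \<union> ?q ` R" by blast+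
        ultimately show ?thesis by (blast intro: COI)
      qed
    qed
    have inter: "CO (UX h c (3 * k)) (UX h (c + 1) 0) \<and> CO (UX h (c + 1) 0) (UX h c (3 * k))" if "c < t" for h c
    proof
      show "CO (UX h c (3 * k)) (UX h (c + 1) 0)"
        by (rule COI[where a = "UX h c (3 * k + 3)" and a' = "UX h (c + 1) 0"]) (use that in \<open>auto simp: shR mem shX\<close>)
      show "CO (UX h (c + 1) 0) (UX h c (3 * k))"
        by (rule COI[where a' = "UX h c (3 * k + 3)" and a = "UX h (c + 1) 0"]) (use that in \<open>auto simp: shR mem shX\<close>)
    qed
    have left: "CO (UA c) (UX h c 0) \<and> CO (UX h c 0) (UA c)" for h c
      by (intro conjI COI[OF _ _ disjI1[OF refl] disjI1[OF refl]]) (auto simp: shR)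
    have right: "CO (UA (c + 1)) (UX h c (3 * k)) \<and> CO (UX h c (3 * k)) (UA (c + 1))" if "c < t" for h c
    proof
      show "CO (UA (c + 1)) (UX h c (3 * k))"
        by (rule COI[where a' = "UX h c (3 * k + 3)" and a = "UA (c + 1)"]) (use that in \<open>auto simp: shR mem shX\<close>)
      show "CO (UX h c (3 * k)) (UA (c + 1))"
        by (rule COI[where a = "UX h c (3 * k + 3)" and a' = "UA (c + 1)"]) (use that in \<open>auto simp: shR mem shX\<close>)
    qed
    show ?thesis
    proof (cases u; cases u')
      fix h c b h' c' b' assume e: "u = UX h c b" "u' = UX h' c' b'"
      then have lt: "c < t" "c' < t" using uU by (auto simp: level_def)
      have "h = h'" using uU e by simp
      moreover have "c = c' \<and> b' = b + 1 \<and> (b < 3 * k \<or> b mod 3 = 1) \<or> c = c' \<and> b = b' + 1 \<and> (b' < 3 * k \<or> b' mod 3 = 1)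
        \<or> c' = c + 1 \<and> b = 3 * k \<and> b' = 0 \<or> c = c' + 1 \<and> b' = 3 * k \<and> b = 0"
        using uU(3) e by auto
      ultimately show ?thesis
        unfolding e using step[of c b h] step[of c b' h] inter[of c h] inter[of c' h] lt by (elim disjE conjE) simp_all
    next
      fix i h c b assume e: "u = UA i" "u' = UX h c b"
      then have "c < t" using uU by (auto simp: level_def)
      moreover have "i = c \<and> b = 0 \<or> i = c + 1 \<and> b = 3 * k" using uU(3) e by auto
      ultimately show ?thesis unfolding e using left[of c h] right[of c h] by (elim disjE conjE) simp_all
    next
      fix i h c b assume e: "u' = UA i" "u = UX h c b"
      then have "c < t" using uU by (auto simp: level_def)
      moreover have "i = c \<and> b = 0 \<or> i = c + 1 \<and> b = 3 * k" using uU(3) e by auto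
      ultimately show ?thesis unfolding e using left[of c h] right[of c h] by (elim disjE conjE) simp_all
    qed (use uU in auto)
  qed
  have "conn (ladj k) j (level (Suc k) - ?w ` R)"
  proof (rule conn_split[where p = ?p and q = ?q and rt = rt and E = "ladj (Suc k)", OF finite_level _ _ _ _ _ _ _ _ _ _ _ _ _
        XP[unfolded XP_def] CO[unfolded CO_def] assms(2)])
    show "R \<subseteq> level (Suc k)" "?p ` R \<subseteq> level (Suc k)" "?q ` R \<subseteq> level (Suc k)" "?w ` R \<subseteq> level (Suc k)"
      using assms(1) by (auto simp: R_def sh_def level_def)
    show "rt (?p x) = x \<and> rt (?q x) = x \<and> rt (?w x) = x" if "x \<in> R" for x
      using that by (auto simp: R_def sh_def rt_def)
    show "R \<inter> ?p ` R = {}" "R \<inter> ?q ` R = {}" "R \<inter> ?w ` R = {}" "?p ` R \<inter> ?q ` R = {}" "?p ` R \<inter> ?w ` R = {}" "?q ` R \<inter> ?w ` R = {}"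
      by (auto simp: R_def sh_def)
    show "ladj (Suc k) x (?p x) \<and> ladj (Suc k) (?p x) (?q x) \<and> ladj (Suc k) (?q x) (?w x)" if "x \<in> R" for x
      using that by (auto simp: R_def sh_def)
    show "ladj k (?p x) (?q x)" if "x \<in> R" for x
      using that by (auto simp: R_def sh_def mod_Suc)
  qed
  then show ?thesis unfolding level_eq .
qed

lemma level_bottom:
  assumes "conn (Gedge n t) j (Gverts n t)"
  shows "conn (ladj 0) j (level 0)"
proof -
  have "conn (ladj (m - d)) j (level (m - d))" if "d \<le> m" for d
    using that
  proof (induction d)
    case 0 then show ?case using level_top[OF assms] by simp
  next
    case (Suc d)
    then show ?case using level_step[of "m - Suc d" j] by (simp add: Suc_diff_Suc)
  qed
  from this[of m] show ?thesis by simp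
qed

end

section \<open>Folding the contracted ladder onto a matching\<close>

lemma mod3_cases:
  fixes i :: nat
  obtains k where "i = 3 * k" | k where "i = 3 * k + 1" | k where "i = 3 * k + 2"
proof -
  have "i mod 3 = 0 \<or> i mod 3 = 1 \<or> i mod 3 = 2" by linarith
  moreover have "i = 3 * (i div 3) + i mod 3" by simp
  ultimately show ?thesis using that by (metis add_0_right)
qed

lemma mod3_cases2:
  fixes i j :: nat
  obtains k l where "i = 3 * k" "j = 3 * l" | k l where "i = 3 * k" "j = 3 * l + 1" | k l where "i = 3 * k" "j = 3 * l + 2"
    | k l where "i = 3 * k + 1" "j = 3 * l" | k l where "i = 3 * k + 1" "j = 3 * l + 1" | k l where "i = 3 * k + 1" "j = 3 * l + 2"
    | k l where "i = 3 * k + 2" "j = 3 * l" | k l where "i = 3 * k + 2" "j = 3 * l + 1" | k l where "i = 3 * k + 2" "j = 3 * l + 2"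
  by (cases i rule: mod3_cases; cases j rule: mod3_cases; blast)

text \<open>\<open>frow\<close> acts on polygon vertices, \<open>fcol\<close> on the columns between
  them. Left of \<open>c\<close>, in each block of three, polygon vertex \<open>3 * k + 1\<close>
  joins \<open>3 * k\<close> and column \<open>3 * k + 2\<close> joins \<open>3 * k + 1\<close>.
  From \<open>c\<close> on columns stay, and polygon vertices collapse to \<open>c\<close> and
  \<open>c + 3\<close>, opposite vertices of the 8-cycle.\<close>

definition frow :: "nat \<Rightarrow> nat \<Rightarrow> nat" where
  "frow c i = (if i < c then (if i mod 3 = 2 then i else 3 * (i div 3)) else if i \<le> c + 1 then c else c + 3)"
definition fcol :: "nat \<Rightarrow> nat \<Rightarrow> nat" where
  "fcol c a = (if c \<le> a \<or> a mod 3 = 0 then a else 3 * (a div 3) + 1)"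

lemma div_mod_3: "(3 * k + 1) mod 3 = (1::nat)" "(3 * k + 2) mod 3 = (2::nat)" "(3 * k + 1) div 3 = (k::nat)" "(3 * k + 2) div 3 = (k::nat)"
  by (simp_all only: mod_mult_self4 div_mult_self4 mod_less div_less numeral_eq_iff semiring_norm | presburger)+

lemma frow_eqs:
  "frow (3 * g) (3 * k) = (if k < g then 3 * k else if k = g then 3 * g else 3 * g + 3)"
  "frow (3 * g) (3 * k + 1) = (if k < g then 3 * k else if k = g then 3 * g else 3 * g + 3)"
  "frow (3 * g) (3 * k + 2) = (if k < g then 3 * k + 2 else 3 * g + 3)"
  unfolding frow_def div_mod_3 by auto

lemma fcol_eqs:
  "fcol (3 * g) (3 * k) = 3 * k"
  "fcol (3 * g) (3 * k + 1) = 3 * k + 1"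
  "fcol (3 * g) (3 * k + 2) = (if k < g then 3 * k + 1 else 3 * k + 2)"
  unfolding fcol_def div_mod_3 by auto

text \<open>Folding reflects edges: \<open>3 * k\<close> and \<open>3 * k + 1\<close> both touch
  column \<open>3 * k\<close>, and \<open>3 * k + 2\<close> touches both columns
  \<open>3 * k + 1\<close> and \<open>3 * k + 2\<close>.\<close>

lemma frow_col:
  assumes "i \<le> 3 * g + 3" "a \<le> 3 * g + 2" "frow (3 * g) i = fcol (3 * g) a \<or> frow (3 * g) i = fcol (3 * g) a + 1"
  shows "i = a \<or> i = a + 1"
  using assms by (cases i a rule: mod3_cases2) (simp only: frow_eqs fcol_eqs split: if_splits; presburger)+

text \<open>Left of \<open>3 * g\<close> folded columns can be consecutive only as
  \<open>3 * k\<close> and \<open>3 * k + 1\<close>. These are sent to different sides of the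
  ladder, so no edge arises.\<close>

lemma fcol_col:
  assumes "fcol (3 * g) a' = fcol (3 * g) a + 1" "\<not> (3 * g \<le> a \<and> 3 * g \<le> a')"
  shows "a < 3 * g \<and> a' < 3 * g \<and> a mod 3 = 0 \<and> a' mod 3 \<noteq> 0"
  using assms by (cases a a' rule: mod3_cases2) (simp only: fcol_eqs div_mod_3 mod_mult_self1_is_0 split: if_splits; presburger)+

lemma Suc_mod_3: "Suc (3 * k) mod 3 = 1" "Suc (Suc (3 * k)) mod 3 = 2"
  using div_mod_3[of k] by simp_all

lemma pred_mod_3: "i mod 3 = 2 \<Longrightarrow> (i - 1) mod 3 = 1 \<and> i \<noteq> 0" for i :: nat
  by (cases i) (auto simp: mod_Suc split: if_splits)

lemma Suc_mod_3_less:
  fixes b :: nat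
  assumes "b mod 3 = 1" "b < 3 * m"
  shows "(b + 1) mod 3 = 2 \<and> b + 1 < 3 * m"
proof -
  have "(b + 1) mod 3 = 2" using assms(1) by (simp add: mod_Suc)
  moreover from this have "b + 1 \<noteq> 3 * m" by auto
  ultimately show ?thesis using assms(2) by simp
qed

lemma frow_range: "frow (3 * g) i < 3 * g \<and> frow (3 * g) i mod 3 \<noteq> 1 \<or> frow (3 * g) i = 3 * g \<or> frow (3 * g) i = 3 * g + 3"
  by (cases i rule: mod3_cases; simp only: frow_eqs; auto simp: Suc_mod_3)

lemma frow_le: "frow (3 * g) i \<le> max i (3 * g + 3)" "i < 3 * g \<Longrightarrow> frow (3 * g) i \<le> i"
  by (cases i rule: mod3_cases; simp only: frow_eqs; auto)+

lemma frow_fixed: "frow (3 * g) i = i \<longleftrightarrow> i < 3 * g \<and> i mod 3 \<noteq> 1 \<or> i = 3 * g \<or> i = 3 * g + 3"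
  by (cases i rule: mod3_cases; simp only: frow_eqs; auto simp: Suc_mod_3; presburger)

lemma fcol_less: "a < 3 * g \<Longrightarrow> fcol (3 * g) a \<le> a \<and> fcol (3 * g) a mod 3 = (if a mod 3 = 0 then 0 else 1)"
  by (cases a rule: mod3_cases) (simp_all only: fcol_eqs div_mod_3 mod_mult_self1_is_0, auto)

lemma fcol_ge: "c \<le> a \<Longrightarrow> fcol c a = a"
  by (simp add: fcol_def)

context ladder begin

text \<open>Left of \<open>3 * g\<close> columns divisible by three go to the upper side and all
  others to the lower side, which keeps the resulting edges disjoint.\<close>

fun fold_cols :: "nat \<Rightarrow> uvtx \<Rightarrow> uvtx" where
  "fold_cols g (UA i) = UA (frow (3 * g) i)"
| "fold_cols g (UX h a b) = (if b \<noteq> 0 then UX h a b else UX (if 3 * g \<le> a then h else a mod 3 = 0) (fcol (3 * g) a) 0)"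

definition "core g = {u \<in> level 0. fold_cols g u = u}"

lemma core_iff:
  "UA i \<in> core g \<longleftrightarrow> i \<le> t \<and> (i < 3 * g \<and> i mod 3 \<noteq> 1 \<or> i = 3 * g \<or> i = 3 * g + 3)"
  "UX h a b \<in> core g \<longleftrightarrow> a < t \<and> b \<le> 3 * m \<and>
     (b mod 3 \<noteq> 0 \<or> b = 0 \<and> (3 * g \<le> a \<or> h \<and> a mod 3 = 0 \<or> \<not> h \<and> a mod 3 = 1))"
proof -
  show "UA i \<in> core g \<longleftrightarrow> i \<le> t \<and> (i < 3 * g \<and> i mod 3 \<noteq> 1 \<or> i = 3 * g \<or> i = 3 * g + 3)"
    using frow_fixed[of g i] by (simp add: core_def level_def)
  have "fcol (3 * g) a = a \<and> (h \<longleftrightarrow> a mod 3 = 0) \<longleftrightarrow> h \<and> a mod 3 = 0 \<or> \<not> h \<and> a mod 3 = 1" if "a < 3 * g"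
    using that by (cases a rule: mod3_cases) (simp_all only: fcol_eqs div_mod_3 mod_mult_self1_is_0, auto)
  then show "UX h a b \<in> core g \<longleftrightarrow> a < t \<and> b \<le> 3 * m \<and>
     (b mod 3 \<noteq> 0 \<or> b = 0 \<and> (3 * g \<le> a \<or> h \<and> a mod 3 = 0 \<or> \<not> h \<and> a mod 3 = 1))"
    using fcol_ge[of "3 * g" a] by (cases "b = 0"; cases "3 * g \<le> a") (auto simp: core_def level_def)
qed

text \<open>The condition on \<open>t\<close> keeps images inside the ladder: either all polygon
  vertices lie left of \<open>3 * g\<close> and only move left, or exactly three polygons follow and
  \<open>3 * g + 3 = t\<close>.\<close>

lemma core_conn:
  assumes t: "t < 3 * g \<or> t = 3 * g + 3" and "conn (ladj 0) j (level 0)"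
  shows "conn (ladj 0) j (core g)"
proof (rule conn_retract[where h = "fold_cols g", OF finite_level _ _ _ _ assms(2)])
  show "core g \<subseteq> level 0" by (auto simp: core_def)
  show "fold_cols g u = u" if "u \<in> core g" for u using that by (simp add: core_def)
  show "fold_cols g u \<in> core g" if "u \<in> level 0" for u
  proof (cases u)
    case (UA i)
    have "i \<le> t" using that UA by (simp add: level_def)
    then have "frow (3 * g) i \<le> t" using t frow_le[where g = g and i = i] by (auto simp: max_def split: if_splits)
    then show ?thesis unfolding UA fold_cols.simps core_iff using frow_range[of g i] by blast
  next
    case (UX h a b)
    then have ab: "a < t" "b \<le> 3 * m" "b = 0 \<or> b mod 3 \<noteq> 0" using that by (auto simp: level_def)
    show ?thesis
    proof (cases "b = 0")
      case False then show ?thesis using ab by (auto simp: UX core_iff)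
    next
      case True
      then show ?thesis using ab fcol_less[of a g] fcol_ge[of "3 * g" a]
        by (cases "3 * g \<le> a") (auto simp: UX core_iff split: if_splits)
    qed
  qed
  show "ladj 0 u v" if uv: "u \<in> level 0" "v \<in> level 0" "ladj 0 (fold_cols g u) (fold_cols g v)" for u v
  proof -
    have AX: "i = a \<or> i = a + 1" if "i \<le> t" "a < t" "ladj 0 (UA (frow (3 * g) i)) (UX h (fcol (3 * g) a) 0)" for i h a
      by (rule frow_col[of i g a]) (use that t in auto)
    show ?thesis
    proof (cases u; cases v)
      fix i h a b assume e: "u = UA i" "v = UX h a b"
      have "b = 0" using uv e by (auto split: if_splits)
      then show ?thesis using AX[of i a] uv e by (auto simp: level_def)
    next
      fix i h a b assume e: "v = UA i" "u = UX h a b"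
      have "b = 0" using uv e by (auto split: if_splits)
      then show ?thesis using AX[of i a] uv e by (auto simp: level_def)
    next
      fix h a b h' a' b' assume e: "u = UX h a b" "v = UX h' a' b'"
      show ?thesis
      proof (cases "b = 0 \<and> b' = 0")
        case False
        then show ?thesis using uv e by (auto split: if_splits)
      next
        case True
        let ?h = "if 3 * g \<le> a then h else a mod 3 = 0" and ?h' = "if 3 * g \<le> a' then h' else a' mod 3 = 0"
        have *: "?h = ?h'" "fcol (3 * g) a' = fcol (3 * g) a + 1 \<or> fcol (3 * g) a = fcol (3 * g) a' + 1"
          using uv(3) unfolding e fold_cols.simps using True by simp_all
        have ge: "3 * g \<le> a \<and> 3 * g \<le> a'"
        proof (rule ccontr)
          assume neg: "\<not> ?thesis"
          show False using *(2)
          proof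
            assume "fcol (3 * g) a' = fcol (3 * g) a + 1"
            from fcol_col[OF this neg] *(1) show False by simp
          next
            assume "fcol (3 * g) a = fcol (3 * g) a' + 1"
            from fcol_col[OF this] neg *(1) show False by auto
          qed
        qed
        then show ?thesis using * True by (auto simp: e fcol_ge)
      qed
    qed (use uv in auto)
  qed
qed

section \<open>The matching in the folded graph and its number of edges\<close>

definition inner where "inner = {UX h a b | h a b. a < t \<and> b \<le> 3 * m \<and> b mod 3 = 1}"

text \<open>There are \<open>2 * t\<close> paths, each with \<open>m\<close> split-off edges,
  counted by their first ends.\<close>

lemma card_inner: "card inner = 2 * t * m" "finite inner"
proof -
  have b: "{b. b \<le> 3 * m \<and> b mod 3 = 1} = (\<lambda>i. 3 * i + 1) ` {..<m}"
  proof (rule Set.set_eqI)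
    fix b show "b \<in> {b. b \<le> 3 * m \<and> b mod 3 = 1} \<longleftrightarrow> b \<in> (\<lambda>i. 3 * i + 1) ` {..<m}"
    proof
      assume "b \<in> {b. b \<le> 3 * m \<and> b mod 3 = 1}"
      then have "b \<le> 3 * m" "b mod 3 = 1" by auto
      then have "b = 3 * (b div 3) + 1 \<and> b div 3 < m" by presburger
      then show "b \<in> (\<lambda>i. 3 * i + 1) ` {..<m}" by blast
    next
      assume "b \<in> (\<lambda>i. 3 * i + 1) ` {..<m}"
      then obtain i where "i < m" "b = 3 * i + 1" by blast
      then show "b \<in> {b. b \<le> 3 * m \<and> b mod 3 = 1}" by (simp add: mod_Suc)
    qed
  qed
  have eq: "inner = (\<lambda>(h, a, b). UX h a b) ` (UNIV \<times> {..<t} \<times> {b. b \<le> 3 * m \<and> b mod 3 = 1})"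
    by (auto simp: inner_def image_iff)
  have "card {b. b \<le> 3 * m \<and> b mod 3 = 1} = m" unfolding b by (subst card_image) (auto simp: inj_on_def)
  then show "card inner = 2 * t * m"
    unfolding eq by (subst card_image) (auto simp: inj_on_def card_cartesian_product)
  show "finite inner" unfolding eq by auto
qed

lemma card_not_mod_1: "card {i. i < 3 * s \<and> i mod 3 \<noteq> 1} = 2 * s"
proof (induction s)
  case (Suc s)
  have "{i. i < 3 * Suc s \<and> i mod 3 \<noteq> 1} = insert (3 * s + 2) (insert (3 * s) {i. i < 3 * s \<and> i mod 3 \<noteq> 1})"
  proof (rule Set.set_eqI)
    fix i
    have "i < 3 * Suc s \<and> i mod 3 \<noteq> 1 \<longleftrightarrow> i = 3 * s + 2 \<or> i = 3 * s \<or> i < 3 * s \<and> i mod 3 \<noteq> 1" by presburger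
    then show "i \<in> {i. i < 3 * Suc s \<and> i mod 3 \<noteq> 1} \<longleftrightarrow> i \<in> insert (3 * s + 2) (insert (3 * s) {i. i < 3 * s \<and> i mod 3 \<noteq> 1})"
      by simp
  qed
  then show ?case using Suc by simp
qed simp

text \<open>A polygon vertex with index divisible by three is matched to the upper vertex on its
  right, one with remainder 2 to the lower vertex on its left, and the first end of a split-off edge
  to the second.\<close>

fun lmate :: "uvtx \<Rightarrow> uvtx" where
  "lmate (UA i) = (if i mod 3 = 0 then UX True i 0 else UX False (i - 1) 0)"
| "lmate (UX h a b) = (if b = 0 then UX h (a + 1) 0 else UX h a (b + 1))"

lemma inner_iff: "UA i \<notin> inner" "UX h a b \<in> inner \<longleftrightarrow> a < t \<and> b \<le> 3 * m \<and> b mod 3 = 1"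
  by (auto simp: inner_def)

definition mates :: "nat \<Rightarrow> uvtx set" where
  "mates g = UA ` {i. i \<le> t \<and> i < 3 * g \<and> i mod 3 \<noteq> 1} \<union> inner"

lemma mates_iff:
  "UA i \<in> mates g \<longleftrightarrow> i \<le> t \<and> i < 3 * g \<and> i mod 3 \<noteq> 1"
  "UX h a b \<in> mates g \<longleftrightarrow> a < t \<and> b \<le> 3 * m \<and> b mod 3 = 1"
  by (auto simp: mates_def inner_iff)

text \<open>If \<open>t\<close> were a multiple of three below \<open>3 * g\<close>, the partner of
  \<open>UA t\<close> would lie in column \<open>t\<close>, which does not exist; the first
  hypothesis excludes this.\<close>

lemma mate_iff:
  assumes t3: "t < 3 * g \<Longrightarrow> t mod 3 \<noteq> 0" and t: "t < 3 * g \<or> t = 3 * g + 3"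
  shows "UA i \<notin> lmate ` mates g"
    "UX h a b \<in> lmate ` mates g \<longleftrightarrow> a < t \<and> (b \<le> 3 * m \<and> b mod 3 = 2 \<or>
        b = 0 \<and> a < 3 * g \<and> (h \<and> a mod 3 = 0 \<or> \<not> h \<and> a mod 3 = 1))"
proof -
  have ne0: "b' \<noteq> 0" if "b' mod 3 = 1" for b' :: nat using that by auto
  show "UA i \<notin> lmate ` mates g"
  proof
    assume "UA i \<in> lmate ` mates g"
    then obtain u where "u \<in> mates g" "UA i = lmate u" by blast
    then show False by (cases u) (auto split: if_splits)
  qed
  show "UX h a b \<in> lmate ` mates g \<longleftrightarrow> a < t \<and> (b \<le> 3 * m \<and> b mod 3 = 2 \<or>
      b = 0 \<and> a < 3 * g \<and> (h \<and> a mod 3 = 0 \<or> \<not> h \<and> a mod 3 = 1))" (is "?l \<longleftrightarrow> ?r")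
  proof
    assume ?l
    then obtain u where u: "u \<in> mates g" "UX h a b = lmate u" by blast
    show ?r
    proof (cases u)
      case (UA i)
      then have i: "i \<le> t" "i < 3 * g" "i mod 3 \<noteq> 1" using u mates_iff by auto
      show ?thesis
      proof (cases "i mod 3 = 0")
        case True
        then have "i \<noteq> t" using i t3 t by auto
        then show ?thesis using u UA True i by auto
      next
        case False
        then have "i mod 3 = 2" using i(3) by linarith
        then have "(i - 1) mod 3 = 1" "i \<noteq> 0" using pred_mod_3 by blast+
        then show ?thesis using u UA False i by auto
      qed
    next
      case (UX h' a' b')
      then have b': "a' < t" "b' \<le> 3 * m" "b' mod 3 = 1" using u mates_iff by auto
      have "b' \<noteq> 3 * m" using b'(3) by auto
      then have "(b' + 1) mod 3 = 2" "b' + 1 \<le> 3 * m" using Suc_mod_3_less[of b' m] b'(2,3) by auto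
      then show ?thesis using u UX ne0[OF b'(3)] b'(1) by auto
    qed
  next
    assume r: ?r
    then consider "a < t" "b \<le> 3 * m" "b mod 3 = 2" | "a < t" "a < 3 * g" "b = 0" "h" "a mod 3 = 0"
      | "a < t" "a < 3 * g" "b = 0" "\<not> h" "a mod 3 = 1" by (cases h) auto
    then show ?l
    proof cases
      case 1
      then have "(b - 1) mod 3 = 1" "b - 1 \<le> 3 * m" "b \<noteq> 0" using pred_mod_3[of b] by auto
      then have "UX h a (b - 1) \<in> mates g" "lmate (UX h a (b - 1)) = UX h a b" using 1 mates_iff ne0[of "b - 1"] by auto
      then show ?thesis by (metis imageI)
    next
      case 2
      then have "UA a \<in> mates g" "lmate (UA a) = UX h a b" using mates_iff by auto
      then show ?thesis by (metis imageI)
    next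
      case 3
      then have "(a + 1) mod 3 = 2" "a + 1 < 3 * g" using Suc_mod_3_less[of a g] by auto
      then have "UA (a + 1) \<in> mates g" "lmate (UA (a + 1)) = UX h a b" using mates_iff 3 by auto
      then show ?thesis by (metis imageI)
    qed
  qed
qed

lemma inj_lmate: "inj_on lmate (mates g)"
proof (rule inj_onI)
  fix u v assume uv: "u \<in> mates g" "v \<in> mates g" "lmate u = lmate v"
  have "i = j" if "i - 1 = j - 1" "i mod 3 \<noteq> 0" "j mod 3 \<noteq> 0" for i j :: nat using that by (cases i; cases j) auto
  then show "u = v" using uv by (cases u; cases v) (auto simp: mates_iff split: if_splits)
qed

definition lmatch :: "nat \<Rightarrow> uvtx \<Rightarrow> uvtx \<Rightarrow> bool" where
  "lmatch g u v \<longleftrightarrow> u \<in> mates g \<and> v = lmate u \<or> v \<in> mates g \<and> u = lmate v"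

text \<open>Separates the matching part of the core from the 8-cycle.\<close>

definition left :: "nat \<Rightarrow> uvtx \<Rightarrow> bool" where
  "left g u = (case u of UA i \<Rightarrow> i < 3 * g | UX h a b \<Rightarrow> b \<noteq> 0 \<or> a < 3 * g)"

text \<open>Only one of the two vertices has to lie in the matching part, since no edge leads from
  there to the 8-cycle.\<close>

lemma left_adj:
  assumes uv: "u \<in> core g" "v \<in> core g" and l: "left g u"
  shows "ladj 0 u v \<longleftrightarrow> lmatch g u v"
proof -
  have AX: "ladj 0 (UA i) (UX h a b) \<longleftrightarrow> lmatch g (UA i) (UX h a b)"
    if T: "UA i \<in> core g" "UX h a b \<in> core g" and l: "i < 3 * g \<or> b \<noteq> 0 \<or> a < 3 * g" for i h a b
  proof -
    have i: "i \<le> t" "i < 3 * g \<and> i mod 3 \<noteq> 1 \<or> i = 3 * g \<or> i = 3 * g + 3"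
      and a: "a < t" "b mod 3 \<noteq> 0 \<or> b = 0 \<and> (3 * g \<le> a \<or> h \<and> a mod 3 = 0 \<or> \<not> h \<and> a mod 3 = 1)"
      using T by (auto simp: core_iff)
    have m: "lmatch g (UA i) (UX h a b) \<longleftrightarrow> i < 3 * g \<and> b = 0 \<and> (if i mod 3 = 0 then h \<and> a = i else \<not> h \<and> a = i - 1)"
      using i by (auto simp: lmatch_def mates_iff)
    show ?thesis
    proof (cases "b = 0")
      case False then show ?thesis using m by auto
    next
      case True
      have ladj: "ladj 0 (UA i) (UX h a b) \<longleftrightarrow> i = a \<or> i = a + 1" using True by auto
      show ?thesis
      proof (cases "a < 3 * g")
        case ag: True
        then have h: "h \<and> a mod 3 = 0 \<or> \<not> h \<and> a mod 3 = 1" using a True by auto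
        show ?thesis
        proof (cases "i < 3 * g")
          case ig: True
          then have i3: "i mod 3 \<noteq> 1" using i by auto
          show ?thesis using h
          proof (elim disjE conjE)
            assume h: "h" "a mod 3 = 0"
            then have "i \<noteq> a + 1" using i3 by (auto simp: mod_Suc)
            then show ?thesis unfolding ladj m using h ig True by auto
          next
            assume h: "\<not> h" "a mod 3 = 1"
            then have "i \<noteq> a" using i3 by auto
            moreover have "i = a + 1 \<Longrightarrow> i mod 3 \<noteq> 0" using h by (auto simp: mod_Suc)
            moreover have "i \<noteq> 0 \<Longrightarrow> a = i - 1 \<longleftrightarrow> i = a + 1" by auto
            ultimately show ?thesis unfolding ladj m using h ig True by (cases "i = 0") auto
          qed
        next
          case False
          then have "i = 3 * g \<or> i = 3 * g + 3" using i by auto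
          moreover have "a mod 3 = 0 \<or> a mod 3 = 1" using h by auto
          then have "a + 1 \<noteq> 3 * g" by presburger
          ultimately show ?thesis unfolding ladj m using ag by auto
        qed
      next
        case False
        then have "i < 3 * g" using l True by auto
        then show ?thesis unfolding ladj m using False by auto
      qed
    qed
  qed
  show ?thesis
  proof (cases u; cases v)
    fix i h a b assume e: "u = UA i" "v = UX h a b"
    then show ?thesis using AX[of i h a b] uv l by (auto simp: left_def)
  next
    fix i h a b assume e: "v = UA i" "u = UX h a b"
    have "ladj 0 u v \<longleftrightarrow> ladj 0 (UA i) (UX h a b)" "lmatch g u v \<longleftrightarrow> lmatch g (UA i) (UX h a b)"
      by (auto simp: e lmatch_def)
    then show ?thesis using AX[of i h a b] uv l e by (auto simp: left_def)
  next
    fix h a b h' a' b' assume e: "u = UX h a b" "v = UX h' a' b'"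
    have x: "a < t" "b \<le> 3 * m" "b mod 3 \<noteq> 0 \<or> b = 0 \<and> (3 * g \<le> a \<or> h \<and> a mod 3 = 0 \<or> \<not> h \<and> a mod 3 = 1)"
      and y: "a' < t" "b' \<le> 3 * m" "b' mod 3 \<noteq> 0 \<or> b' = 0 \<and> (3 * g \<le> a' \<or> h' \<and> a' mod 3 = 0 \<or> \<not> h' \<and> a' mod 3 = 1)"
      using uv by (auto simp: e core_iff)
    have "\<not> (h = h' \<and> b = 0 \<and> b' = 0 \<and> (a' = a + 1 \<or> a = a' + 1))"
    proof
      assume *: "h = h' \<and> b = 0 \<and> b' = 0 \<and> (a' = a + 1 \<or> a = a' + 1)"
      then have ag: "a < 3 * g" using l by (simp add: e left_def)
      have 1: "h \<and> a mod 3 = 0 \<or> \<not> h \<and> a mod 3 = 1" using x(3) * ag by auto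
      then have "a mod 3 = 0 \<or> a mod 3 = 1" by auto
      then have "a + 1 \<noteq> 3 * g" by presburger
      then have "a' < 3 * g" using * ag by auto
      then have "h \<and> a' mod 3 = 0 \<or> \<not> h \<and> a' mod 3 = 1" using y(3) * by auto
      then have "a mod 3 = a' mod 3" using 1 by auto
      moreover have "a' = a + 1 \<or> a = a' + 1" using * by simp
      ultimately show False by presburger
    qed
    moreover have "b = 0 \<Longrightarrow> b mod 3 \<noteq> 1" "b' = 0 \<Longrightarrow> b' mod 3 \<noteq> 1" by auto
    ultimately show ?thesis unfolding e lmatch_def ladj.simps lmate.simps mates_iff using x(1,2) y(1,2) by auto
  qed (auto simp: lmatch_def mates_iff split: if_splits)
qed

text \<open>\<open>s\<close> counts the complete blocks of three, with two matched polygon vertices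
  each, and \<open>X\<close> collects those of the incomplete block.\<close>

lemma card_mates:
  assumes "\<And>i. i \<le> t \<and> i < 3 * g \<and> i mod 3 \<noteq> 1 \<longleftrightarrow> i < 3 * s \<and> i mod 3 \<noteq> 1 \<or> i \<in> X"
    and "finite X" "\<And>i. i \<in> X \<Longrightarrow> 3 * s \<le> i"
  shows "card (mates g) = 2 * s + card X + 2 * t * m" "finite (mates g)"
proof -
  have eq: "{i. i \<le> t \<and> i < 3 * g \<and> i mod 3 \<noteq> 1} = {i. i < 3 * s \<and> i mod 3 \<noteq> 1} \<union> X" using assms(1) by blast
  have "card ({i. i < 3 * s \<and> i mod 3 \<noteq> 1} \<union> X) = 2 * s + card X"
  proof (subst card_Un_disjoint)
    show "{i. i < 3 * s \<and> i mod 3 \<noteq> 1} \<inter> X = {}"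
    proof (rule equals0I)
      fix i assume "i \<in> {i. i < 3 * s \<and> i mod 3 \<noteq> 1} \<inter> X"
      then show False using assms(3)[of i] by auto
    qed
  qed (use assms(2) card_not_mod_1[of s] in auto)
  moreover have fin: "finite ({i. i < 3 * s \<and> i mod 3 \<noteq> 1} \<union> X)" using assms(2) by simp
  moreover have "UA ` S \<inter> inner = {}" for S using inner_iff(1) by blast
  ultimately show "card (mates g) = 2 * s + card X + 2 * t * m" unfolding mates_def eq
    using card_inner by (subst card_Un_disjoint) (auto simp: card_image inj_on_def)
  show "finite (mates g)" unfolding mates_def eq using fin card_inner(2) by simp
qed

lemma mates_disjoint:
  assumes "t < 3 * g \<Longrightarrow> t mod 3 \<noteq> 0" "t < 3 * g \<or> t = 3 * g + 3"
  shows "mates g \<inter> lmate ` mates g = {}"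
proof (rule equals0I)
  fix u assume "u \<in> mates g \<inter> lmate ` mates g"
  then show False by (cases u) (auto simp: mate_iff[OF assms] mates_iff)
qed

text \<open>When three does not divide \<open>t\<close>, folding the whole ladder leaves a perfect
  matching with \<open>Suc d\<close> edges.\<close>

lemma not_conn_12:
  assumes t: "t = 3 * s + e" "e = 1 \<or> e = 2" and d: "Suc d = 2 * t * m + 2 * s + e"
  shows "\<not> conn (ladj 0) (int d) (level 0)"
proof
  assume "conn (ladj 0) (int d) (level 0)"
  \<comment> \<open>One block more than the complete ones, so that every polygon vertex lies left of
    \<open>3 * g\<close> and no cycle remains.\<close>
  define g where "g = s + 1"
  have tg: "t < 3 * g" using t by (auto simp: g_def)
  have conn: "conn (ladj 0) (int d) (core g)" by (rule core_conn[OF _ \<open>conn _ _ _\<close>]) (use tg in simp)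
  have t3: "t mod 3 \<noteq> 0" using t by (auto simp: mod_simps)
  have l: "left g u" if "u \<in> core g" for u
    using that tg by (cases u) (auto simp: left_def core_iff)
  have mate: "UA i \<notin> lmate ` mates g" "UX h a b \<in> lmate ` mates g \<longleftrightarrow> a < t \<and> (b \<le> 3 * m \<and> b mod 3 = 2 \<or>
        b = 0 \<and> a < 3 * g \<and> (h \<and> a mod 3 = 0 \<or> \<not> h \<and> a mod 3 = 1))" for i h a b
    using mate_iff[of g] t3 tg by auto
  have "card (mates g) = 2 * s + card (if e = 1 then {3 * s} else {3 * s, 3 * s + 2}) + 2 * t * m"
  proof (rule card_mates)
    fix i
    have "i \<le> t \<and> i mod 3 \<noteq> 1 \<longleftrightarrow> i < 3 * s \<and> i mod 3 \<noteq> 1 \<or> i = 3 * s \<or> e = 2 \<and> i = 3 * s + 2" using t by presburger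
    then show "i \<le> t \<and> i < 3 * g \<and> i mod 3 \<noteq> 1 \<longleftrightarrow> i < 3 * s \<and> i mod 3 \<noteq> 1 \<or> i \<in> (if e = 1 then {3 * s} else {3 * s, 3 * s + 2})"
      using t(2) tg by auto
  qed (use t in \<open>auto split: if_splits\<close>)
  then have cardP: "card (mates g) = Suc d" using d t(2) by auto
  have "\<not> conn (ladj 0) (int d) (core g)"
  proof (rule matching_not_conn[where P = "mates g" and \<pi> = lmate, OF _ _ _ inj_lmate cardP])
    show "finite (core g)" using finite_level[of 0] by (simp add: core_def)
    show "core g = mates g \<union> lmate ` mates g"
    proof (rule Set.set_eqI)
      fix u show "u \<in> core g \<longleftrightarrow> u \<in> mates g \<union> lmate ` mates g"
      proof (cases u)
        case (UA i)
        show ?thesis unfolding UA core_iff Un_iff mates_iff using mate(1) tg by auto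
      next
        case (UX h a b)
        have "b mod 3 \<noteq> 0 \<longleftrightarrow> b mod 3 = 1 \<or> b mod 3 = 2" by presburger
        then show ?thesis unfolding UX core_iff Un_iff mates_iff mate(2) using tg by auto
      qed
    qed
    show "mates g \<inter> lmate ` mates g = {}" by (rule mates_disjoint) (use t3 tg in auto)
    show "ladj 0 u v \<longleftrightarrow> u \<in> mates g \<and> v = lmate u \<or> v \<in> mates g \<and> u = lmate v" if "u \<in> core g" "v \<in> core g" for u v
      using left_adj[OF that l[OF that(1)]] by (simp add: lmatch_def)
  qed
  then show False using conn by blast
qed

end

section \<open>The remaining 8-cycle when three divides \<open>t\<close>\<close>

definition is_pair :: "'a \<Rightarrow> 'a \<Rightarrow> 'a \<Rightarrow> 'a \<Rightarrow> bool" where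
  "is_pair x y u v \<longleftrightarrow> u = x \<and> v = y \<or> u = y \<and> v = x"

lemma is_pair_iff: "is_pair x y u v \<longleftrightarrow> {u, v} = {x, y}"
  by (auto simp: is_pair_def doubleton_eq_iff)

lemma conn_split_single:
  assumes fin: "finite V" and mem: "x \<in> V" "p \<in> V" "q \<in> V" "w \<in> V" and dist: "distinct [x, p, q, w]"
    and path: "E x p" "E p q" "E q w" and pq: "E' p q"
    and expand: "\<And>a a'. a \<in> V \<Longrightarrow> a' \<in> V \<Longrightarrow> E a a' \<Longrightarrow> is_pair x p a a' \<or> is_pair p q a a' \<or> is_pair q w a a' \<or>
      a \<notin> {p, q} \<and> a' \<notin> {p, q} \<and> E' (if a = w then x else a) (if a' = w then x else a')"
    and contract: "\<And>u u'. u \<in> V \<Longrightarrow> u' \<in> V \<Longrightarrow> E' u u' \<Longrightarrow> is_pair p q u u' \<or>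
      u \<notin> {p, q} \<and> u' \<notin> {p, q} \<and> (E u u' \<or> u = x \<and> E w u' \<or> u' = x \<and> E u w)"
    and "conn E k V"
  shows "conn E' k (V - {w})"
proof -
  have im: "(\<lambda>_. y) ` {x} = {y}" for y by simp
  have "conn E' k (V - (\<lambda>_. w) ` {x})"
  proof (rule conn_split[where R = "{x}" and p = "\<lambda>_. p" and q = "\<lambda>_. q" and rt = "\<lambda>_. x", OF fin _ _ _ _ _ _ _ _ _ _ _ _ _ _ _ assms(13)])
    fix a a' assume "a \<in> V" "a' \<in> V" "E a a'"
    from expand[OF this]
    show "(\<exists>y\<in>{x}. {a, a'} \<in> {{y, p}, {p, q}, {q, w}}) \<or>
       a \<notin> (\<lambda>_. p) ` {x} \<union> (\<lambda>_. q) ` {x} \<and> a' \<notin> (\<lambda>_. p) ` {x} \<union> (\<lambda>_. q) ` {x} \<and>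
       E' (if a \<in> (\<lambda>_. w) ` {x} then x else a) (if a' \<in> (\<lambda>_. w) ` {x} then x else a')"
      unfolding im is_pair_iff singleton_iff by blast
  next
    fix u u' assume "u \<in> V - (\<lambda>_. w) ` {x}" "u' \<in> V - (\<lambda>_. w) ` {x}" "E' u u'"
    then have "is_pair p q u u' \<or> u \<notin> {p, q} \<and> u' \<notin> {p, q} \<and> (E u u' \<or> u = x \<and> E w u' \<or> u' = x \<and> E u w)"
      by (intro contract) auto
    then show "(\<exists>y\<in>{x}. {u, u'} = {p, q}) \<or>
       u \<notin> (\<lambda>_. p) ` {x} \<union> (\<lambda>_. q) ` {x} \<and> u' \<notin> (\<lambda>_. p) ` {x} \<union> (\<lambda>_. q) ` {x} \<and>
       (\<exists>a a'. (a = u \<or> u \<in> {x} \<and> a = w) \<and> (a' = u' \<or> u' \<in> {x} \<and> a' = w) \<and> E a a')"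
      unfolding im is_pair_iff by blast
  qed (use mem dist path pq in auto)
  then show ?thesis by simp
qed

text \<open>Two path contractions turn the 8-cycle into three disjoint edges. Together with the
  given matching these are \<open>card P + 3 = Suc d\<close> edges.\<close>

lemma matching_cycle_not_conn:
  fixes E :: "'a \<Rightarrow> 'a \<Rightarrow> bool" and \<pi> :: "'a \<Rightarrow> 'a"
  assumes finP: "finite P" and inj: "inj_on \<pi> P" and disj: "P \<inter> \<pi> ` P = {}"
    and dist: "distinct [z0, z1, z2, z3, z4, z5, z6, z7]"
    and Z: "\<And>x. x \<in> P \<union> \<pi> ` P \<Longrightarrow> x \<notin> {z0, z1, z2, z3, z4, z5, z6, z7}"
    and V: "V = P \<union> \<pi> ` P \<union> {z0, z1, z2, z3, z4, z5, z6, z7}"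
    and E: "\<And>u v. u \<in> V \<Longrightarrow> v \<in> V \<Longrightarrow> E u v \<longleftrightarrow> (u \<in> P \<and> v = \<pi> u \<or> v \<in> P \<and> u = \<pi> v) \<or>
      {u, v} \<in> {{z0, z1}, {z1, z2}, {z2, z3}, {z3, z4}, {z4, z5}, {z5, z6}, {z6, z7}, {z7, z0}}"
    and d: "d = card P + 2"
  shows "\<not> conn E (int d) V"
proof
  assume conn: "conn E (int d) V"
  define mt where "mt u v \<longleftrightarrow> u \<in> P \<and> v = \<pi> u \<or> v \<in> P \<and> u = \<pi> v" for u v
  \<comment> \<open>Contracting \<open>z1\<close>, \<open>z2\<close>, \<open>z3\<close>,
    \<open>z4\<close> splits off the edge \<open>z2\<close>, \<open>z3\<close> and leaves the
    5-cycle \<open>z0\<close>, \<open>z1\<close>, \<open>z5\<close>, \<open>z6\<close>,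
    \<open>z7\<close>.\<close>
  define E1 where "E1 u v \<longleftrightarrow> mt u v \<or> is_pair z0 z1 u v \<or> is_pair z1 z5 u v \<or> is_pair z2 z3 u v \<or> is_pair z5 z6 u v \<or> is_pair z6 z7 u v \<or> is_pair z7 z0 u v"
    for u v
  \<comment> \<open>Contracting \<open>z1\<close>, \<open>z5\<close>, \<open>z6\<close>,
    \<open>z7\<close> opens the 5-cycle: \<open>z5\<close>, \<open>z6\<close> is split off, and both
    edges at \<open>z0\<close> become the edge to \<open>z1\<close>.\<close>
  define E2 where "E2 u v \<longleftrightarrow> mt u v \<or> is_pair z0 z1 u v \<or> is_pair z2 z3 u v \<or> is_pair z5 z6 u v" for u v
  have fin: "finite V" using finP V by simp
  have mt: "u \<notin> {z0, z1, z2, z3, z4, z5, z6, z7} \<and> v \<notin> {z0, z1, z2, z3, z4, z5, z6, z7}" if "mt u v" for u v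
    using that Z[of u] Z[of v] by (auto simp: mt_def)
  have EV: "E u v \<longleftrightarrow> mt u v \<or> is_pair z0 z1 u v \<or> is_pair z1 z2 u v \<or> is_pair z2 z3 u v \<or> is_pair z3 z4 u v \<or> is_pair z4 z5 u v \<or> is_pair z5 z6 u v
      \<or> is_pair z6 z7 u v \<or> is_pair z7 z0 u v" if "u \<in> V" "v \<in> V" for u v
    unfolding E[OF that] mt_def is_pair_iff by simp
  have ne: "z0 \<noteq> z1" "z0 \<noteq> z2" "z0 \<noteq> z3" "z0 \<noteq> z4" "z0 \<noteq> z5" "z0 \<noteq> z6" "z0 \<noteq> z7" "z1 \<noteq> z2" "z1 \<noteq> z3" "z1 \<noteq> z4" "z1 \<noteq> z5"
    "z1 \<noteq> z6" "z1 \<noteq> z7" "z2 \<noteq> z3" "z2 \<noteq> z4" "z2 \<noteq> z5" "z2 \<noteq> z6" "z2 \<noteq> z7" "z3 \<noteq> z4" "z3 \<noteq> z5" "z3 \<noteq> z6" "z3 \<noteq> z7"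
    "z4 \<noteq> z5" "z4 \<noteq> z6" "z4 \<noteq> z7" "z5 \<noteq> z6" "z5 \<noteq> z7" "z6 \<noteq> z7"
    using dist by simp_all
  note ne' = ne ne[symmetric]
  have zV: "z0 \<in> V" "z1 \<in> V" "z2 \<in> V" "z3 \<in> V" "z4 \<in> V" "z5 \<in> V" "z6 \<in> V" "z7 \<in> V" by (simp_all add: V)
  have conn1: "conn E1 (int d) (V - {z4})"
  proof (rule conn_split_single[OF fin zV(2,3,4,5) _ _ _ _ _ _ _ conn])
    show "E z1 z2" "E z2 z3" "E z3 z4" using zV by (simp_all add: EV is_pair_def)
    show "E1 z2 z3" by (simp add: E1_def is_pair_def)
    fix a a' assume a: "a \<in> V" "a' \<in> V" "E a a'"
    from a(3)[unfolded EV[OF a(1,2)]]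
    show "is_pair z1 z2 a a' \<or> is_pair z2 z3 a a' \<or> is_pair z3 z4 a a' \<or>
      a \<notin> {z2, z3} \<and> a' \<notin> {z2, z3} \<and> E1 (if a = z4 then z1 else a) (if a' = z4 then z1 else a')"
    proof (elim disjE)
      assume "mt a a'" with mt[OF this] show ?thesis by (simp add: E1_def)
    qed (unfold is_pair_def[of _ _ a a'], (elim disjE conjE; simp add: ne' is_pair_def E1_def)+)
  next
    fix u u' assume u: "u \<in> V" "u' \<in> V" "E1 u u'"
    from u(3)[unfolded E1_def]
    show "is_pair z2 z3 u u' \<or> u \<notin> {z2, z3} \<and> u' \<notin> {z2, z3} \<and> (E u u' \<or> u = z1 \<and> E z4 u' \<or> u' = z1 \<and> E u z4)"
    proof (elim disjE)
      assume "mt u u'" with mt[OF this] show ?thesis by (simp add: EV u)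
    qed (unfold is_pair_def[of _ _ u u'], (elim disjE conjE; simp add: ne' is_pair_def EV zV)+)
  qed (use ne in simp)
  have fin1: "finite (V - {z4})" using fin by simp
  have zV1: "z1 \<in> V - {z4}" "z5 \<in> V - {z4}" "z6 \<in> V - {z4}" "z7 \<in> V - {z4}" using zV ne' by auto
  have conn2: "conn E2 (int d) (V - {z4} - {z7})"
  proof (rule conn_split_single[OF fin1 zV1 _ _ _ _ _ _ _ conn1])
    show "E1 z1 z5" "E1 z5 z6" "E1 z6 z7" by (simp_all add: E1_def is_pair_def)
    show "E2 z5 z6" by (simp add: E2_def is_pair_def)
    fix a a' assume a: "a \<in> V - {z4}" "a' \<in> V - {z4}" "E1 a a'"
    from a(3)[unfolded E1_def]
    show "is_pair z1 z5 a a' \<or> is_pair z5 z6 a a' \<or> is_pair z6 z7 a a' \<or>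
      a \<notin> {z5, z6} \<and> a' \<notin> {z5, z6} \<and> E2 (if a = z7 then z1 else a) (if a' = z7 then z1 else a')"
    proof (elim disjE)
      assume "mt a a'" with mt[OF this] show ?thesis by (simp add: E2_def)
    qed (unfold is_pair_def[of _ _ a a'], (elim disjE conjE; simp add: ne' is_pair_def E2_def)+)
  next
    fix u u' assume u: "u \<in> V - {z4}" "u' \<in> V - {z4}" "E2 u u'"
    from u(3)[unfolded E2_def]
    show "is_pair z5 z6 u u' \<or> u \<notin> {z5, z6} \<and> u' \<notin> {z5, z6} \<and> (E1 u u' \<or> u = z1 \<and> E1 z7 u' \<or> u' = z1 \<and> E1 u z7)"
    proof (elim disjE)
      assume "mt u u'" with mt[OF this] show ?thesis by (simp add: E1_def)
    qed (unfold is_pair_def[of _ _ u u'], (elim disjE conjE; simp add: ne' is_pair_def E1_def)+)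
  qed (use ne in simp)
  define \<pi>2 where "\<pi>2 = \<pi>(z1 := z0, z2 := z3, z5 := z6)"
  define P2 where "P2 = P \<union> {z1, z2, z5}"
  have \<pi>2P: "\<pi>2 x = \<pi> x" if "x \<in> P" for x using Z[of x] that by (auto simp: \<pi>2_def)
  have \<pi>2z: "\<pi>2 z1 = z0" "\<pi>2 z2 = z3" "\<pi>2 z5 = z6" using dist by (auto simp: \<pi>2_def)
  have im: "\<pi>2 ` P2 = \<pi> ` P \<union> {z0, z3, z6}" using \<pi>2P \<pi>2z by (auto simp: P2_def image_Un)
  have nP: "z0 \<notin> P" "z1 \<notin> P" "z2 \<notin> P" "z3 \<notin> P" "z5 \<notin> P" "z6 \<notin> P" "z4 \<notin> P" "z7 \<notin> P" using Z by blast+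
  have n\<pi>: "z \<notin> \<pi> ` P" if "z \<in> {z0, z1, z2, z3, z4, z5, z6, z7}" for z using Z that by blast
  have "\<not> conn E2 (int d) (V - {z4} - {z7})"
  proof (rule matching_not_conn[where P = P2 and \<pi> = \<pi>2])
    show "finite (V - {z4} - {z7})" using fin by simp
    show "V - {z4} - {z7} = P2 \<union> \<pi>2 ` P2"
      unfolding im unfolding P2_def V using nP n\<pi>[of z4] n\<pi>[of z7] dist by auto
    show "P2 \<inter> \<pi>2 ` P2 = {}"
      unfolding im unfolding P2_def using nP n\<pi>[of z1] n\<pi>[of z2] n\<pi>[of z5] dist disj by auto
    show "inj_on \<pi>2 P2"
    proof (rule inj_onI)
      fix x y assume xy: "x \<in> P2" "y \<in> P2" "\<pi>2 x = \<pi>2 y"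
      have *: "\<pi> x \<noteq> z0 \<and> \<pi> x \<noteq> z3 \<and> \<pi> x \<noteq> z6" if "x \<in> P" for x using Z[of "\<pi> x"] that by auto
      show "x = y" using xy \<pi>2P[of x] \<pi>2P[of y] \<pi>2z *[of x] *[of y] inj dist unfolding P2_def by (auto dest: inj_onD)
    qed
    show "card P2 = Suc d" unfolding P2_def d using finP nP dist by simp
    show "E2 u v \<longleftrightarrow> u \<in> P2 \<and> v = \<pi>2 u \<or> v \<in> P2 \<and> u = \<pi>2 v" for u v
    proof -
      have *: "x \<in> P2 \<and> y = \<pi>2 x \<longleftrightarrow> x \<in> P \<and> y = \<pi> x \<or> x = z1 \<and> y = z0 \<or> x = z2 \<and> y = z3 \<or> x = z5 \<and> y = z6" for x y
        using \<pi>2P[of x] \<pi>2z by (auto simp: P2_def)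
      show ?thesis unfolding *[of u v] *[of v u] E2_def mt_def is_pair_def by argo
    qed
  qed
  then show False using conn2 by blast
qed

text \<open>The 8-cycle runs along the upper side of three consecutive polygons and back along the
  lower side.\<close>

lemma ladj_cycle:
  assumes "case u of UA i \<Rightarrow> i = c \<or> i = c + 3 | UX h a b \<Rightarrow> b = 0 \<and> c \<le> a \<and> a < c + 3"
    and "case v of UA i \<Rightarrow> i = c \<or> i = c + 3 | UX h a b \<Rightarrow> b = 0 \<and> c \<le> a \<and> a < c + 3"
  shows "ladj 0 u v \<longleftrightarrow> is_pair (UA c) (UX True c 0) u v \<or> is_pair (UX True c 0) (UX True (c + 1) 0) u v \<or>
    is_pair (UX True (c + 1) 0) (UX True (c + 2) 0) u v \<or> is_pair (UX True (c + 2) 0) (UA (c + 3)) u v \<or>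
    is_pair (UA (c + 3)) (UX False (c + 2) 0) u v \<or> is_pair (UX False (c + 2) 0) (UX False (c + 1) 0) u v \<or>
    is_pair (UX False (c + 1) 0) (UX False c 0) u v \<or> is_pair (UX False c 0) (UA c) u v"
proof (cases u; cases v)
  fix i j assume "u = UA i" "v = UA j"
  then show ?thesis by (simp add: is_pair_def)
next
  fix i h a b assume e: "u = UA i" "v = UX h a b"
  have "i = a \<or> i = a + 1 \<longleftrightarrow> i = c \<and> a = c \<or> i = c + 3 \<and> a = c + 2"
    using assms unfolding e by auto
  then show ?thesis using assms unfolding e by (cases h) (simp_all add: is_pair_def, argo+)
next
  fix i h a b assume e: "v = UA i" "u = UX h a b"
  have "i = a \<or> i = a + 1 \<longleftrightarrow> i = c \<and> a = c \<or> i = c + 3 \<and> a = c + 2"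
    using assms unfolding e by auto
  then show ?thesis using assms unfolding e by (cases h) (simp_all add: is_pair_def, argo+)
next
  fix h a b h' a' b' assume e: "u = UX h a b" "v = UX h' a' b'"
  have "a' = a + 1 \<longleftrightarrow> a = c \<and> a' = c + 1 \<or> a = c + 1 \<and> a' = c + 2" "a = a' + 1 \<longleftrightarrow> a' = c \<and> a = c + 1 \<or> a' = c + 1 \<and> a = c + 2"
    using assms unfolding e by auto
  then show ?thesis using assms unfolding e by (cases h; cases h') (simp_all add: is_pair_def, argo+)
qed

context ladder begin

text \<open>Folding all polygons would leave \<open>UA t\<close> isolated, and the resulting cone
  would give no upper bound. Hence only the first \<open>s\<close> blocks are folded to a matching,
  and the last three polygons keep their cycle.\<close>

lemma not_conn_3:
  assumes t: "t = 3 * s + 3" and d: "d = 2 * t * m + 2 * s + 2"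
  shows "\<not> conn (ladj 0) (int d) (level 0)"
proof
  assume "conn (ladj 0) (int d) (level 0)"
  then have conn: "conn (ladj 0) (int d) (core s)" using t by (intro core_conn) auto
  have mate: "UA i \<notin> lmate ` mates s" "UX h a b \<in> lmate ` mates s \<longleftrightarrow> a < t \<and> (b \<le> 3 * m \<and> b mod 3 = 2 \<or>
        b = 0 \<and> a < 3 * s \<and> (h \<and> a mod 3 = 0 \<or> \<not> h \<and> a mod 3 = 1))" for i h a b
    using mate_iff[of s] t by auto
  have card: "card (mates s) = 2 * s + card ({} :: nat set) + 2 * t * m" "finite (mates s)"
    by (rule card_mates; use t in auto)+
  let ?c = "3 * s"
  let ?Z = "{UA ?c, UX True ?c 0, UX True (?c + 1) 0, UX True (?c + 2) 0, UA (?c + 3), UX False (?c + 2) 0, UX False (?c + 1) 0, UX False ?c 0}"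
  have Ziff: "UA i \<in> ?Z \<longleftrightarrow> i = ?c \<or> i = ?c + 3" "UX h a b \<in> ?Z \<longleftrightarrow> b = 0 \<and> ?c \<le> a \<and> a < ?c + 3" for i h a b
    by (cases h; auto)+
  have leftZ: "left s u \<longleftrightarrow> u \<notin> ?Z" if "u \<in> core s" for u
  proof (cases u)
    case (UA i)
    then show ?thesis using that by (simp only: Ziff core_iff left_def uvtx.case) auto
  next
    case (UX h a b)
    then have "a < t" using that by (simp add: core_iff)
    then have "a < 3 * s + 3" using t by simp
    then show ?thesis using UX by (simp only: Ziff left_def uvtx.case) auto
  qed
  have core_eq: "core s = mates s \<union> lmate ` mates s \<union> ?Z"
  proof (rule Set.set_eqI)
    fix u show "u \<in> core s \<longleftrightarrow> u \<in> mates s \<union> lmate ` mates s \<union> ?Z"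
    proof (cases u)
      case (UA i)
      show ?thesis unfolding UA Un_iff core_iff mates_iff Ziff using mate(1) t by auto
    next
      case (UX h a b)
      have "b mod 3 \<noteq> 0 \<longleftrightarrow> b mod 3 = 1 \<or> b mod 3 = 2" by presburger
      then show ?thesis unfolding UX Un_iff core_iff mates_iff Ziff mate(2) using t by auto
    qed
  qed
  have disjZ: "x \<notin> ?Z" if "x \<in> mates s \<union> lmate ` mates s" for x
  proof (cases x)
    case (UA i)
    then show ?thesis using that mate(1) by (simp only: Ziff Un_iff mates_iff) auto
  next
    case (UX h a b)
    have "b mod 3 \<noteq> 0 \<Longrightarrow> b \<noteq> 0" by auto
    then show ?thesis using that unfolding UX by (simp only: Ziff Un_iff mates_iff mate(2)) auto
  qed
  have nlm: "\<not> lmatch s u v" if "u \<in> ?Z" for u v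
    using disjZ[of u] that by (auto simp: lmatch_def)
  have "\<not> conn (ladj 0) (int d) (core s)"
  proof (rule matching_cycle_not_conn[OF card(2) inj_lmate _ _ disjZ core_eq])
    show "mates s \<inter> lmate ` mates s = {}" by (rule mates_disjoint) (use t in auto)
    show "d = card (mates s) + 2" using d card(1) by simp
    fix u v assume uv: "u \<in> core s" "v \<in> core s"
    let ?cyc = "{{UA ?c, UX True ?c 0}, {UX True ?c 0, UX True (?c + 1) 0}, {UX True (?c + 1) 0, UX True (?c + 2) 0},
      {UX True (?c + 2) 0, UA (?c + 3)}, {UA (?c + 3), UX False (?c + 2) 0}, {UX False (?c + 2) 0, UX False (?c + 1) 0},
      {UX False (?c + 1) 0, UX False ?c 0}, {UX False ?c 0, UA ?c}}"
    have cyc: "u \<in> ?Z \<and> v \<in> ?Z" if "{u, v} \<in> ?cyc"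
      using that by (auto simp: doubleton_eq_iff)
    have "ladj 0 u v \<longleftrightarrow> lmatch s u v \<or> {u, v} \<in> ?cyc"
    proof (cases "u \<in> ?Z \<and> v \<in> ?Z")
      case True
      then have "\<not> lmatch s u v" by (intro nlm) argo
      moreover have "ladj 0 u v \<longleftrightarrow> {u, v} \<in> ?cyc"
      proof -
        have "case x of UA i \<Rightarrow> i = ?c \<or> i = ?c + 3 | UX h a b \<Rightarrow> b = 0 \<and> ?c \<le> a \<and> a < ?c + 3" if "x \<in> ?Z" for x
          using that by (auto simp only: Ziff simp del: insert_iff split: uvtx.split)
        then show ?thesis using True ladj_cycle[of ?c u v] unfolding is_pair_iff by simp
      qed
      ultimately show ?thesis by argo
    next
      case False
      have "ladj 0 u v \<longleftrightarrow> lmatch s u v"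
      proof (cases "left s u")
        case True then show ?thesis by (rule left_adj[OF uv])
      next
        case nl: False
        then have "left s v" using leftZ[OF uv(1)] leftZ[OF uv(2)] False by argo
        then have "ladj 0 v u \<longleftrightarrow> lmatch s v u" by (rule left_adj[OF uv(2,1)])
        moreover have "ladj 0 v u \<longleftrightarrow> ladj 0 u v" by (cases u; cases v) auto
        moreover have "lmatch s v u \<longleftrightarrow> lmatch s u v" by (auto simp: lmatch_def)
        ultimately show ?thesis by simp
      qed
      moreover have "{u, v} \<notin> ?cyc"
      proof
        assume "{u, v} \<in> ?cyc"
        from cyc[OF this] False show False by argo
      qed
      ultimately show ?thesis by argo
    qed
    then show "ladj 0 u v \<longleftrightarrow> (u \<in> mates s \<and> v = lmate u \<or> v \<in> mates s \<and> u = lmate v) \<or> {u, v} \<in> ?cyc"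
      by (simp only: lmatch_def)
  qed simp
  then show False using conn by blast
qed

lemma Gverts_not_conn:
  assumes t: "t = 3 * s + e" "e \<in> {1, 2, 3}" and d: "Suc d = 2 * m * t + 2 * s + e"
  shows "\<not> conn (Gedge n t) (int d) (Gverts n t)"
proof
  assume "conn (Gedge n t) (int d) (Gverts n t)"
  then have "conn (ladj 0) (int d) (level 0)" by (rule level_bottom)
  moreover have d': "Suc d = 2 * t * m + 2 * s + e" using d by (simp add: mult.commute mult.left_commute)
  have "\<not> conn (ladj 0) (int d) (level 0)"
  proof (cases "e = 3")
    case True
    then show ?thesis using t d' by (intro not_conn_3[of s]) auto
  next
    case False
    then show ?thesis using t d' by (intro not_conn_12[of s e]) auto
  qed
  ultimately show False by blast
qed

end

theorem theorem3p8:
  fixes m n t s \<epsilon> :: nat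
  assumes "n = 3 * m + 2"
    and "t \<ge> 1"
    and "t = 3 * s + \<epsilon>" and "\<epsilon> \<in> {1, 2, 3}"
  shows "connectivity_eq (geom_real (indep_complex (Gverts n t) (Gedge n t)))
           (2 * int m * int t + 2 * (int s - 1) + int \<epsilon>)"
proof -
  interpret ladder m t .
  have n: "ladder.n m = n" using assms(1) by (simp add: n_def)
  have "t - 1 = 3 * s + (\<epsilon> - 1)" "\<epsilon> - 1 < 3" using assms(3,4) by auto
  then have "(t - 1) div 3 = s" by simp
  moreover have "int t = 3 * int s + int \<epsilon>" using assms(3) by simp
  ultimately have "2 * int m * int t + int t - 2 - int ((t - 1) div 3) = 2 * int m * int t + 2 * (int s - 1) + int \<epsilon>"
    by simp
  then have "conn (Gedge n t) (2 * int m * int t + 2 * (int s - 1) + int \<epsilon>) (Gverts n t)"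
    using Gverts_conn[OF assms(2)] unfolding n by metis
  moreover
  \<comment> \<open>\<open>Suc d\<close> is the number of edges of the final matching, so
    \<open>d\<close> exceeds the claimed connectivity by one. Since
    \<open>\<epsilon> \<ge> 1\<close>, the subtraction of naturals is exact.\<close>
  define d where "d = 2 * m * t + 2 * s + \<epsilon> - 1"
  have d: "Suc d = 2 * m * t + 2 * s + \<epsilon>" using assms(4) by (auto simp: d_def)
  then have "int d = 2 * int m * int t + 2 * (int s - 1) + int \<epsilon> + 1"
    by (auto dest: arg_cong[where f = int])
  then have "\<not> conn (Gedge n t) (2 * int m * int t + 2 * (int s - 1) + int \<epsilon> + 1) (Gverts n t)"
    using Gverts_not_conn[OF assms(3,4) d] unfolding n by metis
  ultimately show ?thesis unfolding connectivity_eq_def conn_def by blast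
qed

end
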